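(* Let $a,b,c,d\ge1$ and $e,f\ge0$ be integers with $\max(e,f)\ge1$ and $a+b+c+d+e+f=n$, and let $w\in\mathfrak S_n$ be the permutation with one-line notation $$(b+f+1..b+f+a:\;n-c-e+1..n-c:\;1..b:\;n-c+1..n:\;b+1..b+f:\;n-d-c-e+1..n-c-e)$$ (i.e. $w$ has block structure $[3][5][1][6][2][4]$ with block lengths $a,e,b,c,f,d$). Let $u\in\mathfrak S_n$. Then the coefficient $f_w(u)$ of $x_u$ in the Temperley-Lieb immanant $\operatorname{Imm}_w$ is as follows. (i) $f_w(u)=0$ if there exists $i\in[1,a+e]$ with $u(i)\in[1,b+f]$, or there exists $i\in[a+e+b+c+1,n]$ with $u(i)\in[b+f+a+d+1,n]$. (ii) Otherwise, $f_w(u)=\operatorname{sgn}(w)\operatorname{sgn}(u)\binom{A+B}{A}$, where $$A=c-|[a+e+1,a+e+b+c]\cap u^{-1}([b+f+a+d+1,n])|,$$ $$B=b-|[a+e+1,a+e+b+c]\cap u^{-1}([1,b+f])|,$$ and the binomial coefficient $\binom{A+B}{A}$ is taken to be zero if $A<0$ or $B<0$.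
   Context: Notation. $[p,q]=\{p,p+1,\dots,q\}$ (empty if $p>q$); $(p..q)$ denotes the sequence $p,p+1,\dots,q$ (empty if $p>q$), and colons denote concatenation of sequences. $\mathfrak S_n$ is the symmetric group on $[n]=[1,n]$ with product $(v\cdot w)(i)=v(w(i))$; $s_i=(i,i+1)$ for $1\le i\le n-1$. $x_{i,j}$ ($1\le i,j\le n$) are commuting variables, and $x_u=\prod_{i=1}^n x_{i,u(i)}$ for $u\in\mathfrak S_n$. A permutation is $321$-avoiding if there are no $i<j<k$ with $w(i)>w(j)>w(k)$ (the $w$ in the claim is $321$-avoiding). Temperley-Lieb immanants. $TL_n(2)$ is the unital associative $\mathbb C$-algebra generated by $t_1,\dots,t_{n-1}$ with relations $t_i^2=2t_i$, $t_it_j=t_jt_i$ if $|i-j|\ge2$, and $t_it_jt_i=t_i$ if $|i-j|=1$. Let $\theta:\mathbb C[\mathfrak S_n]\to TL_n(2)$ be the $\mathbb C$-algebra homomorphism with $\theta(s_i)=t_i-1$. For a $321$-avoiding $w\in\mathfrak S_n$ with reduced word $s_{i_1}\cdots s_{i_k}$, put $\beta(w)=t_{i_1}\cdots t_{i_k}$; this does not depend on the reduced word, and the $\beta(w)$, over $321$-avoiding $w\in\mathfrak S_n$, form a basis of $TL_n(2)$. For $u\in\mathfrak S_n$ let $f_w(u)$ be the coefficient of $\beta(w)$ in the expansion of $\theta(u)$ in this basis, and $\operatorname{Imm}_w=\sum_{u\in\mathfrak S_n}f_w(u)x_u$. (The integer $f$ is unrelated to the function $f_w$.) *)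

theory Defs
  imports
    "HOL-Algebra.QuotRing"
    "HOL-Algebra.Module"
    "HOL-Algebra.Sym_Groups"
    "HOL-Library.Poly_Mapping"
    Complex_Main
begin

section \<open>Complex associative algebras\<close>

text \<open>
  A complex associative algebra is represented by a record of type
  \<open>(complex, 'b) module\<close>, whose ring multiplication need not be commutative.
\<close>

definition algebra_hom ::
    "(complex, 'a, 'm) module_scheme \<Rightarrow> (complex, 'b, 'k) module_scheme \<Rightarrow> ('a \<Rightarrow> 'b) set" where
  "algebra_hom R S =
    {h \<in> ring_hom R S. \<forall>c. \<forall>x \<in> carrier R. h (c \<odot>\<^bsub>R\<^esub> x) = c \<odot>\<^bsub>S\<^esub> h x}"

text \<open>The library quotient \<open>R Quot I\<close> only provides the ring structure; scalars act on
  representatives.\<close>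

definition quotient_algebra ::
    "(complex, 'a, 'm) module_scheme \<Rightarrow> 'a set \<Rightarrow> (complex, 'a set) module" where
  "quotient_algebra R I =
    ring.extend (R Quot I) (module.fields (\<lambda>c X. \<Union>x\<in>X. I +>\<^bsub>R\<^esub> (c \<odot>\<^bsub>R\<^esub> x)))"

text \<open>The algebra of finitely supported complex functions on a monoid \<open>M\<close>, with convolution.\<close>

definition monoid_algebra :: "('a, 'm) monoid_scheme \<Rightarrow> (complex, 'a \<Rightarrow> complex) module" where
  "monoid_algebra M =
    \<lparr>carrier = {p. finite {x. p x \<noteq> 0} \<and> {x. p x \<noteq> 0} \<subseteq> carrier M},
     monoid.mult = (\<lambda>p q z. \<Sum>x | p x \<noteq> 0. \<Sum>y | q y \<noteq> 0. if x \<otimes>\<^bsub>M\<^esub> y = z then p x * q y else 0),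
     one = (\<lambda>x. if x = \<one>\<^bsub>M\<^esub> then 1 else 0),
     zero = (\<lambda>x. 0),
     add = (\<lambda>p q x. p x + q x),
     smult = (\<lambda>c p x. c * p x)\<rparr>"

definition delta :: "'a \<Rightarrow> 'a \<Rightarrow> complex" where
  "delta x = (\<lambda>y. if y = x then 1 else 0)"

definition free_monoid :: "'a set \<Rightarrow> 'a list monoid" where
  "free_monoid X = \<lparr>carrier = lists X, monoid.mult = (@), one = []\<rparr>"

abbreviation free_algebra :: "'a set \<Rightarrow> (complex, 'a list \<Rightarrow> complex) module" where
  "free_algebra X \<equiv> monoid_algebra (free_monoid X)"

abbreviation sym_group_algebra :: "nat \<Rightarrow> (complex, (nat \<Rightarrow> nat) \<Rightarrow> complex) module" where
  "sym_group_algebra n \<equiv> monoid_algebra (sym_group n)"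


section \<open>Reduced words and 321-avoiding permutations\<close>

definition simple_transposition :: "nat \<Rightarrow> nat \<Rightarrow> nat" where
  "simple_transposition i = transpose i (i + 1)"

definition word_of :: "nat \<Rightarrow> (nat \<Rightarrow> nat) \<Rightarrow> nat list \<Rightarrow> bool" where
  "word_of n w is \<longleftrightarrow> is \<in> lists {1..<n} \<and> foldr (\<circ>) (map simple_transposition is) id = w"

definition reduced_word :: "nat \<Rightarrow> (nat \<Rightarrow> nat) \<Rightarrow> nat list \<Rightarrow> bool" where
  "reduced_word n w is \<longleftrightarrow>
    word_of n w is \<and> (\<forall>js. word_of n w js \<longrightarrow> length is \<le> length js)"

definition perms_avoiding_321 :: "nat \<Rightarrow> (nat \<Rightarrow> nat) set" where
  "perms_avoiding_321 n =
    {w. w permutes {1..n} \<and>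
        \<not> (\<exists>i\<in>{1..n}. \<exists>j\<in>{1..n}. \<exists>k\<in>{1..n}. i < j \<and> j < k \<and> w i > w j \<and> w j > w k)}"


section \<open>The Temperley-Lieb algebra with parameter 2\<close>

definition TL_relators :: "nat \<Rightarrow> (nat list \<Rightarrow> complex) set" where
  "TL_relators n = (let F = free_algebra {1..<n}; T = (\<lambda>i. delta [i]) in
     {T i \<otimes>\<^bsub>F\<^esub> T i \<ominus>\<^bsub>F\<^esub> 2 \<odot>\<^bsub>F\<^esub> T i | i. i \<in> {1..<n}}
   \<union> {T i \<otimes>\<^bsub>F\<^esub> T j \<ominus>\<^bsub>F\<^esub> T j \<otimes>\<^bsub>F\<^esub> T i | i j.
        i \<in> {1..<n} \<and> j \<in> {1..<n} \<and> \<bar>int i - int j\<bar> \<ge> 2}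
   \<union> {T i \<otimes>\<^bsub>F\<^esub> T j \<otimes>\<^bsub>F\<^esub> T i \<ominus>\<^bsub>F\<^esub> T i | i j.
        i \<in> {1..<n} \<and> j \<in> {1..<n} \<and> \<bar>int i - int j\<bar> = 1})"

definition TL_ideal :: "nat \<Rightarrow> (nat list \<Rightarrow> complex) set" where
  "TL_ideal n = genideal (free_algebra {1..<n}) (TL_relators n)"

definition TL :: "nat \<Rightarrow> (complex, (nat list \<Rightarrow> complex) set) module" where
  "TL n = quotient_algebra (free_algebra {1..<n}) (TL_ideal n)"

definition TL_gen :: "nat \<Rightarrow> nat \<Rightarrow> (nat list \<Rightarrow> complex) set" where
  "TL_gen n i = TL_ideal n +>\<^bsub>free_algebra {1..<n}\<^esub> delta [i]"

text \<open>Extensionality only fixes the irrelevant values outside the group algebra.\<close>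

definition TL_theta :: "nat \<Rightarrow> ((nat \<Rightarrow> nat) \<Rightarrow> complex) \<Rightarrow> (nat list \<Rightarrow> complex) set" where
  "TL_theta n = (THE h. h \<in> extensional (carrier (sym_group_algebra n)) \<and>
     h \<in> algebra_hom (sym_group_algebra n) (TL n) \<and>
     (\<forall>i\<in>{1..<n}. h (delta (simple_transposition i)) = TL_gen n i \<ominus>\<^bsub>TL n\<^esub> \<one>\<^bsub>TL n\<^esub>))"

definition TL_beta :: "nat \<Rightarrow> (nat \<Rightarrow> nat) \<Rightarrow> (nat list \<Rightarrow> complex) set" where
  "TL_beta n w =
    foldr (monoid.mult (TL n)) (map (TL_gen n) (SOME is. reduced_word n w is)) \<one>\<^bsub>TL n\<^esub>"

text \<open>\<open>TL_coeff n w u\<close> is the coefficient of \<open>TL_beta n w\<close> in the expansion of the image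
  of \<open>u\<close> in the basis of all \<open>TL_beta n v\<close> with \<open>v\<close> avoiding 321.\<close>

definition TL_coeff :: "nat \<Rightarrow> (nat \<Rightarrow> nat) \<Rightarrow> (nat \<Rightarrow> nat) \<Rightarrow> complex" where
  "TL_coeff n w u =
    (THE g. g \<in> extensional (perms_avoiding_321 n) \<and>
       TL_theta n (delta u) =
         finsum (TL n) (\<lambda>v. g v \<odot>\<^bsub>TL n\<^esub> TL_beta n v) (perms_avoiding_321 n)) w"


section \<open>Temperley-Lieb immanants\<close>

text \<open>Polynomials in the variables \<open>x\<^sub>i\<^sub>j\<close>: a monomial is a finitely supported map from index
  pairs \<open>(i, j)\<close> to exponents.\<close>

type_synonym matrix_monomial = "(nat \<times> nat) \<Rightarrow>\<^sub>0 nat"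
type_synonym matrix_poly = "matrix_monomial \<Rightarrow>\<^sub>0 complex"

definition perm_monomial :: "nat \<Rightarrow> (nat \<Rightarrow> nat) \<Rightarrow> matrix_monomial" where
  "perm_monomial n u = (\<Sum>i\<in>{1..n}. Poly_Mapping.single (i, u i) 1)"

definition TL_immanant :: "nat \<Rightarrow> (nat \<Rightarrow> nat) \<Rightarrow> matrix_poly" where
  "TL_immanant n w =
    (\<Sum>u | u permutes {1..n}. Poly_Mapping.single (perm_monomial n u) (TL_coeff n w u))"

end

theory Submission
  imports Defs "HOL-Library.Function_Algebras"
begin

text \<open>
  The algebra \<open>TL\<^sub>n(2)\<close> acts on words of length \<open>n\<close> in two colours by \<open>t\<^sub>i = 1 - s\<^sub>i\<close>, where \<open>s\<^sub>i\<close>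
  swaps two adjacent letters, and \<open>\<theta>(u)\<close> then acts as \<open>sgn(u)\<close> times the permutation of the letters.
  The \<open>\<beta>(v)\<close> span the algebra, and the signed 321-avoiding permutations act independently; hence
  the representation is faithful, and the coefficients can be computed in it.

  Let \<open>X\<close> be the sum of all words of colour 1 on the first \<open>a + e\<close> letters and of colour 0 on the
  last \<open>f + d\<close> letters, and let \<open>Y\<close> be the sum of all words of colour 0 on the first \<open>b + f\<close> and of
  colour 1 on the last \<open>c + e\<close> letters, both with \<open>a + c + e\<close> letters of colour 1 altogether. Then
  \<open>\<langle>Y, \<theta>(u) X\<rangle>\<close> is \<open>sgn(u)\<close> times the number of words in \<open>X\<close> that \<open>u\<close> maps into \<open>Y\<close>, which is the
  binomial coefficient of the theorem or zero. On the other hand \<open>\<langle>Y, \<beta>(v) X\<rangle> = 0\<close> for \<open>v \<noteq> w\<close>: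
  since \<open>t\<^sub>i X = 0\<close> and \<open>Y t\<^sub>i = 0\<close> inside the blocks, \<open>v\<close> may be assumed to be increasing on the three
  blocks of positions and \<open>v\<inverse>\<close> on the three blocks of values. Then the colours of the lines of \<open>v\<close>
  are forced one after the other, and they are consistent only for \<open>v = w\<close>.
\<close>

section \<open>Permutations, inversions and reduced words\<close>

text \<open>Both the homomorphism and the coefficient function are specified by \<open>THE\<close>,
  so existence and uniqueness are owed for each. Existence of the expansion comes from rewriting
  words, uniqueness from independence of the operators. Faithfulness turns a coset of the ideal into
  the set of all elements with one given action; theta can then be defined by its action alone,
  without a presentation of the symmetric group. Row vectors are used because a right action lets a
  reduced word be stripped at its last letter, that is, at a descent of the permutation. The
  obstacle is the set of permutations that the block symmetries do not exclude. Their lines are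
  forced by removing extreme values one at a time, on intervals that shrink; therefore length,
  avoidance and the operators are defined without reference to n. The pairing of Y with beta(w) X is
  never evaluated directly. It is shown to be 0 or sgn(w), and 0 is excluded by the coefficient
  identity at u = w, where the count of words is positive.\<close>

abbreviation st :: "nat \<Rightarrow> nat \<Rightarrow> nat" where "st \<equiv> simple_transposition"

lemma st_apply: "st i j = (if j = i then Suc i else if j = Suc i then i else j)"
  by (simp add: simple_transposition_def transpose_def)

lemma st_at [simp]: "st i i = Suc i" "st i (Suc i) = i"
  by (simp_all add: st_apply)

lemma st_other [simp]: "j \<noteq> i \<Longrightarrow> j \<noteq> Suc i \<Longrightarrow> st i j = j"
  by (simp add: st_apply)

lemma st_st [simp]: "st i (st i j) = j"
  by (simp add: st_apply)

lemma st_comp_st [simp]: "st i \<circ> st i = id"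
  by (simp add: fun_eq_iff)

lemma comp_st_st [simp]: "v \<circ> st i \<circ> st i = v"
  by (simp add: fun_eq_iff)

lemma bij_st [simp]: "bij (st i)"
  by (rule o_bij[where g = "st i"]) simp_all

lemma st_permutes: "i \<in> {lo..<hi} \<Longrightarrow> st i permutes {lo..hi}"
  by (auto simp: simple_transposition_def intro: permutes_swap_id)

lemma permutation_st [simp]: "permutation (st i)"
  by (simp add: simple_transposition_def permutation_swap_id)

lemma permutation_comp_st [simp]: "permutation (v \<circ> st i) \<longleftrightarrow> permutation v"
  using permutation_compose[of "v \<circ> st i" "st i"] permutation_compose[of v "st i"] by auto

lemma comp_st_permutes: "v permutes {lo..hi} \<Longrightarrow> i \<in> {lo..<hi} \<Longrightarrow> v \<circ> st i permutes {lo..hi}"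
  by (simp add: permutes_compose st_permutes)

lemma sign_st [simp]: "sign (st i) = -1"
  by (simp add: simple_transposition_def sign_swap_id)

lemma sign_comp_st: "permutation v \<Longrightarrow> sign (v \<circ> st i) = - sign v"
  by (simp add: sign_compose)

text \<open>Pairs range over all natural numbers, so the length of a permutation does not depend on
  the interval in which it is considered.\<close>

definition inversions :: "(nat \<Rightarrow> nat) \<Rightarrow> (nat \<times> nat) set" where
  "inversions v = {(i, j). i < j \<and> v j < v i}"

lemma finite_inversions:
  assumes "permutation v" shows "finite (inversions v)"
proof -
  obtain N where N: "\<And>x. v x \<noteq> x \<Longrightarrow> x \<le> N"
    using permutation[of v] assms by (auto simp: finite_nat_set_iff_bounded_le)
  have inj: "inj v" using assms permutation bij_is_inj by blast
  have le: "v x \<le> N" if "x \<le> N" for x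
    using N[of "v x"] inj that by (metis injD)
  have "inversions v \<subseteq> {..N} \<times> {..N}"
    unfolding inversions_def
  proof clarsimp
    fix i j assume ij: "i < j" "v j < v i"
    show "i \<le> N \<and> j \<le> N" using N[of i] N[of j] le[of i] le[of j] ij
      by (metis leD le_trans less_imp_le linorder_le_cases order_less_trans)
  qed
  thus ?thesis by (rule finite_subset) simp
qed

text \<open>Relabelling positions by \<open>st i\<close> keeps the order of every pair except
  \<open>(i, Suc i)\<close>, so that pair is the only new inversion.\<close>

lemma card_inversions_comp_st:
  assumes "permutation v" "v i < v (Suc i)"
  shows "card (inversions (v \<circ> st i)) = Suc (card (inversions v))"
proof -
  have "(x, y) \<in> inversions (v \<circ> st i) \<longleftrightarrow> (x, y) = (i, Suc i) \<or> (st i x, st i y) \<in> inversions v" for x y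
    using assms(2) by (cases "x = i"; cases "x = Suc i"; cases "y = i"; cases "y = Suc i")
      (auto simp: inversions_def)
  moreover have "(x, y) \<in> map_prod (st i) (st i) ` inversions v \<longleftrightarrow> (st i x, st i y) \<in> inversions v" for x y
    by (force simp: image_iff)
  ultimately have eq: "inversions (v \<circ> st i) = insert (i, Suc i) (map_prod (st i) (st i) ` inversions v)"
    by auto
  have "inj (map_prod (st i) (st i))"
    by (rule prod.inj_map) (simp_all add: bij_is_inj)
  hence "card (map_prod (st i) (st i) ` inversions v) = card (inversions v)"
    by (metis card_image inj_on_subset subset_UNIV)
  moreover have "(i, Suc i) \<notin> map_prod (st i) (st i) ` inversions v"
    using assms(2) by (force simp: inversions_def st_apply split: if_splits)
  ultimately show ?thesis unfolding eq
    using finite_inversions[OF assms(1)] by simp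
qed

lemma card_inversions_descent:
  assumes "permutation v" "v i > v (Suc i)"
  shows "card (inversions v) = Suc (card (inversions (v \<circ> st i)))"
  using card_inversions_comp_st[of "v \<circ> st i" i] assms by simp

lemma permutation_ascent_or_descent:
  "permutation v \<Longrightarrow> v i < v (Suc i) \<or> v i > v (Suc i)"
  by (metis permutation bij_is_inj injD less_linear n_not_Suc_n)

definition word_perm :: "nat list \<Rightarrow> nat \<Rightarrow> nat" where
  "word_perm is = foldr (\<circ>) (map st is) id"

lemma word_perm_simps [simp]: "word_perm [] = id" "word_perm (i # is) = st i \<circ> word_perm is"
  by (simp_all add: word_perm_def)

lemma word_perm_append: "word_perm (xs @ ys) = word_perm xs \<circ> word_perm ys"
  by (induction xs) (simp_all add: o_assoc)

lemma word_perm_snoc: "word_perm (is @ [i]) = word_perm is \<circ> st i"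
  by (simp only: word_perm_append word_perm_simps comp_id)

lemma permutation_word_perm [simp]: "permutation (word_perm is)"
proof (induction "is")
  case (Cons i "is") thus ?case unfolding word_perm_simps by (intro permutation_compose permutation_st)
qed simp

lemma word_perm_permutes: "set is \<subseteq> {lo..<hi} \<Longrightarrow> word_perm is permutes {lo..hi}"
proof (induction "is")
  case (Cons i "is") thus ?case
    unfolding word_perm_simps by (intro permutes_compose st_permutes) simp_all
qed (simp add: permutes_id)

lemma inversions_id [simp]: "inversions id = {}" "inversions (\<lambda>x. x) = {}"
  by (auto simp: inversions_def)

lemma card_inversions_word_perm: "card (inversions (word_perm is)) \<le> length is"
proof (induction "is" rule: rev_induct)
  case Nil show ?case by simp
next
  case (snoc i "is")
  have "card (inversions (word_perm is \<circ> st i)) \<le> Suc (card (inversions (word_perm is)))"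
    using permutation_ascent_or_descent[of "word_perm is" i]
    by (auto simp: card_inversions_comp_st card_inversions_descent)
  with snoc show ?case unfolding word_perm_snoc length_append list.size by linarith
qed

text \<open>Measured by inversions instead of by comparison with other words;
  \<open>reduced_word_iff\<close> shows the agreement with minimal length.\<close>

definition reduced :: "(nat \<Rightarrow> nat) \<Rightarrow> nat list \<Rightarrow> bool" where
  "reduced v is \<longleftrightarrow> word_perm is = v \<and> length is = card (inversions v)"

lemma reduced_snoc:
  "reduced (v \<circ> st i) is \<Longrightarrow> v (Suc i) < v i \<Longrightarrow> reduced v (is @ [i])"
  unfolding reduced_def using permutation_word_perm[of "is"]
  by (auto simp: word_perm_append card_inversions_descent)

lemma reduced_snocD:
  assumes "reduced v (is @ [i])"
  shows "v (Suc i) < v i" "reduced (v \<circ> st i) is"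
proof -
  have v: "v = word_perm is \<circ> st i" and l: "Suc (length is) = card (inversions v)"
    using assms by (auto simp: reduced_def word_perm_append)
  have w: "word_perm is = v \<circ> st i" and p: "permutation v" by (simp_all add: v)
  show "v (Suc i) < v i"
    using permutation_ascent_or_descent[OF p, of i] card_inversions_comp_st[OF p, of i] l
      card_inversions_word_perm[of "is"] unfolding w by auto
  from card_inversions_descent[OF p this] l w show "reduced (v \<circ> st i) is"
    by (simp add: reduced_def)
qed

text \<open>A strictly increasing map never lies below the identity; this holds for \<open>v\<close>
  and for its inverse.\<close>

lemma ascending_imp_id:
  assumes "bij v" "\<And>i. v i < v (Suc i)" shows "v = id"
proof -
  have m: "strict_mono v" using assms(2) by (simp add: strict_mono_Suc_iff)
  have "strict_mono (inv' v)"
    unfolding strict_mono_def by (metis assms(1) bij_inv_eq_iff m strict_mono_less)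
  hence "\<And>i. i \<le> inv' v i" by (rule strict_mono_imp_increasing)
  hence "v i \<le> v (inv' v i)" for i using m by (simp add: strict_mono_less_eq)
  hence "v i \<le> i" for i using assms(1) by (simp add: bij_is_surj surj_f_inv_f)
  moreover have "i \<le> v i" for i using m by (rule strict_mono_imp_increasing)
  ultimately show ?thesis by (auto simp: fun_eq_iff le_antisym)
qed

lemma permutes_ascending_imp_id:
  assumes "v permutes {lo..hi}" "\<And>i. lo \<le> i \<Longrightarrow> i < hi \<Longrightarrow> v i < v (Suc i)" shows "v = id"
proof (rule ascending_imp_id)
  show "bij v" using assms(1) by (rule permutes_bij)
  fix i
  have *: "\<And>x. v x \<in> {lo..hi} \<longleftrightarrow> x \<in> {lo..hi}" "\<And>x. x \<notin> {lo..hi} \<Longrightarrow> v x = x"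
    using assms(1) permutes_in_image permutes_not_in by metis+
  show "v i < v (Suc i)"
  proof (cases "lo \<le> i \<and> i < hi")
    case False
    then show ?thesis using *[of i] *[of "Suc i"] by (cases "i \<in> {lo..hi}"; cases "Suc i \<in> {lo..hi}") auto
  qed (use assms in auto)
qed

lemma reduced_exists:
  assumes "v permutes {lo..hi}" shows "\<exists>is. set is \<subseteq> {lo..<hi} \<and> reduced v is"
  using assms
proof (induction "card (inversions v)" arbitrary: v)
  case 0
  moreover have "permutation v" using 0(2) permutation_permutes by auto
  ultimately have "inversions v = {}" using finite_inversions by simp
  hence "v i < v (Suc i)" for i
    using permutation_ascent_or_descent[of v i] permutation_permutes[of v] 0(2)
    by (auto simp: inversions_def)
  hence "v = id" using permutes_bij[OF 0(2)] ascending_imp_id by blast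
  thus ?case by (intro exI[of _ "[]"]) (auto simp: reduced_def)
next
  case (Suc k)
  have p: "permutation v" using Suc.prems permutation_permutes by auto
  have "v \<noteq> id" using Suc.hyps(2) by auto
  then obtain i where i: "i \<in> {lo..<hi}" "v (Suc i) < v i"
    using permutes_ascending_imp_id[OF Suc.prems] permutation_ascent_or_descent[OF p]
    by (meson atLeastLessThan_iff)
  then obtain "is" where "set is \<subseteq> {lo..<hi}" "reduced (v \<circ> st i) is"
    using Suc.hyps(1)[of "v \<circ> st i"] Suc.hyps(2) card_inversions_descent[OF p i(2)]
      comp_st_permutes[OF Suc.prems i(1)] by auto
  thus ?case using i by (intro exI[of _ "is @ [i]"]) (auto intro: reduced_snoc)
qed

lemma word_of_iff: "word_of n w is \<longleftrightarrow> set is \<subseteq> {1..<n} \<and> word_perm is = w"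
  by (auto simp: word_of_def word_perm_def)

lemma reduced_word_iff:
  assumes "w permutes {1..n}"
  shows "reduced_word n w is \<longleftrightarrow> set is \<subseteq> {1..<n} \<and> reduced w is"
proof -
  obtain js where js: "word_of n w js" "length js = card (inversions w)"
    using reduced_exists[OF assms] by (auto simp: word_of_iff reduced_def)
  have ge: "card (inversions w) \<le> length is" if "word_of n w is" for "is"
    using that card_inversions_word_perm by (auto simp: word_of_iff)
  show ?thesis
  proof
    assume "reduced_word n w is"
    with js ge[of "is"] show "set is \<subseteq> {1..<n} \<and> reduced w is"
      by (auto simp: reduced_word_def reduced_def word_of_iff)
  next
    assume "set is \<subseteq> {1..<n} \<and> reduced w is"
    with ge show "reduced_word n w is"
      by (auto simp: reduced_word_def reduced_def word_of_iff)
  qed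
qed

lemma inversions_rev: 
  "bij_betw (\<lambda>(i, j). (v j, v i)) (inversions v) (inversions (inv' v))" if "bij v"
  by (rule bij_betw_byWitness[where f' = "\<lambda>(i, j). (inv' v j, inv' v i)"])
     (use that in \<open>auto simp: inversions_def bij_is_inj bij_is_surj surj_f_inv_f\<close>)

lemma word_perm_rev: "word_perm (rev is) = inv' (word_perm is)"
proof (rule sym, rule inv_unique_comp)
  show "word_perm is \<circ> word_perm (rev is) = id"
  proof (induction "is")
    case (Cons i "is")
    have "word_perm (i # is) \<circ> word_perm (rev (i # is)) = st i \<circ> (word_perm is \<circ> word_perm (rev is)) \<circ> st i"
      by (simp only: word_perm_append word_perm_simps rev.simps o_assoc comp_id)
    with Cons show ?case by (simp only: comp_id st_comp_st)
  qed simp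
  show "word_perm (rev is) \<circ> word_perm is = id"
  proof (induction "is" rule: rev_induct)
    case (snoc i "is")
    have "word_perm (rev (is @ [i])) \<circ> word_perm (is @ [i]) = st i \<circ> (word_perm (rev is) \<circ> word_perm is) \<circ> st i"
      by (simp only: word_perm_append word_perm_simps rev_append rev.simps append.simps o_assoc comp_id)
    with snoc show ?case by (simp only: comp_id st_comp_st)
  qed simp
qed

lemma reduced_rev:
  assumes "reduced v is" shows "reduced (inv' v) (rev is)"
proof -
  have "bij v" using assms permutation_word_perm[of "is"] permutation by (auto simp: reduced_def)
  from bij_betw_same_card[OF inversions_rev[OF this]] show ?thesis
    using assms word_perm_rev[of "is"] by (simp add: reduced_def)
qed

text \<open>Descents of the inverse are the possible first letters: strip the last letter of a
  reduced word of \<open>inv' v\<close> and reverse.\<close>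

lemma reduced_Cons:
  assumes v: "v permutes {lo..hi}" and i: "inv' v (Suc i) < inv' v i" "i \<in> {lo..<hi}"
  shows "\<exists>is. set is \<subseteq> {lo..<hi} \<and> reduced v (i # is)"
proof -
  have "inv' v permutes {lo..hi}" using v by (rule permutes_inv)
  then obtain "is" where "set is \<subseteq> {lo..<hi}" "reduced (inv' v \<circ> st i) is"
    using comp_st_permutes[OF _ i(2)] reduced_exists by metis
  with reduced_snoc[of "inv' v" i "is"] i have "reduced (inv' (inv' v)) (rev (is @ [i]))"
    by (intro reduced_rev) auto
  moreover have "inv' (inv' v) = v" using v by (simp add: permutes_bij inv_inv_eq)
  ultimately show ?thesis using \<open>set is \<subseteq> _\<close> by (intro exI[of _ "rev is"]) auto
qed

section \<open>Avoidance of 321 and commutation of reduced words\<close>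

definition avoids_321 :: "(nat \<Rightarrow> nat) \<Rightarrow> bool" where
  "avoids_321 v \<longleftrightarrow> (\<forall>i j k. i < j \<longrightarrow> j < k \<longrightarrow> v j < v i \<longrightarrow> v k < v j \<longrightarrow> False)"

lemma avoids_321D: "avoids_321 v \<Longrightarrow> i < j \<Longrightarrow> j < k \<Longrightarrow> v j < v i \<Longrightarrow> \<not> v k < v j"
  by (auto simp: avoids_321_def)

text \<open>A point outside \<open>{1..n}\<close> is fixed and belongs to no inversion, so dropping
  the range restrictions adds no pattern.\<close>

lemma perms_avoiding_321_iff:
  "v \<in> perms_avoiding_321 n \<longleftrightarrow> v permutes {1..n} \<and> avoids_321 v"
proof -
  have "i \<in> {1..n} \<and> j \<in> {1..n} \<and> k \<in> {1..n}"
    if v: "v permutes {1..n}" and h: "i < j" "j < k" "v j < v i" "v k < v j" for i j k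
  proof -
    have *: "\<And>x. v x \<in> {1..n} \<longleftrightarrow> x \<in> {1..n}" "\<And>x. x \<notin> {1..n} \<Longrightarrow> v x = x"
      using v permutes_in_image permutes_not_in by metis+
    show ?thesis using *[of i] *[of j] *[of k] h
      by (cases "i \<in> {1..n}"; cases "j \<in> {1..n}"; cases "k \<in> {1..n}") auto
  qed
  thus ?thesis unfolding perms_avoiding_321_def avoids_321_def by blast
qed

lemma avoids_321_comp_st:
  assumes "avoids_321 v" "v (Suc i) < v i" shows "avoids_321 (v \<circ> st i)"
  unfolding avoids_321_def
proof (intro allI impI)
  fix x y z assume "x < y" "y < z" "(v \<circ> st i) y < (v \<circ> st i) x" "(v \<circ> st i) z < (v \<circ> st i) y"
  moreover from this have "st i x < st i y" "st i y < st i z" using assms(2)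
    by (auto simp: st_apply split: if_splits)
  ultimately show False using avoids_321D[OF assms(1), of "st i x" "st i y" "st i z"] by simp
qed

text \<open>Two adjacent descents would form a 321 pattern on three consecutive positions.\<close>

lemma descents_far_apart:
  assumes "avoids_321 v" "v (Suc i) < v i" "v (Suc j) < v j" "i \<noteq> j"
  shows "Suc i < j \<or> Suc j < i"
  using avoids_321D[OF assms(1), of i "Suc i" "Suc (Suc i)"]
    avoids_321D[OF assms(1), of j "Suc j" "Suc (Suc j)"] assms
  by (metis lessI linorder_neqE_nat not_less_eq)

text \<open>In other words, two reduced words of a 321-avoiding permutation differ by commutations only.\<close>

lemma reduced_commutation_invariant:
  fixes f :: "nat list \<Rightarrow> 'b"
  assumes "avoids_321 v" "v permutes {lo..hi}"
    and "set is \<subseteq> {lo..<hi}" "set js \<subseteq> {lo..<hi}" "reduced v is" "reduced v js"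
    and comm: "\<And>xs ys i j. set (xs @ i # j # ys) \<subseteq> {lo..<hi} \<Longrightarrow> Suc i < j \<or> Suc j < i \<Longrightarrow>
                 f (xs @ i # j # ys) = f (xs @ j # i # ys)"
  shows "f is = f js"
  using assms
proof (induction "length is" arbitrary: v "is" js f)
  case 0
  hence "length is = 0" "length js = 0" by (auto simp: reduced_def)
  thus ?case by simp
next
  case (Suc k)
  have "length is = length js" using Suc.prems by (simp add: reduced_def)
  with Suc.hyps obtain is' i js' j where eq: "is = is' @ [i]" "js = js' @ [j]"
    by (metis length_Suc_conv_rev)
  have red: "reduced (v \<circ> st i) is'" "reduced (v \<circ> st j) js'"
    and d: "v (Suc i) < v i" "v (Suc j) < v j"
    using Suc.prems reduced_snocD unfolding eq by blast+
  have av: "avoids_321 (v \<circ> st i)" "avoids_321 (v \<circ> st j)" 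
    using avoids_321_comp_st Suc.prems d by blast+
  have ij: "i \<in> {lo..<hi}" "j \<in> {lo..<hi}" using Suc.prems unfolding eq by auto
  note pv = comp_st_permutes[OF Suc.prems(2) ij(1)] comp_st_permutes[OF Suc.prems(2) ij(2)]
  have len: "k = length is'" "k = length js'" using Suc.hyps(2) \<open>length is = length js\<close> eq by auto
  have IH: "f (xs @ [m]) = f (ys @ [m])"
    if "m \<in> {lo..<hi}" "avoids_321 v'" "v' permutes {lo..hi}" "k = length xs"
      "set xs \<subseteq> {lo..<hi}" "set ys \<subseteq> {lo..<hi}" "reduced v' xs" "reduced v' ys" for v' m xs ys
  proof (rule Suc.hyps(1)[OF that(4,2,3,5-8), of "\<lambda>zs. f (zs @ [m])"])
    fix as bs i j assume "set (as @ i # j # bs) \<subseteq> {lo..<hi}" "Suc i < j \<or> Suc j < i"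
    thus "f ((as @ i # j # bs) @ [m]) = f ((as @ j # i # bs) @ [m])"
      using Suc.prems(7)[of as i j "bs @ [m]"] that(1) by simp
  qed
  show ?case
  proof (cases "i = j")
    case True
    then show ?thesis using IH[of i "v \<circ> st i" is' js'] red Suc.prems ij av pv len unfolding eq by auto
  next
    case False
    note far = descents_far_apart[OF Suc.prems(1) d False]
    \<comment> \<open>The last letters \<open>i\<close> and \<open>j\<close> commute, so
      \<open>v\<close> also has reduced words ending in \<open>j, i\<close> and in
      \<open>i, j\<close> with a common beginning. The given words are joined through these
      two.\<close>
    obtain ks where ks: "set ks \<subseteq> {lo..<hi}" "reduced (v \<circ> st i \<circ> st j) ks"
      using reduced_exists comp_st_permutes[OF pv(1) ij(2)] by blast
    have sw: "v \<circ> st i \<circ> st j = v \<circ> st j \<circ> st i" using far by (auto simp: fun_eq_iff st_apply)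
    have r1: "reduced (v \<circ> st i) (ks @ [j])"
      by (rule reduced_snoc[OF ks(2)]) (use far d in auto)
    have r2: "reduced (v \<circ> st j) (ks @ [i])"
      by (rule reduced_snoc[OF ks(2)[unfolded sw]]) (use far d in auto)
    have "f is = f ((ks @ [j]) @ [i])"
      unfolding eq using IH[OF ij(1) av(1) pv(1) len(1) _ _ red(1) r1] Suc.prems ks ij unfolding eq by auto
    also have "\<dots> = f ((ks @ [i]) @ [j])"
      using Suc.prems(7)[of ks j i "[]"] far ks ij by auto
    also have "\<dots> = f js"
      unfolding eq using IH[OF ij(2) av(2) pv(2) _ _ _ r2 red(2)] Suc.prems ks ij len r2 red
      unfolding eq by (auto simp: reduced_def)
    finally show ?thesis .
  qed
qed

section \<open>Operators on colourings\<close>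

text \<open>A set of positions stands for the word that has colour 1 exactly there; \<open>tact i\<close> is the right
  action of \<open>t\<^sub>i\<close> on row vectors.\<close>

definition tact :: "nat \<Rightarrow> (nat set \<Rightarrow> complex) \<Rightarrow> nat set \<Rightarrow> complex" where
  "tact i \<Phi> I = \<Phi> I - \<Phi> (st i ` I)"

definition wact :: "nat list \<Rightarrow> (nat set \<Rightarrow> complex) \<Rightarrow> nat set \<Rightarrow> complex" where
  "wact is = fold tact is"

lemma wact_simps [simp]:
  "wact [] \<Phi> = \<Phi>" "wact (i # is) \<Phi> = wact is (tact i \<Phi>)"
  "wact (xs @ ys) \<Phi> = wact ys (wact xs \<Phi>)"
  by (simp_all add: wact_def)

lemma image_st_st [simp]: "st i ` st i ` I = I"
  by (simp add: image_image)

lemma mem_image_st [simp]: "x \<in> st i ` I \<longleftrightarrow> st i x \<in> I"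
  by (metis image_iff st_st)

lemma image_st_same: "(i \<in> I \<longleftrightarrow> Suc i \<in> I) \<Longrightarrow> st i ` I = I"
  by (auto simp: st_apply split: if_splits)

lemma tact_idem: "tact i (tact i \<Phi>) = (\<lambda>I. 2 * tact i \<Phi> I)"
  by (auto simp: tact_def fun_eq_iff)

lemma image_st_commute:
  assumes "Suc i < j \<or> Suc j < i" shows "st i ` st j ` I = st j ` st i ` I"
proof -
  have "st i (st j x) = st j (st i x)" for x
    using assms by (cases "x = i"; cases "x = Suc i"; cases "x = j"; cases "x = Suc j") auto
  thus ?thesis by (simp add: image_image)
qed

lemma tact_commute: "Suc i < j \<or> Suc j < i \<Longrightarrow> tact i (tact j \<Phi>) = tact j (tact i \<Phi>)"
  using image_st_commute[of i j] by (auto simp: tact_def fun_eq_iff)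

lemma image_st_braid: "st i ` st (Suc i) ` st i ` I = st (Suc i) ` st i ` st (Suc i) ` I"
proof -
  have "st i (st (Suc i) (st i x)) = st (Suc i) (st i (st (Suc i) x))" for x
    by (cases "x = i"; cases "x = Suc i"; cases "x = Suc (Suc i)") simp_all
  thus ?thesis by (simp add: image_image)
qed

text \<open>Only two colours are available, so two of any three adjacent positions have the same
  colour; hence the alternating sum over the permutations of three positions vanishes.\<close>

lemma alternating_sum_zero:
  "\<Phi> I - \<Phi> (st i ` I) - \<Phi> (st (Suc i) ` I) + \<Phi> (st i ` st (Suc i) ` I)
     + \<Phi> (st (Suc i) ` st i ` I) - \<Phi> (st i ` st (Suc i) ` st i ` I) = (0 :: complex)"
proof -
  let ?a = "\<lambda>J. st i ` J" and ?b = "\<lambda>J. st (Suc i) ` J"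
  consider "?a I = I" | "?b I = I" | "i \<in> I \<longleftrightarrow> Suc (Suc i) \<in> I"
    using image_st_same[of i I] image_st_same[of "Suc i" I] by blast
  thus ?thesis
  proof cases
    case 2
    thus ?thesis using image_st_braid[of i I] by simp
  next
    case 3
    hence "st i (st (Suc i) (st i x)) \<in> I \<longleftrightarrow> x \<in> I" for x
      by (cases "x = i"; cases "x = Suc i"; cases "x = Suc (Suc i)") simp_all
    hence "?a (?b (?a I)) = I" by auto
    moreover from this have "?b (?a I) = ?a I" "?a (?b I) = ?b I"
      using image_st_braid[of i I] by (metis image_st_st)+
    ultimately show ?thesis by simp
  qed simp
qed

text \<open>Expanding the difference of both sides in swaps gives exactly the alternating sum over
  the permutations of three adjacent positions.\<close>

lemma tact_braid: "j = Suc i \<or> i = Suc j \<Longrightarrow> tact i (tact j (tact i \<Phi>)) = tact i \<Phi>"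
proof (elim disjE)
  assume "j = Suc i"
  thus ?thesis
    using alternating_sum_zero[of \<Phi> _ i] by (auto simp: tact_def fun_eq_iff algebra_simps)
next
  assume "i = Suc j"
  thus ?thesis
    using alternating_sum_zero[of \<Phi> _ j] image_st_braid[of j]
    by (auto simp: tact_def fun_eq_iff algebra_simps)
qed

text \<open>The letters only swap positions inside the interval, so the colour of \<open>x\<close>
  is never changed.\<close>

lemma wact_support:
  assumes "\<And>J. Y J \<noteq> 0 \<Longrightarrow> x \<in> J \<longleftrightarrow> B" "set is \<subseteq> {lo..<hi}" "x \<notin> {lo..hi}" "wact is Y J \<noteq> 0"
  shows "x \<in> J \<longleftrightarrow> B"
  using assms
proof (induction "is" arbitrary: Y J)
  case (Cons i "is")
  have x: "x \<noteq> i" "x \<noteq> Suc i" using Cons.prems(2,3) by auto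
  have "x \<in> J \<longleftrightarrow> B" if "tact i Y J \<noteq> 0" for J
    using that Cons.prems(1)[of J] Cons.prems(1)[of "st i ` J"] x
    by (cases "Y J = 0") (auto simp: tact_def)
  thus ?case using Cons.IH[of "tact i Y" J] Cons.prems by auto
qed auto

section \<open>Operators of 321-avoiding permutations\<close>

lemma permutation_permutes_interval:
  fixes v :: "nat \<Rightarrow> nat"
  assumes "permutation v" shows "\<exists>N. v permutes {0..N}"
proof -
  from assms obtain S where S: "finite S" "v permutes S" using permutation_permutes by auto
  then obtain N where "\<forall>x\<in>S. x \<le> N" using finite_nat_set_iff_bounded_le[of S] by auto
  hence "v permutes {0..N}" using S(2) permutes_subset[of v S "{0..N}"] by (simp add: subset_iff)
  thus ?thesis by blast
qed

text \<open>The action of beta(v) without a fixed n. For 321-avoiding \<open>v\<close> the chosen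
  word is immaterial by \<open>wact_reduced\<close>.\<close>

definition pact :: "(nat \<Rightarrow> nat) \<Rightarrow> (nat set \<Rightarrow> complex) \<Rightarrow> nat set \<Rightarrow> complex" where
  "pact v = wact (SOME is. reduced v is)"

lemma wact_reduced:
  assumes "avoids_321 v" "reduced v is" "reduced v js"
  shows "wact is = wact js"
proof -
  have "permutation v" using assms by (auto simp: reduced_def)
  then obtain N where N: "v permutes {0..N}" using permutation_permutes_interval by blast
  obtain M where M: "\<And>x. x \<in> set is \<union> set js \<Longrightarrow> x < M"
    using finite_nat_set_iff_bounded[of "set is \<union> set js"] by auto
  have "v permutes {0..max N M}" using N by (rule permutes_subset) auto
  moreover have "set is \<subseteq> {0..<max N M}" "set js \<subseteq> {0..<max N M}"
    using M by (auto simp: less_max_iff_disj)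
  ultimately show ?thesis
    by (rule reduced_commutation_invariant[OF assms(1) _ _ _ assms(2,3)])
      (auto simp: fun_eq_iff tact_commute)
qed

lemma pact_eq: "avoids_321 v \<Longrightarrow> reduced v is \<Longrightarrow> pact v = wact is"
  unfolding pact_def by (rule wact_reduced) (auto intro: someI)

lemma pact_id [simp]: "pact id Y = Y"
  using pact_eq[of id "[]"] by (simp add: avoids_321_def reduced_def)

text \<open>A reduced word of \<open>v\<close> can be chosen to end in the descent \<open>i\<close>,
  and its last factor is 1 - s_i. In particular the value is 0 when positions \<open>i\<close> and
  \<open>Suc i\<close> have the same colour in \<open>I\<close>.\<close>

lemma pact_descent:
  assumes "avoids_321 v" "permutation v" "v (Suc i) < v i"
  shows "pact v Y I = pact (v \<circ> st i) Y I - pact (v \<circ> st i) Y (st i ` I)"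
proof -
  obtain N where N: "v \<circ> st i permutes {0..N}"
    using permutation_permutes_interval[of "v \<circ> st i"] assms by auto
  then obtain "is" where "is": "reduced (v \<circ> st i) is" using reduced_exists by blast
  have "pact v = wact (is @ [i])" using assms "is" by (intro pact_eq reduced_snoc)
  moreover have "pact (v \<circ> st i) = wact is" using assms "is" by (intro pact_eq avoids_321_comp_st)
  ultimately show ?thesis by (simp add: tact_def)
qed

lemma pact_support:
  assumes "avoids_321 v" "v permutes {lo..hi}" "x \<notin> {lo..hi}" "\<And>J. Y J \<noteq> 0 \<Longrightarrow> x \<in> J \<longleftrightarrow> B"
    "pact v Y J \<noteq> 0"
  shows "x \<in> J \<longleftrightarrow> B"
proof -
  obtain "is" where "set is \<subseteq> {lo..<hi}" "reduced v is" using reduced_exists assms(2) by blast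
  with assms show ?thesis by (metis pact_eq wact_support)
qed

text \<open>Think of \<open>v\<close> as lines from \<open>i\<close> to \<open>v i\<close>, coloured by \<open>I\<close>, while \<open>Y\<close> prescribes colour 0 at the
  values up to \<open>l\<close> and colour 1 at the values above \<open>h\<close>. If the line to the least value meets
  colour 1 only, then of the two terms of each \<open>t\<^sub>i = 1 - s\<^sub>i\<close> on its way only \<open>- s\<^sub>i\<close> survives, and the
  line can be removed; likewise for the greatest value. Here \<open>v'\<close> and \<open>\<pi> ` I\<close> describe the
  lines that are left after removing those to \<open>{lo..l0}\<close> and to \<open>{h0<..hi}\<close>.\<close>

lemma peel:
  assumes "\<And>J x. Y J \<noteq> 0 \<Longrightarrow> 1 \<le> x \<Longrightarrow> x \<le> l \<Longrightarrow> x \<notin> J"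
    and "\<And>J x. Y J \<noteq> 0 \<Longrightarrow> h < x \<Longrightarrow> x \<le> n \<Longrightarrow> x \<in> J"
    and "v permutes {lo..hi}" "avoids_321 v" "1 \<le> lo" "hi \<le> n"
    and "l0 \<le> l" "h \<le> h0" "lo \<le> Suc l0" "h0 \<le> hi" "l0 \<le> h0"
    and "\<And>i j. lo \<le> v j \<Longrightarrow> v j \<le> l0 \<Longrightarrow> i < j \<Longrightarrow> v j < v i \<Longrightarrow> i \<in> I"
    and "\<And>i j. h0 < v i \<Longrightarrow> v i \<le> hi \<Longrightarrow> i < j \<Longrightarrow> v j < v i \<Longrightarrow> j \<notin> I"
    and "pact v Y I \<noteq> 0"
  shows "(\<forall>i. lo \<le> v i \<and> v i \<le> l0 \<longrightarrow> i \<notin> I) \<and> (\<forall>i. h0 < v i \<and> v i \<le> hi \<longrightarrow> i \<in> I) \<and>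
    (\<exists>v' \<pi>. v' permutes {Suc l0..h0} \<and> avoids_321 v' \<and> v = v' \<circ> \<pi> \<and>
       (\<forall>i j. i < j \<and> l0 < v i \<and> v i \<le> h0 \<and> l0 < v j \<and> v j \<le> h0 \<longrightarrow> \<pi> i < \<pi> j) \<and>
       pact v Y I = of_int (sign v * sign v') * pact v' Y (\<pi> ` I))"
  using assms(3-)
\<comment> \<open>Each step either drops a straight line at an end of the interval or removes an
  inversion; the measure decreases in both cases.\<close>
proof (induction "Suc hi - lo + card (inversions v)" arbitrary: lo hi v I l0 h0 rule: less_induct)
  case less
  note pv = less.prems(1) and av = less.prems(2) and HL = less.prems(10) and HT = less.prems(11)
    and nz = less.prems(12)
  have perm: "permutation v" using pv permutation_permutes by auto
  have inj: "v x = v y \<longleftrightarrow> x = y" for x y using pv by (metis permutes_inj injD)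
  \<comment> \<open>Common to both ends: the unswapped term vanishes by \<open>z\<close>, and the
    swapped one is covered by the induction hypothesis. By \<open>ext\<close> one of the two
    exchanged lines is to be removed, so the relative order of the remaining lines recorded by
    \<open>\<pi>\<close> is unaffected.\<close>
  have step: ?case if i: "v (Suc i) < v i" "i \<in> {lo..<hi}" and iI: "i \<in> I" "Suc i \<notin> I"
      and z: "pact (v \<circ> st i) Y I = 0" and ext: "v (Suc i) \<le> l0 \<or> h0 < v i" for i
  proof -
    define v1 where "v1 = v \<circ> st i"
    have v: "v = v1 \<circ> st i" and v1x: "v1 x = v (st i x)" for x by (simp_all add: v1_def)
    have p1: "v1 permutes {lo..hi}" unfolding v1_def using pv i(2) by (rule comp_st_permutes)
    have av1: "avoids_321 v1" unfolding v1_def using av i(1) by (rule avoids_321_comp_st)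
    have eq: "pact v Y I = - pact v1 Y (st i ` I)"
      using pact_descent[OF av perm i(1)] z by (simp add: v1_def)
    have inv1: "st i x < st i y" if "x < y" "v1 y < v1 x" for x y
      using that i(1) by (auto simp: st_apply v1x split: if_splits)
    have sm: "Suc hi - lo + card (inversions v1) < Suc hi - lo + card (inversions v)"
      using card_inversions_descent[OF perm i(1)] by (simp add: v1_def)
    have *: "(\<forall>j. lo \<le> v1 j \<and> v1 j \<le> l0 \<longrightarrow> j \<notin> st i ` I) \<and> (\<forall>j. h0 < v1 j \<and> v1 j \<le> hi \<longrightarrow> j \<in> st i ` I) \<and>
      (\<exists>v' \<pi>. v' permutes {Suc l0..h0} \<and> avoids_321 v' \<and> v1 = v' \<circ> \<pi> \<and>
       (\<forall>i j. i < j \<and> l0 < v1 i \<and> v1 i \<le> h0 \<and> l0 < v1 j \<and> v1 j \<le> h0 \<longrightarrow> \<pi> i < \<pi> j) \<and>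
       pact v1 Y (st i ` I) = of_int (sign v1 * sign v') * pact v' Y (\<pi> ` st i ` I))"
    proof (rule less.hyps[OF sm p1 av1 less.prems(3-9)])
      fix x y assume "lo \<le> v1 y" "v1 y \<le> l0" "x < y" "v1 y < v1 x"
      thus "x \<in> st i ` I" using HL[of "st i y" "st i x"] inv1[of x y] by (simp add: v1x)
    next
      fix x y assume "h0 < v1 x" "v1 x \<le> hi" "x < y" "v1 y < v1 x"
      thus "y \<notin> st i ` I" using HT[of "st i x" "st i y"] inv1[of x y] by (simp add: v1x)
    next
      show "pact v1 Y (st i ` I) \<noteq> 0" using nz eq by simp
    qed
    then obtain v' \<pi> where v': "v' permutes {Suc l0..h0}" "avoids_321 v'" "v1 = v' \<circ> \<pi>"
       and mono: "\<And>i j. i < j \<Longrightarrow> l0 < v1 i \<Longrightarrow> v1 i \<le> h0 \<Longrightarrow> l0 < v1 j \<Longrightarrow> v1 j \<le> h0 \<Longrightarrow> \<pi> i < \<pi> j"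
       and eq': "pact v1 Y (st i ` I) = of_int (sign v1 * sign v') * pact v' Y (\<pi> ` st i ` I)"
      by blast
    have "sign v1 = - sign v" unfolding v1_def using perm by (rule sign_comp_st)
    hence e: "pact v Y I = of_int (sign v * sign v') * pact v' Y ((\<pi> \<circ> st i) ` I)"
      using eq eq' by (simp add: image_comp)
    have m: "(\<pi> \<circ> st i) x < (\<pi> \<circ> st i) y"
      if "x < y" "l0 < v x" "v x \<le> h0" "l0 < v y" "v y \<le> h0" for x y
    proof -
      have "\<not> (x = i \<and> y = Suc i)" using ext that by auto
      hence "st i x < st i y" using that(1) by (auto simp: st_apply)
      thus ?thesis using mono[of "st i x" "st i y"] that by (simp add: v1x)
    qed
    have "v = v' \<circ> (\<pi> \<circ> st i)" using v'(3) v by (simp add: o_assoc)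
    moreover have "\<forall>j. lo \<le> v j \<and> v j \<le> l0 \<longrightarrow> j \<notin> I" "\<forall>j. h0 < v j \<and> v j \<le> hi \<longrightarrow> j \<in> I"
      using * by (metis mem_image_st st_st v1x)+
    ultimately show ?thesis using v'(1,2) e m by blast
  qed
  show ?case
  proof (cases "lo \<le> l0")
    case True
    define k where "k = inv' v lo"
    have vk: "v k = lo" unfolding k_def using pv by (simp add: permutes_inverses)
    have le: "lo \<le> hi" using True less.prems(8,9) by simp
    have k: "k \<in> {lo..hi}" using permutes_in_image[OF pv, of k] vk le by simp
    show ?thesis
    proof (cases "k = lo")
      case True
      \<comment> \<open>The line to \<open>lo\<close> is already straight. The operator does not
        touch that position, so its colour is the one prescribed by \<open>Y\<close>.\<close>
      have p': "v permutes {Suc lo..hi}"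
        using pv vk True by (intro permutes_superset[OF pv]) (auto simp: not_less_eq_eq le_Suc_eq)
      have "lo \<notin> I"
        using pact_support[OF av p', of lo Y False I] assms(1)[of _ lo] nz \<open>lo \<le> l0\<close> less.prems(3,5) by auto
      moreover have HL': "i \<in> I" if "Suc lo \<le> v j" "v j \<le> l0" "i < j" "v j < v i" for i j
        using HL[of j i] that by auto
      have "(\<forall>i. Suc lo \<le> v i \<and> v i \<le> l0 \<longrightarrow> i \<notin> I) \<and> (\<forall>i. h0 < v i \<and> v i \<le> hi \<longrightarrow> i \<in> I) \<and>
    (\<exists>v' \<pi>. v' permutes {Suc l0..h0} \<and> avoids_321 v' \<and> v = v' \<circ> \<pi> \<and>
       (\<forall>i j. i < j \<and> l0 < v i \<and> v i \<le> h0 \<and> l0 < v j \<and> v j \<le> h0 \<longrightarrow> \<pi> i < \<pi> j) \<and>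
       pact v Y I = of_int (sign v * sign v') * pact v' Y (\<pi> ` I))"
        using less.prems(2-9) HT HL' nz \<open>lo \<le> l0\<close> le p'
        by (intro less.hyps) auto
      ultimately show ?thesis using vk True inj
        by (metis le_antisym not_less_eq_eq)
    next
      case False
      then obtain i where i: "k = Suc i" "lo \<le> i" "i < hi" using k by (cases k) auto
      have vi: "lo < v i" using permutes_in_image[OF pv, of i] i vk inj[of i k] by (auto simp: le_less)
      have iI: "i \<in> I" using HL[of k i] vk i vi True by auto
      have kI: "k \<notin> I"
      proof
        assume "k \<in> I"
        hence "st i ` I = I" using iI i by (intro image_st_same) auto
        thus False using nz pact_descent[OF av perm, of i Y I] vi vk i by simp
      qed
      \<comment> \<open>If this term survived, the line to \<open>lo\<close> would start at
        \<open>i\<close>, which has colour 1. The induction hypothesis with \<open>l0 = lo\<close>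
        and \<open>h0 = hi\<close> forbids that; with these bounds only the crossings of this single
        line have to be checked.\<close>
      have "pact (v \<circ> st i) Y I = 0"
      proof (rule ccontr)
        assume nz1: "pact (v \<circ> st i) Y I \<noteq> 0"
        have *: "j = i" if "v (st i j) = lo" for j
          using that vk inj i by (metis st_at(1) st_st)
        have "\<forall>j. lo \<le> (v \<circ> st i) j \<and> (v \<circ> st i) j \<le> lo \<longrightarrow> j \<notin> I"
        proof (rule conjunct1[OF less.hyps[OF _ _ _ less.prems(3,4) _ _ _ _ _ _ _ nz1, where ?h0.0 = hi and ?l0.0 = lo]])
          show "Suc hi - lo + card (inversions (v \<circ> st i)) < Suc hi - lo + card (inversions v)"
            using card_inversions_descent[OF perm, of i] vi vk i by simp
          show "v \<circ> st i permutes {lo..hi}" using pv i by (intro comp_st_permutes) auto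
          show "avoids_321 (v \<circ> st i)" using av vi vk i by (intro avoids_321_comp_st) auto
          show "x \<in> I" if "lo \<le> (v \<circ> st i) y" "(v \<circ> st i) y \<le> lo" "x < y"
            "(v \<circ> st i) y < (v \<circ> st i) x" for x y
          proof -
            have "y = i" using *[of y] that by simp
            thus ?thesis using HL[of k x] that vk i True by auto
          qed
        qed (use True less.prems le in auto)
        thus False using vk i iI by auto
      qed
      thus ?thesis by (rule step[rotated -2]) (use i vi vk iI kI True in simp_all)
    qed
  next
    case False
    hence lo: "lo = Suc l0" using less.prems(7) by simp
    show ?thesis
    \<comment> \<open>Nothing is left to remove at the lower end; the greatest value is now treated
      in the mirrored way.\<close>
    proof (cases "h0 < hi")
      case True
      define k where "k = inv' v hi"
      have vk: "v k = hi" unfolding k_def using pv by (simp add: permutes_inverses)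
      have le: "lo \<le> hi" using True less.prems(9) lo by simp
      have k: "k \<in> {lo..hi}" using permutes_in_image[OF pv, of k] vk le by simp
      show ?thesis
      proof (cases "k = hi")
        case True
        have p': "v permutes {lo..hi - 1}"
        proof (rule permutes_superset[OF pv])
          fix x assume "x \<in> {lo..hi} - {lo..hi - 1}"
          hence "x = hi" by auto
          thus "v x = x" using vk True by simp
        qed
        have "hi \<in> I"
          using pact_support[OF av p', of hi Y True I] assms(2)[of _ hi] nz \<open>h0 < hi\<close> less.prems(4,6) le lo by auto
        moreover have HT': "j \<notin> I" if "h0 < v i" "v i \<le> hi - 1" "i < j" "v j < v i" for i j
          using HT[of i j] that by auto
        have "(\<forall>i. lo \<le> v i \<and> v i \<le> l0 \<longrightarrow> i \<notin> I) \<and> (\<forall>i. h0 < v i \<and> v i \<le> hi - 1 \<longrightarrow> i \<in> I) \<and>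
      (\<exists>v' \<pi>. v' permutes {Suc l0..h0} \<and> avoids_321 v' \<and> v = v' \<circ> \<pi> \<and>
         (\<forall>i j. i < j \<and> l0 < v i \<and> v i \<le> h0 \<and> l0 < v j \<and> v j \<le> h0 \<longrightarrow> \<pi> i < \<pi> j) \<and>
         pact v Y I = of_int (sign v * sign v') * pact v' Y (\<pi> ` I))"
          using less.prems(2-9) HL HT' nz \<open>h0 < hi\<close> le p' lo
          by (intro less.hyps) auto
        moreover have "v i \<le> hi - 1 \<or> i = hi" if "v i \<le> hi" for i
          using that vk True inj[of i k] by linarith
        ultimately show ?thesis by metis
      next
        case False
        have k: "lo \<le> k" "k < hi" using k False by auto
        have vk': "v (Suc k) < hi"
          using permutes_in_image[OF pv, of "Suc k"] k vk inj[of "Suc k" k] by (auto simp: le_less)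
        have kI': "Suc k \<notin> I" using HT[of k "Suc k"] vk vk' True by auto
        have kI: "k \<in> I"
        proof (rule ccontr)
          assume "k \<notin> I"
          hence "st k ` I = I" using kI' by (intro image_st_same) auto
          thus False using nz pact_descent[OF av perm, of k Y I] vk vk' by simp
        qed
        have "pact (v \<circ> st k) Y I = 0"
        proof (rule ccontr)
          assume nz1: "pact (v \<circ> st k) Y I \<noteq> 0"
          have *: "j = Suc k" if "v (st k j) = hi" for j
            using that vk inj by (metis st_at(1) st_st)
          have "\<forall>j. hi - 1 < (v \<circ> st k) j \<and> (v \<circ> st k) j \<le> hi \<longrightarrow> j \<in> I"
          proof (rule conjunct1[OF conjunct2[OF less.hyps[OF _ _ _ less.prems(3,4) _ _ _ _ _ _ _ nz1, where ?h0.0 = "hi - 1" and ?l0.0 = l0]]])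
            show "Suc hi - lo + card (inversions (v \<circ> st k)) < Suc hi - lo + card (inversions v)"
              using card_inversions_descent[OF perm, of k] vk vk' by simp
            show "v \<circ> st k permutes {lo..hi}" using pv k by (intro comp_st_permutes) auto
            show "avoids_321 (v \<circ> st k)" using av vk vk' by (intro avoids_321_comp_st) auto
            show "y \<notin> I" if "hi - 1 < (v \<circ> st k) x" "(v \<circ> st k) x \<le> hi" "x < y"
              "(v \<circ> st k) y < (v \<circ> st k) x" for x y
            proof -
              have "x = Suc k" using *[of x] that by simp
              thus ?thesis using HT[of k y] that vk True by auto
            qed
          qed (use True less.prems le lo in auto)
          thus False using vk kI' le lo by auto
        qed
        thus ?thesis by (rule step[rotated -2]) (use k vk vk' kI kI' True in simp_all)
      qed
    next
      case False
      hence "hi = h0" using less.prems(8) by simp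
      have "of_int (sign v * sign v) = (1::complex)" by (simp flip: of_int_mult)
      hence "v permutes {Suc l0..h0} \<and> avoids_321 v \<and> v = v \<circ> id \<and>
       (\<forall>i j. i < j \<and> l0 < v i \<and> v i \<le> h0 \<and> l0 < v j \<and> v j \<le> h0 \<longrightarrow> id i < id j) \<and>
       pact v Y I = of_int (sign v * sign v) * pact v Y (id ` I)"
        using pv av lo \<open>hi = h0\<close> by simp
      thus ?thesis using lo \<open>hi = h0\<close> by (intro conjI exI[of _ v] exI[of _ id]) auto
    qed
  qed
qed

section \<open>Monoid algebras\<close>

text \<open>The linear extension of \<open>\<phi>\<close> from the basis to finitely supported
  \<open>p\<close>. Convolution is a twofold \<open>lin\<close>, so the ring laws and the module
  laws reduce to rules for evaluating and exchanging it.\<close>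

definition lin :: "('a \<Rightarrow> complex) \<Rightarrow> ('a \<Rightarrow> complex) \<Rightarrow> complex" where
  "lin \<phi> p = (\<Sum>x | p x \<noteq> 0. p x * \<phi> x)"

lemma lin_superset:
  assumes "finite A" "{x. p x \<noteq> 0} \<subseteq> A" shows "lin \<phi> p = (\<Sum>x\<in>A. p x * \<phi> x)"
  unfolding lin_def by (rule sum.mono_neutral_left) (use assms in auto)

lemma lin_cong: "(\<And>x. p x \<noteq> 0 \<Longrightarrow> \<phi> x = \<psi> x) \<Longrightarrow> lin \<phi> p = lin \<psi> p"
  unfolding lin_def by (rule sum.cong) auto

lemma finite_support_comb:
  "finite {x. p x \<noteq> 0} \<Longrightarrow> finite {x. q x \<noteq> 0} \<Longrightarrow> finite {x. p x + c * q x \<noteq> (0::complex)}"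
  by (rule finite_subset[of _ "{x. p x \<noteq> 0} \<union> {x. q x \<noteq> 0}"]) auto

lemma lin_comb:
  assumes "finite {x. p x \<noteq> 0}" "finite {x. q x \<noteq> 0}"
  shows "lin \<phi> (\<lambda>x. p x + c * q x) = lin \<phi> p + c * lin \<phi> q"
proof -
  let ?A = "{x. p x \<noteq> 0} \<union> {x. q x \<noteq> 0}"
  have "lin \<phi> (\<lambda>x. p x + c * q x) = (\<Sum>x\<in>?A. (p x + c * q x) * \<phi> x)"
    "lin \<phi> p = (\<Sum>x\<in>?A. p x * \<phi> x)" "lin \<phi> q = (\<Sum>x\<in>?A. q x * \<phi> x)"
    using assms by (intro lin_superset; auto)+
  thus ?thesis by (simp add: sum.distrib algebra_simps flip: sum_distrib_left)
qed

lemma lin_fun_comb: "lin (\<lambda>x. \<phi> x + c * \<psi> x) p = lin \<phi> p + c * lin \<psi> p"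
  unfolding lin_def by (simp add: sum.distrib algebra_simps sum_distrib_left)

lemma lin_zero [simp]: "lin \<phi> (\<lambda>x. 0) = 0" "lin (\<lambda>x. 0) p = 0"
  by (simp_all add: lin_def)

lemma delta_neq_0 [simp]: "delta x y \<noteq> 0 \<longleftrightarrow> y = x" "delta x y = 0 \<longleftrightarrow> y \<noteq> x"
  by (simp_all add: delta_def)

lemma lin_delta [simp]: "lin \<phi> (delta x) = \<phi> x"
  by (simp add: lin_def) (simp add: delta_def)

lemma lin_sum:
  assumes "finite B" "\<And>b. b \<in> B \<Longrightarrow> finite {x. q b x \<noteq> 0}"
  shows "lin \<phi> (\<lambda>x. \<Sum>b\<in>B. c b * q b x) = (\<Sum>b\<in>B. c b * lin \<phi> (q b))"
    and "finite {x. (\<Sum>b\<in>B. c b * q b x) \<noteq> 0}"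
proof -
  have "finite {x. (\<Sum>b\<in>B. c b * q b x) \<noteq> 0} \<and>
    lin \<phi> (\<lambda>x. \<Sum>b\<in>B. c b * q b x) = (\<Sum>b\<in>B. c b * lin \<phi> (q b))"
    using assms
  proof (induction B rule: finite_induct)
    case (insert b B)
    hence fin: "finite {x. (\<Sum>b\<in>B. c b * q b x) \<noteq> 0}" "finite {x. q b x \<noteq> 0}" by auto
    have "(\<lambda>x. \<Sum>b\<in>insert b B. c b * q b x) = (\<lambda>x. (\<Sum>b\<in>B. c b * q b x) + c b * q b x)"
      using insert.hyps by (simp add: fun_eq_iff add.commute)
    thus ?case using lin_comb[OF fin] finite_support_comb[OF fin] insert by (simp add: add.commute)
  qed simp
  thus "lin \<phi> (\<lambda>x. \<Sum>b\<in>B. c b * q b x) = (\<Sum>b\<in>B. c b * lin \<phi> (q b))"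
    "finite {x. (\<Sum>b\<in>B. c b * q b x) \<noteq> 0}" by auto
qed

lemma lin_swap: "lin (\<lambda>x. lin (\<lambda>y. \<phi> x y) q) p = lin (\<lambda>y. lin (\<lambda>x. \<phi> x y) p) q"
  unfolding lin_def sum_distrib_left
  by (subst sum.swap) (simp add: algebra_simps)

lemma monoid_algebra_simps:
  "p \<in> carrier (monoid_algebra M) \<longleftrightarrow> finite {x. p x \<noteq> 0} \<and> {x. p x \<noteq> 0} \<subseteq> carrier M"
  "(p \<otimes>\<^bsub>monoid_algebra M\<^esub> q) z = lin (\<lambda>x. lin (\<lambda>y. if x \<otimes>\<^bsub>M\<^esub> y = z then 1 else 0) q) p"
  "\<one>\<^bsub>monoid_algebra M\<^esub> = delta \<one>\<^bsub>M\<^esub>"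
  "\<zero>\<^bsub>monoid_algebra M\<^esub> = (\<lambda>x. 0)"
  "p \<oplus>\<^bsub>monoid_algebra M\<^esub> q = (\<lambda>x. p x + q x)"
  "c \<odot>\<^bsub>monoid_algebra M\<^esub> p = (\<lambda>x. c * p x)"
  by (auto simp: monoid_algebra_def lin_def delta_def sum_distrib_left fun_eq_iff intro!: sum.cong)

lemma delta_carrier [simp]: "x \<in> carrier M \<Longrightarrow> delta x \<in> carrier (monoid_algebra M)"
  by (simp add: monoid_algebra_simps)

lemma comb_carrier:
  assumes "p \<in> carrier (monoid_algebra M)" "q \<in> carrier (monoid_algebra M)"
  shows "(\<lambda>x. p x + c * q x) \<in> carrier (monoid_algebra M)"
proof -
  have "{x. p x + c * q x \<noteq> 0} \<subseteq> {x. p x \<noteq> 0} \<union> {x. q x \<noteq> 0}" by auto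
  moreover have "{x. p x \<noteq> 0} \<union> {x. q x \<noteq> 0} \<subseteq> carrier M"
    using assms by (simp add: monoid_algebra_simps)
  ultimately show ?thesis
    using assms finite_support_comb[of p q c] unfolding monoid_algebra_simps(1) by blast
qed

lemma lin_neq_0D: "lin \<phi> p \<noteq> 0 \<Longrightarrow> \<exists>x. p x \<noteq> 0 \<and> \<phi> x \<noteq> 0"
  unfolding lin_def by (metis (mono_tags, lifting) mem_Collect_eq mult_zero_right sum.neutral)

lemma sum_carrier:
  assumes "finite B" "\<And>b. b \<in> B \<Longrightarrow> q b \<in> carrier (monoid_algebra M)"
  shows "(\<lambda>x. \<Sum>b\<in>B. c b * q b x) \<in> carrier (monoid_algebra M)"
proof -
  have "finite {x. (\<Sum>b\<in>B. c b * q b x) \<noteq> 0}"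
    using assms by (intro lin_sum(2)) (auto simp: monoid_algebra_simps(1))
  moreover have "x \<in> carrier M" if "(\<Sum>b\<in>B. c b * q b x) \<noteq> 0" for x
  proof -
    have "\<exists>b\<in>B. c b * q b x \<noteq> 0"
    proof (rule ccontr)
      assume "\<not> ?thesis"
      hence "(\<Sum>b\<in>B. c b * q b x) = 0" by (intro sum.neutral) auto
      thus False using that by simp
    qed
    then obtain b where "b \<in> B" "q b x \<noteq> 0" by auto
    thus ?thesis using assms(2)[of b] by (auto simp: monoid_algebra_simps(1))
  qed
  ultimately show ?thesis unfolding monoid_algebra_simps(1) by blast
qed

lemma mult_support:
  "{z. (p \<otimes>\<^bsub>monoid_algebra M\<^esub> q) z \<noteq> 0} \<subseteq> (\<lambda>(x, y). x \<otimes>\<^bsub>M\<^esub> y) ` ({x. p x \<noteq> 0} \<times> {y. q y \<noteq> 0})"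
proof
  fix z assume "z \<in> {z. (p \<otimes>\<^bsub>monoid_algebra M\<^esub> q) z \<noteq> 0}"
  hence "lin (\<lambda>x. lin (\<lambda>y. if x \<otimes>\<^bsub>M\<^esub> y = z then 1 else 0) q) p \<noteq> 0" by (simp add: monoid_algebra_simps)
  then obtain x where x: "p x \<noteq> 0" "lin (\<lambda>y. if x \<otimes>\<^bsub>M\<^esub> y = z then 1 else 0) q \<noteq> 0"
    by (auto dest: lin_neq_0D)
  then obtain y where "q y \<noteq> 0" "x \<otimes>\<^bsub>M\<^esub> y = z"
    by (auto dest!: lin_neq_0D split: if_splits)
  with x(1) show "z \<in> (\<lambda>(x, y). x \<otimes>\<^bsub>M\<^esub> y) ` ({x. p x \<noteq> 0} \<times> {y. q y \<noteq> 0})" by force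
qed

lemma lin_mult:
  assumes "finite {x. p x \<noteq> 0}" "finite {x. q x \<noteq> 0}"
  shows "lin \<phi> (p \<otimes>\<^bsub>monoid_algebra M\<^esub> q) = lin (\<lambda>x. lin (\<lambda>y. \<phi> (x \<otimes>\<^bsub>M\<^esub> y)) q) p"
proof -
  let ?P = "{x. p x \<noteq> 0}" and ?Q = "{y. q y \<noteq> 0}"
  let ?A = "(\<lambda>(x, y). x \<otimes>\<^bsub>M\<^esub> y) ` (?P \<times> ?Q)"
  have fin: "finite ?A" using assms by simp
  have "lin \<phi> (p \<otimes>\<^bsub>monoid_algebra M\<^esub> q)
      = (\<Sum>z\<in>?A. lin (\<lambda>x. lin (\<lambda>y. if x \<otimes>\<^bsub>M\<^esub> y = z then 1 else 0) q) p * \<phi> z)"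
    by (subst lin_superset[OF fin mult_support]) (simp add: monoid_algebra_simps)
  also have "\<dots> = (\<Sum>z\<in>?A. \<Sum>x\<in>?P. \<Sum>y\<in>?Q. if x \<otimes>\<^bsub>M\<^esub> y = z then p x * q y * \<phi> z else 0)"
    by (intro sum.cong refl) (auto simp: lin_def sum_distrib_left sum_distrib_right intro!: sum.cong)
  also have "\<dots> = (\<Sum>x\<in>?P. \<Sum>y\<in>?Q. \<Sum>z\<in>?A. if x \<otimes>\<^bsub>M\<^esub> y = z then p x * q y * \<phi> z else 0)"
    by (rule trans[OF sum.swap]) (intro sum.cong refl sum.swap)
  also have "\<dots> = (\<Sum>x\<in>?P. \<Sum>y\<in>?Q. p x * q y * \<phi> (x \<otimes>\<^bsub>M\<^esub> y))"
    using fin by (intro sum.cong refl) (auto simp: sum.delta')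
  finally show ?thesis by (simp add: lin_def sum_distrib_left mult.assoc)
qed

lemma mult_carrier:
  assumes "monoid M" "p \<in> carrier (monoid_algebra M)" "q \<in> carrier (monoid_algebra M)"
  shows "p \<otimes>\<^bsub>monoid_algebra M\<^esub> q \<in> carrier (monoid_algebra M)"
proof -
  let ?A = "(\<lambda>(x, y). x \<otimes>\<^bsub>M\<^esub> y) ` ({x. p x \<noteq> 0} \<times> {y. q y \<noteq> 0})"
  have "finite ?A" "?A \<subseteq> carrier M"
    using assms by (auto simp: monoid_algebra_simps intro!: monoid.m_closed)
  with mult_support[of M p q] show ?thesis
    unfolding monoid_algebra_simps(1) by (meson finite_subset subset_trans)
qed

lemma mult_comb_left:
  assumes "finite {x. p x \<noteq> 0}" "finite {x. q x \<noteq> 0}"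
  shows "(\<lambda>x. p x + c * q x) \<otimes>\<^bsub>monoid_algebra M\<^esub> r
    = (\<lambda>x. (p \<otimes>\<^bsub>monoid_algebra M\<^esub> r) x + c * (q \<otimes>\<^bsub>monoid_algebra M\<^esub> r) x)"
  by (rule ext) (simp add: monoid_algebra_simps lin_comb[OF assms])

lemma mult_comb_right:
  assumes "finite {x. p x \<noteq> 0}" "finite {x. q x \<noteq> 0}"
  shows "r \<otimes>\<^bsub>monoid_algebra M\<^esub> (\<lambda>x. p x + c * q x)
    = (\<lambda>x. (r \<otimes>\<^bsub>monoid_algebra M\<^esub> p) x + c * (r \<otimes>\<^bsub>monoid_algebra M\<^esub> q) x)"
  by (rule ext) (simp add: monoid_algebra_simps lin_comb[OF assms] lin_fun_comb)

lemma mult_delta: "delta x \<otimes>\<^bsub>monoid_algebra M\<^esub> delta y = delta (x \<otimes>\<^bsub>M\<^esub> y)"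
proof
  fix z show "(delta x \<otimes>\<^bsub>monoid_algebra M\<^esub> delta y) z = delta (x \<otimes>\<^bsub>M\<^esub> y) z"
    unfolding monoid_algebra_simps(2) lin_delta by (auto simp: delta_def)
qed

lemma lin_eval: "finite {x. p x \<noteq> 0} \<Longrightarrow> lin (\<lambda>x. if x = z then 1 else 0) p = p z"
proof -
  assume fin: "finite {x. p x \<noteq> 0}"
  have "lin (\<lambda>x. if x = z then 1 else 0) p = (\<Sum>x\<in>insert z {x. p x \<noteq> 0}. p x * (if x = z then 1 else 0))"
    using fin by (intro lin_superset) auto
  also have "\<dots> = (\<Sum>x\<in>insert z {x. p x \<noteq> 0}. if x = z then p x else 0)"
    by (rule sum.cong) auto
  also have "\<dots> = p z" using fin by (simp only: sum.delta finite_insert insertI1 if_True)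
  finally show ?thesis .
qed

lemma ring_monoid_algebra:
  assumes M: "monoid M" shows "ring (monoid_algebra M)"
proof (rule ringI)
  interpret M: monoid M by fact
  let ?R = "monoid_algebra M"
  show "abelian_group ?R"
  proof (rule abelian_groupI)
    fix p q assume "p \<in> carrier ?R" "q \<in> carrier ?R"
    thus "p \<oplus>\<^bsub>?R\<^esub> q \<in> carrier ?R" using comb_carrier[of p M q 1] by (simp add: monoid_algebra_simps(5))
  next
    fix p assume p: "p \<in> carrier ?R"
    have "(\<lambda>x. - p x) \<in> carrier ?R" using p by (simp add: monoid_algebra_simps)
    thus "\<exists>q\<in>carrier ?R. q \<oplus>\<^bsub>?R\<^esub> p = \<zero>\<^bsub>?R\<^esub>" by (rule bexI[rotated]) (simp add: monoid_algebra_simps)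
  qed (auto simp: monoid_algebra_simps algebra_simps)
  show "Group.monoid ?R"
  proof (rule monoidI)
    fix p q assume "p \<in> carrier ?R" "q \<in> carrier ?R"
    thus "p \<otimes>\<^bsub>?R\<^esub> q \<in> carrier ?R" using M mult_carrier by blast
  next
    fix p q r assume pqr: "p \<in> carrier ?R" "q \<in> carrier ?R" "r \<in> carrier ?R"
    have fin: "finite {x. p x \<noteq> 0}" "finite {x. q x \<noteq> 0}" "finite {x. r x \<noteq> 0}"
      using pqr by (auto simp: monoid_algebra_simps)
    show "p \<otimes>\<^bsub>?R\<^esub> q \<otimes>\<^bsub>?R\<^esub> r = p \<otimes>\<^bsub>?R\<^esub> (q \<otimes>\<^bsub>?R\<^esub> r)"
    proof
      fix z
      have "(p \<otimes>\<^bsub>?R\<^esub> q \<otimes>\<^bsub>?R\<^esub> r) z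
          = lin (\<lambda>x. lin (\<lambda>y. lin (\<lambda>t. if x \<otimes>\<^bsub>M\<^esub> y \<otimes>\<^bsub>M\<^esub> t = z then 1 else 0) r) q) p"
        unfolding monoid_algebra_simps(2)[where q = r] by (rule lin_mult[OF fin(1,2)])
      also have "\<dots> = lin (\<lambda>x. lin (\<lambda>y. lin (\<lambda>t. if x \<otimes>\<^bsub>M\<^esub> (y \<otimes>\<^bsub>M\<^esub> t) = z then 1 else 0) r) q) p"
        by (intro lin_cong) (use pqr M.m_assoc in \<open>auto simp: monoid_algebra_simps(1) subset_iff\<close>)
      also have "\<dots> = (p \<otimes>\<^bsub>?R\<^esub> (q \<otimes>\<^bsub>?R\<^esub> r)) z"
        unfolding monoid_algebra_simps(2)[where p = p] lin_mult[OF fin(2,3)] ..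
      finally show "(p \<otimes>\<^bsub>?R\<^esub> q \<otimes>\<^bsub>?R\<^esub> r) z = (p \<otimes>\<^bsub>?R\<^esub> (q \<otimes>\<^bsub>?R\<^esub> r)) z" .
    qed
  next
    fix p assume p: "p \<in> carrier ?R"
    have "(\<one>\<^bsub>?R\<^esub> \<otimes>\<^bsub>?R\<^esub> p) z = lin (\<lambda>y. if y = z then 1 else 0) p" for z
      unfolding monoid_algebra_simps(2,3) lin_delta
      by (rule lin_cong) (use p in \<open>auto simp: monoid_algebra_simps(1)\<close>)
    moreover have "(p \<otimes>\<^bsub>?R\<^esub> \<one>\<^bsub>?R\<^esub>) z = lin (\<lambda>y. if y = z then 1 else 0) p" for z
      unfolding monoid_algebra_simps(2,3) lin_delta
      by (rule lin_cong) (use p in \<open>auto simp: monoid_algebra_simps(1)\<close>)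
    ultimately show "\<one>\<^bsub>?R\<^esub> \<otimes>\<^bsub>?R\<^esub> p = p" "p \<otimes>\<^bsub>?R\<^esub> \<one>\<^bsub>?R\<^esub> = p"
      using p by (auto simp: lin_eval monoid_algebra_simps(1) fun_eq_iff)
  qed (simp add: monoid_algebra_simps(3))
next
  let ?R = "monoid_algebra M"
  fix p q r assume pqr: "p \<in> carrier ?R" "q \<in> carrier ?R" "r \<in> carrier ?R"
  hence fin: "finite {x. p x \<noteq> 0}" "finite {x. q x \<noteq> 0}"
    by (auto simp: monoid_algebra_simps)
  show "(p \<oplus>\<^bsub>?R\<^esub> q) \<otimes>\<^bsub>?R\<^esub> r = p \<otimes>\<^bsub>?R\<^esub> r \<oplus>\<^bsub>?R\<^esub> q \<otimes>\<^bsub>?R\<^esub> r"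
    "r \<otimes>\<^bsub>?R\<^esub> (p \<oplus>\<^bsub>?R\<^esub> q) = r \<otimes>\<^bsub>?R\<^esub> p \<oplus>\<^bsub>?R\<^esub> r \<otimes>\<^bsub>?R\<^esub> q"
    using mult_comb_left[OF fin, where c = 1 and M = M and r = r]
      mult_comb_right[OF fin, where c = 1 and M = M and r = r]
    by (simp_all add: monoid_algebra_simps(5))
qed

lemma minus_monoid_algebra:
  assumes "monoid M" "p \<in> carrier (monoid_algebra M)" "q \<in> carrier (monoid_algebra M)"
  shows "p \<ominus>\<^bsub>monoid_algebra M\<^esub> q = (\<lambda>x. p x - q x)"
proof -
  interpret ring "monoid_algebra M" using assms(1) by (rule ring_monoid_algebra)
  have "(\<lambda>x. - q x) \<in> carrier (monoid_algebra M)" using assms(3) by (simp add: monoid_algebra_simps)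
  hence "\<ominus>\<^bsub>monoid_algebra M\<^esub> q = (\<lambda>x. - q x)"
    using assms(3) by (intro minus_equality) (auto simp: monoid_algebra_simps(4,5))
  thus ?thesis by (simp add: a_minus_def monoid_algebra_simps(5))
qed

section \<open>Monomials of the Temperley-Lieb algebra\<close>

lemma free_monoid_simps [simp]:
  "carrier (free_monoid X) = lists X" "x \<otimes>\<^bsub>free_monoid X\<^esub> y = x @ y" "\<one>\<^bsub>free_monoid X\<^esub> = []"
  by (simp_all add: free_monoid_def)

lemma monoid_free_monoid: "Group.monoid (free_monoid X)"
  by (rule monoidI) auto

interpretation FA: ring "free_algebra X" for X
  by (rule ring_monoid_algebra[OF monoid_free_monoid])

lemma delta_append: "delta xs \<otimes>\<^bsub>free_algebra X\<^esub> delta ys = delta (xs @ ys)"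
  by (simp add: mult_delta)

lemma finite_delta [simp]: "finite {x. delta y x \<noteq> 0}"
  by simp

lemma setcompr_cong: "(\<And>i. P i \<Longrightarrow> f i = g i) \<Longrightarrow> {f i | i. P i} = {g i | i. P i}"
  "(\<And>i j. Q i j \<Longrightarrow> f' i j = g' i j) \<Longrightarrow> {f' i j | i j. Q i j} = {g' i j | i j. Q i j}"
  by metis+

text \<open>Differences are brought to the form \<open>p x + c * q x\<close> shared by all closure
  and evaluation lemmas.\<close>

lemma TL_relators_eq:
  "TL_relators n =
     {\<lambda>x. delta [i, i] x + (- 2) * delta [i] x | i. i \<in> {1..<n}} \<union>
     {\<lambda>x. delta [i, j] x + (- 1) * delta [j, i] x | i j. i \<in> {1..<n} \<and> j \<in> {1..<n} \<and> \<bar>int i - int j\<bar> \<ge> 2} \<union>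
     {\<lambda>x. delta [i, j, i] x + (- 1) * delta [i] x | i j. i \<in> {1..<n} \<and> j \<in> {1..<n} \<and> \<bar>int i - int j\<bar> = 1}"
proof -
  let ?F = "free_algebra {1..<n}"
  have minus: "delta xs \<ominus>\<^bsub>?F\<^esub> delta ys = (\<lambda>x. delta xs x + (- 1) * delta ys x)"
    "delta xs \<ominus>\<^bsub>?F\<^esub> 2 \<odot>\<^bsub>?F\<^esub> delta ys = (\<lambda>x. delta xs x + (- 2) * delta ys x)"
    if "xs \<in> lists {1..<n}" "ys \<in> lists {1..<n}" for xs ys
  proof -
    have c: "delta xs \<in> carrier ?F" "delta ys \<in> carrier ?F" "2 \<odot>\<^bsub>?F\<^esub> delta ys \<in> carrier ?F"
      using that by (auto simp: monoid_algebra_simps)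
    show "delta xs \<ominus>\<^bsub>?F\<^esub> delta ys = (\<lambda>x. delta xs x + (- 1) * delta ys x)"
      using minus_monoid_algebra[OF monoid_free_monoid c(1,2)] by simp
    show "delta xs \<ominus>\<^bsub>?F\<^esub> 2 \<odot>\<^bsub>?F\<^esub> delta ys = (\<lambda>x. delta xs x + (- 2) * delta ys x)"
      using minus_monoid_algebra[OF monoid_free_monoid c(1,3)] by (simp add: monoid_algebra_simps(6))
  qed
  show ?thesis unfolding TL_relators_def Let_def delta_append append.simps
    by (intro arg_cong2[where f = "(\<union>)"] setcompr_cong; rule minus; auto)
qed

lemma TL_relators_carrier: "TL_relators n \<subseteq> carrier (free_algebra {1..<n})"
  unfolding TL_relators_eq
  by (intro Un_least subsetI; elim CollectE exE conjE; hypsubst; intro comb_carrier delta_carrier; auto)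

lemma ideal_TL_ideal: "ideal (TL_ideal n) (free_algebra {1..<n})"
  unfolding TL_ideal_def by (rule FA.genideal_ideal[OF TL_relators_carrier])

lemma TL_relators_subset: "TL_relators n \<subseteq> TL_ideal n"
  unfolding TL_ideal_def by (rule FA.genideal_self[OF TL_relators_carrier])

lemmas TL_additive_subgroup = ideal.axioms(1)[OF ideal_TL_ideal]
lemmas TL_ideal_closed = ideal.I_l_closed[OF ideal_TL_ideal] ideal.I_r_closed[OF ideal_TL_ideal]

lemma TL_ideal_carrier: "p \<in> TL_ideal n \<Longrightarrow> p \<in> carrier (free_algebra {1..<n})"
  by (rule additive_subgroup.a_Hcarr[OF TL_additive_subgroup])

text \<open>An ideal of the ring is not closed under scalars by definition; writing a scalar as
  multiplication by a multiple of the unit supplies this.\<close>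

lemma smult_mult: "p \<in> carrier (free_algebra X) \<Longrightarrow> (\<lambda>x. c * delta [] x) \<otimes>\<^bsub>free_algebra X\<^esub> p = (\<lambda>x. c * p x)"
  using mult_comb_left[where p = "\<lambda>x. 0" and q = "delta []" and M = "free_monoid X" and c = c and r = p]
    FA.l_one[of p X] FA.l_null[of p X] by (simp add: monoid_algebra_simps(3,4))

lemma TL_ideal_zero: "(\<lambda>x. 0) \<in> TL_ideal n"
  using additive_subgroup.zero_closed[OF TL_additive_subgroup] by (simp add: monoid_algebra_simps)

lemma TL_ideal_smult:
  assumes "q \<in> TL_ideal n" shows "(\<lambda>x. c * q x) \<in> TL_ideal n"
proof -
  have "(\<lambda>x. c * delta [] x) \<in> carrier (free_algebra {1..<n})"
    by (auto simp: monoid_algebra_simps(1))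
  from TL_ideal_closed(1)[OF assms this] show ?thesis
    unfolding smult_mult[OF TL_ideal_carrier[OF assms]] .
qed

lemma TL_ideal_comb:
  assumes "p \<in> TL_ideal n" "q \<in> TL_ideal n" shows "(\<lambda>x. p x + c * q x) \<in> TL_ideal n"
  using additive_subgroup.a_closed[OF TL_additive_subgroup assms(1) TL_ideal_smult[OF assms(2)]]
  by (simp add: monoid_algebra_simps(5))

lemma TL_ideal_sum:
  assumes "finite B" "\<And>b. b \<in> B \<Longrightarrow> q b \<in> TL_ideal n"
  shows "(\<lambda>x. \<Sum>b\<in>B. c b * q b x) \<in> TL_ideal n"
  using assms
proof (induction B rule: finite_induct)
  case (insert b B)
  have "(\<lambda>x. \<Sum>b\<in>insert b B. c b * q b x) = (\<lambda>x. (\<Sum>b\<in>B. c b * q b x) + c b * q b x)"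
    using insert.hyps by (simp add: fun_eq_iff add.commute)
  thus ?case using TL_ideal_comb[of "\<lambda>x. \<Sum>b\<in>B. c b * q b x" n "q b" "c b"] insert by simp
qed (simp add: TL_ideal_zero)

text \<open>Congruence of one monomial with a multiple of another modulo the ideal. This binary form
  suffices because every relator is a difference of two multiples of monomials.\<close>

definition word_eqv :: "nat \<Rightarrow> nat list \<Rightarrow> complex \<Rightarrow> nat list \<Rightarrow> bool" where
  "word_eqv n is k js \<longleftrightarrow> (\<lambda>x. delta is x + (- k) * delta js x) \<in> TL_ideal n"

lemma word_eqv_refl: "word_eqv n is 1 is"
  using TL_ideal_zero by (simp add: word_eqv_def)

lemma word_eqv_trans: 
  assumes "word_eqv n is k js" "word_eqv n js m ks" shows "word_eqv n is (k * m) ks"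
proof -
  have "(\<lambda>x. (delta is x + (- k) * delta js x) + k * (delta js x + (- m) * delta ks x)) \<in> TL_ideal n"
    using assms unfolding word_eqv_def by (rule TL_ideal_comb)
  thus ?thesis by (simp add: word_eqv_def algebra_simps)
qed

lemma word_eqv_context:
  assumes "word_eqv n is k js" "set xs \<subseteq> {1..<n}" "set ys \<subseteq> {1..<n}"
  shows "word_eqv n (xs @ is @ ys) k (xs @ js @ ys)"
proof -
  let ?F = "free_algebra {1..<n}"
  have "delta xs \<otimes>\<^bsub>?F\<^esub> (\<lambda>x. delta is x + (- k) * delta js x) \<otimes>\<^bsub>?F\<^esub> delta ys \<in> TL_ideal n"
    using assms unfolding word_eqv_def
    by (intro TL_ideal_closed delta_carrier) auto
  thus ?thesis unfolding word_eqv_def mult_comb_right[OF finite_delta finite_delta]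
      mult_comb_left[OF finite_delta finite_delta] delta_append by simp
qed

lemma word_eqv_square: "i \<in> {1..<n} \<Longrightarrow> word_eqv n [i, i] 2 [i]"
  unfolding word_eqv_def by (rule subsetD[OF TL_relators_subset]) (auto simp: TL_relators_eq)

lemma word_eqv_commute:
  assumes "i \<in> {1..<n}" "j \<in> {1..<n}" "Suc i < j \<or> Suc j < i"
  shows "word_eqv n [i, j] 1 [j, i]"
proof -
  have "\<bar>int i - int j\<bar> \<ge> 2" using assms(3) by auto
  thus ?thesis using assms(1,2)
    unfolding word_eqv_def by (intro subsetD[OF TL_relators_subset]) (auto simp: TL_relators_eq)
qed

lemma word_eqv_braid:
  assumes "i \<in> {1..<n}" "j \<in> {1..<n}" "j = Suc i \<or> i = Suc j"
  shows "word_eqv n [i, j, i] 1 [i]"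
proof -
  have "\<bar>int i - int j\<bar> = 1" using assms(3) by auto
  thus ?thesis using assms(1,2)
    unfolding word_eqv_def by (intro subsetD[OF TL_relators_subset]) (auto simp: TL_relators_eq)
qed

lemma word_eqv_commute_past:
  assumes "i \<in> {1..<n}" "set ms \<subseteq> {1..<n}" "\<And>m. m \<in> set ms \<Longrightarrow> Suc i < m \<or> Suc m < i"
  shows "word_eqv n (ms @ [i]) 1 (i # ms)"
  using assms(2,3)
proof (induction ms)
  case (Cons m ms)
  have "word_eqv n (m # ms @ [i]) 1 (m # i # ms)"
    using word_eqv_context[of n "ms @ [i]" 1 "i # ms" "[m]" "[]"] Cons by simp
  moreover have "word_eqv n (m # i # ms) 1 (i # m # ms)"
    using word_eqv_context[OF word_eqv_commute[of m n i], of "[]" ms] Cons assms(1) by auto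
  ultimately show ?case using word_eqv_trans by fastforce
qed (simp add: word_eqv_refl)

lemma word_eqv_reduced:
  assumes "avoids_321 v" "v permutes {1..n}" "set is \<subseteq> {1..<n}" "set js \<subseteq> {1..<n}" "reduced v is" "reduced v js"
  shows "word_eqv n is 1 js"
proof -
  have "word_eqv n is 1 js = word_eqv n js 1 js"
  proof (rule reduced_commutation_invariant[OF assms, of "\<lambda>ks. word_eqv n ks 1 js"])
    fix xs ys i j assume *: "set (xs @ i # j # ys) \<subseteq> {1..<n}" "Suc i < j \<or> Suc j < i"
    have "word_eqv n (xs @ i # j # ys) 1 (xs @ j # i # ys)"
      "word_eqv n (xs @ j # i # ys) 1 (xs @ i # j # ys)"
      using word_eqv_context[OF word_eqv_commute[of i n j], of xs ys]
        word_eqv_context[OF word_eqv_commute[of j n i], of xs ys] * by auto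
    thus "word_eqv n (xs @ i # j # ys) 1 js = word_eqv n (xs @ j # i # ys) 1 js"
      using word_eqv_trans[of n _ 1 _ 1 js] by fastforce
  qed
  thus ?thesis by (simp add: word_eqv_refl)
qed

text \<open>The same choice as inside \<open>TL_beta\<close>, so that both speak of one
  word.\<close>

definition rw :: "nat \<Rightarrow> (nat \<Rightarrow> nat) \<Rightarrow> nat list" where
  "rw n w = (SOME is. reduced_word n w is)"

lemma rw:
  assumes "w permutes {1..n}" shows "set (rw n w) \<subseteq> {1..<n}" "reduced w (rw n w)"
proof -
  have "\<exists>is. reduced_word n w is" using reduced_exists[OF assms] reduced_word_iff[OF assms] by auto
  hence "reduced_word n w (rw n w)" unfolding rw_def by (rule someI_ex)
  thus "set (rw n w) \<subseteq> {1..<n}" "reduced w (rw n w)" using reduced_word_iff[OF assms] by auto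
qed

text \<open>The value at \<open>j\<close> is smaller than those at \<open>i\<close>, ...,
  \<open>j - 1\<close>, so it can be moved left to \<open>i\<close> by one descent after another.
  The letters used appear at the end of the word.\<close>

lemma reduced_move_left:
  assumes "v permutes {1..n}" "1 \<le> i" "i \<le> j" "j \<le> n" "\<And>m. i \<le> m \<Longrightarrow> m < j \<Longrightarrow> v j < v m"
  shows "\<exists>r. set r \<subseteq> {1..<n} \<and> reduced v (r @ [i..<j])"
  using assms(3,1,4,5)
proof (induction j arbitrary: v rule: dec_induct)
  case base
  then show ?case using reduced_exists by fastforce
next
  case (step j)
  let ?v = "v \<circ> st j"
  have "?v permutes {1..n}" using step.prems step.hyps assms(2) by (intro comp_st_permutes) auto
  moreover have "?v j < ?v m" if "i \<le> m" "m < j" for m using step.prems(3)[of m] that by simp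
  ultimately obtain r where r: "set r \<subseteq> {1..<n}" "reduced ?v (r @ [i..<j])"
    using step.IH[OF _ Suc_leD[OF step.prems(2)]] by blast
  have "reduced v ((r @ [i..<j]) @ [j])" using r(2) step.prems(3)[of j] step.hyps by (intro reduced_snoc) auto
  thus ?case using r(1) step.hyps by (intro exI[of _ r]) simp
qed

lemma reduced_move_right:
  assumes "v permutes {1..n}" "1 \<le> j" "j \<le> k" "k \<le> n" "\<And>m. j < m \<Longrightarrow> m \<le> k \<Longrightarrow> v m < v j"
  shows "\<exists>r. set r \<subseteq> {1..<n} \<and> reduced v (r @ rev [j..<k])"
  using assms(3,1,2,5)
proof (induction j arbitrary: v rule: inc_induct)
  case base
  then show ?case using reduced_exists by fastforce
next
  case (step j)
  let ?v = "v \<circ> st j"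
  have "?v permutes {1..n}" using step.prems step.hyps assms(4) by (intro comp_st_permutes) auto
  moreover have "?v m < ?v (Suc j)" if "Suc j < m" "m \<le> k" for m using step.prems(3)[of m] that by simp
  ultimately obtain r where r: "set r \<subseteq> {1..<n}" "reduced ?v (r @ rev [Suc j..<k])"
    using step.IH[OF _ le_SucI[OF step.prems(2)]] by blast
  have "reduced v ((r @ rev [Suc j..<k]) @ [j])"
    using r(2) step.prems(3)[of "Suc j"] step.hyps by (intro reduced_snoc) auto
  thus ?case using r(1) step.hyps by (intro exI[of _ r]) (simp add: upt_conv_Cons)
qed

text \<open>A pattern created by the exchange must use the new descent at \<open>i, Suc i\<close>.
  Its third member lies to the right with a smaller value or to the left with a greater one.\<close>

lemma avoids_321_comp_st_cases:
  assumes v: "avoids_321 v" and lt: "v i < v (Suc i)"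
  shows "avoids_321 (v \<circ> st i) \<or> (\<exists>j. Suc i < j \<and> v j < v i) \<or> (\<exists>j<i. v (Suc i) < v j)"
proof (rule ccontr)
  assume "\<not> ?thesis"
  hence no: "\<And>j. Suc i < j \<Longrightarrow> \<not> v j < v i" "\<And>j. j < i \<Longrightarrow> \<not> v (Suc i) < v j"
    and "\<not> avoids_321 (v \<circ> st i)" by auto
  then obtain x y z where xyz: "x < y" "y < z" "v (st i y) < v (st i x)" "v (st i z) < v (st i y)"
    by (auto simp: avoids_321_def)
  have "\<not> (x = i \<and> y = Suc i)" using no(1)[of z] xyz by auto
  moreover have "\<not> (y = i \<and> z = Suc i)" using no(2)[of x] xyz by auto
  ultimately have "st i x < st i y" "st i y < st i z" using xyz(1,2) by (auto simp: st_apply)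
  thus False using avoids_321D[OF v] xyz(3,4) by blast
qed

text \<open>A further letter either lengthens the reduced word, or repeats its last letter, or
  produces a factor \<open>i j i\<close> after commutations and so shortens the word.\<close>

lemma word_eqv_snoc:
  assumes v: "avoids_321 v" "v permutes {1..n}" and i: "i \<in> {1..<n}"
  shows "(\<exists>k v'. avoids_321 v' \<and> v' permutes {1..n} \<and> word_eqv n (rw n v @ [i]) k (rw n v') \<and>
            length (rw n v') \<le> Suc (length (rw n v))) \<or>
         (\<exists>js. set js \<subseteq> {1..<n} \<and> word_eqv n (rw n v @ [i]) 1 js \<and> length js \<le> length (rw n v))"
proof -
  note rwv = rw[OF v(2)]
  have app: "word_eqv n (rw n v @ [i]) 1 (r @ [i])" if "set r \<subseteq> {1..<n}" "reduced v r" for r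
    using word_eqv_context[OF word_eqv_reduced[OF v rwv(1) that(1) rwv(2) that(2)], of "[]" "[i]"] i by simp
  have perm: "permutation v" using v(2) permutation_permutes by auto
  have vi: "v \<circ> st i permutes {1..n}" using v(2) i by (rule comp_st_permutes)
  consider "v (Suc i) < v i" | "v i < v (Suc i)" "avoids_321 (v \<circ> st i)"
    | "v i < v (Suc i)" "\<exists>j. Suc i < j \<and> v j < v i" | "v i < v (Suc i)" "\<exists>j<i. v (Suc i) < v j"
    using permutation_ascent_or_descent[OF perm, of i] avoids_321_comp_st_cases[OF v(1)] by blast
  thus ?thesis
  proof cases
    case 1
    obtain r where r: "set r \<subseteq> {1..<n}" "reduced (v \<circ> st i) r" using reduced_exists[OF vi] by blast
    have red: "reduced v (r @ [i])" using r(2) 1 by (rule reduced_snoc)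
    have "word_eqv n (rw n v @ [i]) 1 (r @ [i, i])" using app[OF _ red] r i by simp
    moreover have "word_eqv n (r @ [i, i]) 2 (r @ [i])"
      using word_eqv_context[OF word_eqv_square[OF i] r(1), of "[]"] by simp
    moreover have "word_eqv n (r @ [i]) 1 (rw n v)"
      using word_eqv_reduced[OF v _ rwv(1) red rwv(2)] r i by simp
    ultimately have "word_eqv n (rw n v @ [i]) (1 * 2 * 1) (rw n v)" using word_eqv_trans by blast
    thus ?thesis using v by (intro disjI1 exI[of _ "1 * 2 * 1"] exI[of _ v]) simp
  next
    case 2
    have red: "reduced (v \<circ> st i) (rw n v @ [i])" using rwv(2) 2(1) by (intro reduced_snoc) simp_all
    note rwvi = rw[OF vi]
    have "word_eqv n (rw n v @ [i]) 1 (rw n (v \<circ> st i))"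
      using word_eqv_reduced[OF 2(2) vi _ rwvi(1) red rwvi(2)] rwv i by simp
    moreover have "length (rw n (v \<circ> st i)) = Suc (length (rw n v))"
      using red rwvi(2) by (auto simp: reduced_def)
    ultimately show ?thesis using 2(2) vi by (intro disjI1 exI[of _ 1] exI[of _ "v \<circ> st i"]) simp
  next
    case 3
    \<comment> \<open>With the least such \<open>j\<close> all values at \<open>i\<close>, ...,
      \<open>j - 1\<close> exceed \<open>v j\<close>, so the reduced word may end in
      \<open>i, i + 1, ..., j - 1\<close>. The appended \<open>i\<close> commutes back past the
      letters from \<open>i + 2\<close> on and meets \<open>i, i + 1\<close>.\<close>
    define j where "j = (LEAST j. Suc i < j \<and> v j < v i)"
    have j: "Suc i < j" "v j < v i" using LeastI_ex[OF 3(2)] by (auto simp: j_def)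
    have min: "\<not> v m < v i" if "Suc i < m" "m < j" for m
      using not_less_Least[of m "\<lambda>j. Suc i < j \<and> v j < v i"] that by (auto simp: j_def)
    have jn: "j \<le> n"
    proof (rule ccontr)
      assume "\<not> j \<le> n"
      hence "v j = j" using permutes_not_in[OF v(2), of j] by simp
      moreover have "v i \<le> n" using permutes_in_image[OF v(2), of i] i by auto
      ultimately show False using j(2) \<open>\<not> j \<le> n\<close> by simp
    qed
    have "v j < v m" if "i \<le> m" "m < j" for m
      using min[of m] j that 3(1) by (cases "m = i"; cases "m = Suc i") auto
    then obtain r where r: "set r \<subseteq> {1..<n}" "reduced v (r @ [i..<j])"
      using reduced_move_left[OF v(2), of i j] i j jn by auto
    let ?ms = "[Suc (Suc i)..<j]"
    have eq: "[i..<j] = i # Suc i # ?ms" using j by (simp add: upt_conv_Cons)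
    have ms: "set ?ms \<subseteq> {1..<n}" using jn by auto
    have A: "word_eqv n (rw n v @ [i]) 1 ((r @ [i, Suc i]) @ (?ms @ [i]) @ [])"
      using app[OF _ r(2)] r(1) i jn j by (auto simp: eq)
    have B: "word_eqv n ((r @ [i, Suc i]) @ (?ms @ [i]) @ []) 1 ((r @ [i, Suc i]) @ (i # ?ms) @ [])"
      by (intro word_eqv_context word_eqv_commute_past) (use i j jn r in auto)
    have C: "word_eqv n (r @ [i, Suc i, i] @ ?ms) 1 (r @ [i] @ ?ms)"
      by (intro word_eqv_context word_eqv_braid) (use i j jn r in auto)
    hence "word_eqv n ((r @ [i, Suc i]) @ (i # ?ms) @ []) 1 (r @ [i] @ ?ms)" by simp
    from word_eqv_trans[OF word_eqv_trans[OF A B] this]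
    have "word_eqv n (rw n v @ [i]) 1 (r @ [i] @ ?ms)" by simp
    moreover have "length (r @ [i] @ ?ms) \<le> length (rw n v)"
      using r(2) rwv(2) j by (auto simp: reduced_def)
    ultimately show ?thesis using r(1) i ms by (intro disjI2 exI[of _ "r @ [i] @ ?ms"]) simp
  next
    case 4
    \<comment> \<open>Mirror image: the greatest such \<open>j\<close> lets the value at
      \<open>j\<close> be moved right to \<open>Suc i\<close>, and the word may end in
      \<open>i, i - 1, ..., j\<close>.\<close>
    define j where "j = Max {j. j < i \<and> v (Suc i) < v j}"
    let ?S = "{j. j < i \<and> v (Suc i) < v j}"
    have fin: "finite ?S" by simp
    have "j \<in> ?S" unfolding j_def by (rule Max_in[OF fin]) (use 4(2) in auto)
    moreover have max: "m \<le> j" if "m \<in> ?S" for m unfolding j_def using fin that by (rule Max_ge)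
    ultimately have j: "j < i" "v (Suc i) < v j" by auto
    have j1: "1 \<le> j"
    proof (rule ccontr)
      assume "\<not> 1 \<le> j"
      hence "v j = 0" using permutes_not_in[OF v(2), of j] by simp
      thus False using j(2) by simp
    qed
    have "v m < v j" if "j < m" "m \<le> Suc i" for m
    proof -
      consider "m = Suc i" | "m = i" | "m < i" using \<open>m \<le> Suc i\<close> by linarith
      thus ?thesis
      proof cases
        case 3
        hence "\<not> v (Suc i) < v m" using max[of m] that by auto
        thus ?thesis using j by simp
      qed (use j 4(1) in auto)
    qed
    then obtain r where r: "set r \<subseteq> {1..<n}" "reduced v (r @ rev [j..<Suc i])"
      using reduced_move_right[OF v(2), of j "Suc i"] i j j1 by auto
    let ?ms = "rev [j..<i - 1]"
    have "[j..<Suc i] = [j..<i - 1] @ [i - 1, i]"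
      using j by (metis One_nat_def Suc_pred append_Cons append_Nil append_assoc less_Suc_eq_le less_imp_le_nat
          nat_less_le not_less_zero upt_Suc_append gr0I Suc_leI)
    hence eq: "rev [j..<Suc i] = i # (i - 1) # ?ms" by simp
    have ms: "set ?ms \<subseteq> {1..<n}" using i j1 by auto
    have A: "word_eqv n (rw n v @ [i]) 1 ((r @ [i, i - 1]) @ (?ms @ [i]) @ [])"
    proof -
      have "i - 1 \<in> {1..<n}" using i j j1 by auto
      thus ?thesis using app[OF _ r(2)] r(1) i ms unfolding eq by simp
    qed
    have B: "word_eqv n ((r @ [i, i - 1]) @ (?ms @ [i]) @ []) 1 ((r @ [i, i - 1]) @ (i # ?ms) @ [])"
      by (intro word_eqv_context word_eqv_commute_past) (use i j j1 r in auto)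
    have C: "word_eqv n (r @ [i, i - 1, i] @ ?ms) 1 (r @ [i] @ ?ms)"
      by (intro word_eqv_context word_eqv_braid) (use i j j1 r in auto)
    hence "word_eqv n ((r @ [i, i - 1]) @ (i # ?ms) @ []) 1 (r @ [i] @ ?ms)" by simp
    from word_eqv_trans[OF word_eqv_trans[OF A B] this]
    have "word_eqv n (rw n v @ [i]) 1 (r @ [i] @ ?ms)" by simp
    moreover have "length (r @ [i] @ ?ms) \<le> length (rw n v)"
      using r(2) rwv(2) j unfolding eq by (auto simp: reduced_def)
    ultimately show ?thesis using r(1) i ms by (intro disjI2 exI[of _ "r @ [i] @ ?ms"]) simp
  qed
qed

text \<open>The length bound belongs to the induction: the shortened word that
  \<open>word_eqv_snoc\<close> may return is normalised again by the induction hypothesis.\<close>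

lemma word_eqv_exists:
  assumes "set is \<subseteq> {1..<n}"
  shows "\<exists>k v. avoids_321 v \<and> v permutes {1..n} \<and> word_eqv n is k (rw n v) \<and> length (rw n v) \<le> length is"
  using assms
proof (induction "is" rule: length_induct)
  case (1 "is")
  show ?case
  proof (cases "is" rule: rev_cases)
    case Nil
    have "rw n id = []" using rw[OF permutes_id[of "{1..n}"]] by (auto simp: reduced_def)
    hence "word_eqv n is 1 (rw n id) \<and> length (rw n id) \<le> length is"
      using word_eqv_refl[of n "[]"] Nil by simp
    moreover have "avoids_321 id" by (simp add: avoids_321_def)
    ultimately show ?thesis using permutes_id[of "{1..n}"] by blast
  next
    case (snoc is' i)
    have i: "i \<in> {1..<n}" and is': "set is' \<subseteq> {1..<n}" using 1(2) snoc by auto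
    obtain k v where v: "avoids_321 v" "v permutes {1..n}" and
      w: "word_eqv n is' k (rw n v)" "length (rw n v) \<le> length is'"
      using 1(1)[rule_format, of is'] is' snoc by auto
    have w': "word_eqv n is k (rw n v @ [i])"
      using word_eqv_context[OF w(1), of "[]" "[i]"] i snoc by simp
    from word_eqv_snoc[OF v i] show ?thesis
    proof (elim disjE exE conjE)
      fix k' v' assume *: "avoids_321 v'" "v' permutes {1..n}" "word_eqv n (rw n v @ [i]) k' (rw n v')"
        "length (rw n v') \<le> Suc (length (rw n v))"
      thus ?thesis using word_eqv_trans[OF w' *(3)] w(2) snoc
        by (intro exI[of _ "k * k'"] exI[of _ v']) auto
    next
      fix js assume *: "set js \<subseteq> {1..<n}" "word_eqv n (rw n v @ [i]) 1 js" "length js \<le> length (rw n v)"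
      then obtain k' v' where v': "avoids_321 v'" "v' permutes {1..n}" "word_eqv n js k' (rw n v')"
        "length (rw n v') \<le> length js"
        using 1(1)[rule_format, of js] w(2) snoc by auto
      have "word_eqv n is (k * 1 * k') (rw n v')"
        using word_eqv_trans[OF word_eqv_trans[OF w' *(2)] v'(3)] .
      thus ?thesis using v' * w(2) snoc by (intro exI[of _ "k * 1 * k'"] exI[of _ v']) auto
    qed
  qed
qed

section \<open>The basis and the coefficients\<close>

text \<open>At the first disagreement \<open>i\<close>, the value \<open>u i\<close> is taken by
  \<open>v\<close> at a later position on the same side of \<open>I\<close>, and \<open>v\<close>
  increases there.\<close>

lemma increasing_lex_least:
  fixes u v :: "nat \<Rightarrow> nat"
  assumes uv: "u permutes {1..n}" "v permutes {1..n}" and img: "u ` I = v ` I"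
    and mono: "\<And>i j. i < j \<Longrightarrow> i \<in> {1..n} \<Longrightarrow> j \<in> {1..n} \<Longrightarrow> i \<in> I \<longleftrightarrow> j \<in> I \<Longrightarrow> v i < v j"
    and ne: "u \<noteq> v"
  shows "\<exists>i. (\<forall>j<i. u j = v j) \<and> v i < u i"
proof -
  define i where "i = (LEAST i. u i \<noteq> v i)"
  have i: "u i \<noteq> v i" unfolding i_def by (rule LeastI_ex) (use ne in auto)
  have less: "u j = v j" if "j < i" for j using that not_less_Least unfolding i_def by blast
  have i1: "i \<in> {1..n}" using i uv by (metis permutes_not_in)
  define k where "k = inv' v (u i)"
  have vk: "v k = u i" unfolding k_def using uv(2) by (simp add: permutes_inverses)
  have k1: "k \<in> {1..n}" using vk i1 uv permutes_in_image by metis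
  have "k \<noteq> i" using vk i by auto
  moreover have "\<not> k < i"
  proof
    assume "k < i"
    hence "u k = u i" using less vk by simp
    thus False using uv(1) \<open>k < i\<close> by (metis permutes_inj injD less_irrefl)
  qed
  ultimately have "i < k" by simp
  have "i \<in> I \<longleftrightarrow> k \<in> I"
    using img vk uv by (metis image_iff inj_image_mem_iff permutes_inj)
  hence "v i < v k" using mono[OF \<open>i < k\<close>] i1 k1 by simp
  thus ?thesis using less vk by auto
qed

text \<open>\<open>ev\<close> and \<open>sact\<close> are the right actions of the free algebra and
  of the group algebra on row vectors, hence the reversed composition in \<open>ev_mult\<close> and
  \<open>sact_mult\<close>. The sign in \<open>sact\<close> reflects that theta(s_i) = t_i - 1 acts
  as -s_i.\<close>

definition ev :: "(nat list \<Rightarrow> complex) \<Rightarrow> (nat set \<Rightarrow> complex) \<Rightarrow> nat set \<Rightarrow> complex" where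
  "ev p \<Phi> J = lin (\<lambda>is. wact is \<Phi> J) p"

definition sact :: "((nat \<Rightarrow> nat) \<Rightarrow> complex) \<Rightarrow> (nat set \<Rightarrow> complex) \<Rightarrow> nat set \<Rightarrow> complex" where
  "sact q \<Phi> J = lin (\<lambda>u. of_int (sign u) * \<Phi> (u ` J)) q"

lemma wact_lin: "wact js (\<lambda>J. lin (\<lambda>x. g x J) p) = (\<lambda>J. lin (\<lambda>x. wact js (g x) J) p)"
proof (induction js arbitrary: g)
  case (Cons j js)
  have "tact j (\<lambda>J. lin (\<lambda>x. g x J) p) = (\<lambda>J. lin (\<lambda>x. tact j (g x) J) p)"
    by (simp add: tact_def lin_def sum_subtractf right_diff_distrib fun_eq_iff)
  with Cons show ?case by simp
qed simp

lemma carrier_finite: "p \<in> carrier (monoid_algebra M) \<Longrightarrow> finite {x. p x \<noteq> 0}"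
  by (simp add: monoid_algebra_simps(1))

lemma ev_mult:
  assumes "p \<in> carrier (free_algebra X)" "q \<in> carrier (free_algebra X)"
  shows "ev (p \<otimes>\<^bsub>free_algebra X\<^esub> q) \<Phi> = ev q (ev p \<Phi>)"
proof
  fix J
  have "ev (p \<otimes>\<^bsub>free_algebra X\<^esub> q) \<Phi> J = lin (\<lambda>x. lin (\<lambda>y. wact (x @ y) \<Phi> J) q) p"
    unfolding ev_def by (subst lin_mult) (use assms in \<open>simp_all add: carrier_finite\<close>)
  also have "\<dots> = lin (\<lambda>y. lin (\<lambda>x. wact y (wact x \<Phi>) J) p) q"
    by (subst lin_swap) simp
  also have "\<dots> = ev q (ev p \<Phi>) J"
    unfolding ev_def wact_lin ..
  finally show "ev (p \<otimes>\<^bsub>free_algebra X\<^esub> q) \<Phi> J = ev q (ev p \<Phi>) J" .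
qed

lemma ev_delta: "ev (delta is) \<Phi> = wact is \<Phi>"
  by (simp add: ev_def fun_eq_iff)

lemma ev_comb:
  assumes "finite {x. p x \<noteq> 0}" "finite {x. q x \<noteq> 0}"
  shows "ev (\<lambda>x. p x + c * q x) \<Phi> J = ev p \<Phi> J + c * ev q \<Phi> J"
  unfolding ev_def by (rule lin_comb[OF assms])

lemma ev_zero_fun: "ev p (\<lambda>_. 0) = (\<lambda>_. 0)"
proof -
  have "wact is (\<lambda>_. 0) J = 0" for "is" J
    using wact_lin[of "is" "\<lambda>_ _. 0" "\<lambda>_. 0"] by simp
  thus ?thesis by (simp add: ev_def fun_eq_iff)
qed

text \<open>The elements acting as zero form an ideal, and the relators are among them.\<close>

lemma ev_TL_ideal:
  assumes "p \<in> TL_ideal n" shows "ev p \<Phi> J = 0"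
proof -
  let ?F = "free_algebra {1..<n}"
  let ?K = "{p \<in> carrier ?F. \<forall>\<Phi> J. ev p \<Phi> J = 0}"
  have comb: "(\<lambda>x. p x + c * q x) \<in> ?K" if "p \<in> ?K" "q \<in> ?K" for p q c
    using that by (auto simp: ev_comb carrier_finite intro!: comb_carrier)
  have zero: "(\<lambda>x. 0) \<in> ?K" by (auto simp: monoid_algebra_simps(1) ev_def)
  have "ideal ?K ?F"
  proof (rule idealI[OF FA.ring_axioms])
    show "subgroup ?K (add_monoid ?F)"
    proof
      fix p assume p: "p \<in> ?K"
      have "(\<lambda>x. - p x) \<in> ?K" using comb[OF zero p, of "- 1"] by simp
      moreover have "inv\<^bsub>add_monoid ?F\<^esub> p = (\<lambda>x. - p x)"
        unfolding a_inv_def[symmetric]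
        by (rule FA.minus_equality) (use p calculation in \<open>auto simp: monoid_algebra_simps(4,5)\<close>)
      ultimately show "inv\<^bsub>add_monoid ?F\<^esub> p \<in> ?K" by simp
    next
      fix p q assume "p \<in> ?K" "q \<in> ?K"
      thus "p \<otimes>\<^bsub>add_monoid ?F\<^esub> q \<in> ?K" using comb[of p q 1] by (simp add: monoid_algebra_simps(5))
    qed (use zero in \<open>auto simp: monoid_algebra_simps(4)\<close>)
  next
    fix p x assume "p \<in> ?K" "x \<in> carrier ?F"
    thus "x \<otimes>\<^bsub>?F\<^esub> p \<in> ?K" by (auto simp: ev_mult FA.m_closed)
  next
    fix p x assume *: "p \<in> ?K" "x \<in> carrier ?F"
    hence "ev p \<Phi> = (\<lambda>_. 0)" for \<Phi> by auto
    thus "p \<otimes>\<^bsub>?F\<^esub> x \<in> ?K" using * by (auto simp: ev_mult FA.m_closed ev_zero_fun)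
  qed
  moreover have "TL_relators n \<subseteq> ?K"
  proof
    fix r assume r: "r \<in> TL_relators n"
    have "ev r \<Phi> J = 0" for \<Phi> J
      using r unfolding TL_relators_eq
    proof (elim UnE CollectE exE conjE)
      fix i assume "r = (\<lambda>x. delta [i, i] x + - 2 * delta [i] x)"
      thus ?thesis
        by (simp only: ev_comb[OF finite_delta finite_delta] ev_delta) (simp add: tact_idem)
    next
      fix i j assume "r = (\<lambda>x. delta [i, j] x + - 1 * delta [j, i] x)" "2 \<le> \<bar>int i - int j\<bar>"
      moreover from this have "Suc i < j \<or> Suc j < i" by auto
      ultimately show ?thesis
        using tact_commute[of i j \<Phi>] by (simp only: ev_comb[OF finite_delta finite_delta] ev_delta) simp
    next
      fix i j assume "r = (\<lambda>x. delta [i, j, i] x + - 1 * delta [i] x)" "\<bar>int i - int j\<bar> = 1"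
      moreover from this have "j = Suc i \<or> i = Suc j" by auto
      ultimately show ?thesis
        by (simp only: ev_comb[OF finite_delta finite_delta] ev_delta) (simp add: tact_braid)
    qed
    thus "r \<in> ?K" using r TL_relators_carrier by auto
  qed
  ultimately have "TL_ideal n \<subseteq> ?K" unfolding TL_ideal_def by (rule FA.genideal_minimal)
  thus ?thesis using assms by auto
qed

abbreviation Av :: "nat \<Rightarrow> (nat \<Rightarrow> nat) set" where "Av \<equiv> perms_avoiding_321"

lemma finite_Av [simp]: "finite (Av n)"
  by (rule finite_subset[OF _ finite_permutations[of "{1..n}"]]) (auto simp: perms_avoiding_321_iff)

definition beta_comb :: "nat \<Rightarrow> ((nat \<Rightarrow> nat) \<Rightarrow> complex) \<Rightarrow> nat list \<Rightarrow> complex" where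
  "beta_comb n g x = (\<Sum>v\<in>Av n. g v * delta (rw n v) x)"

lemma beta_comb_carrier: "beta_comb n g \<in> carrier (free_algebra {1..<n})"
  unfolding beta_comb_def[abs_def]
proof (rule sum_carrier[OF finite_Av])
  fix v assume "v \<in> Av n"
  hence "rw n v \<in> lists {1..<n}" using rw(1)[of v n] by (simp add: perms_avoiding_321_iff in_lists_conv_set subset_iff)
  thus "delta (rw n v) \<in> carrier (free_algebra {1..<n})" by (intro delta_carrier) simp
qed

lemma ev_beta_comb: "ev (beta_comb n g) \<Phi> J = (\<Sum>v\<in>Av n. g v * wact (rw n v) \<Phi> J)"
  unfolding beta_comb_def[abs_def] ev_def by (subst lin_sum(1)) simp_all

text \<open>The spanning half of the basis property: each monomial is replaced by a multiple of a
  chosen reduced word, and the coefficients are collected by permutation.\<close>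

lemma beta_comb_exists:
  assumes p: "p \<in> carrier (free_algebra {1..<n})"
  shows "\<exists>g. (\<lambda>x. p x + (- 1) * beta_comb n g x) \<in> TL_ideal n"
proof -
  let ?S = "{x. p x \<noteq> 0}"
  have fin: "finite ?S" and S: "\<And>x. x \<in> ?S \<Longrightarrow> set x \<subseteq> {1..<n}"
    using p by (auto simp: monoid_algebra_simps(1))
  have "\<forall>x\<in>?S. \<exists>k v. v \<in> Av n \<and> word_eqv n x k (rw n v)"
    using word_eqv_exists[OF S] by (auto simp: perms_avoiding_321_iff) blast
  then obtain k v where kv: "\<And>x. x \<in> ?S \<Longrightarrow> v x \<in> Av n" "\<And>x. x \<in> ?S \<Longrightarrow> word_eqv n x (k x) (rw n (v x))"
    by metis
  define g where "g w = (\<Sum>x | x \<in> ?S \<and> v x = w. p x * k x)" for w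
  have "(\<lambda>y. \<Sum>x\<in>?S. p x * (delta x y + (- k x) * delta (rw n (v x)) y)) \<in> TL_ideal n"
    by (rule TL_ideal_sum[OF fin]) (use kv(2) in \<open>auto simp: word_eqv_def\<close>)
  moreover have "(\<Sum>x\<in>?S. p x * (delta x y + (- k x) * delta (rw n (v x)) y)) = p y + (- 1) * beta_comb n g y" for y
  proof -
    have 1: "(\<Sum>x\<in>?S. p x * delta x y) = p y"
      unfolding lin_eval[OF fin, of y, symmetric] lin_def by (rule sum.cong) (auto simp: delta_def)
    have "(\<Sum>x\<in>?S. p x * k x * delta (rw n (v x)) y)
        = (\<Sum>w\<in>Av n. \<Sum>x | x \<in> ?S \<and> v x = w. p x * k x * delta (rw n (v x)) y)"
      by (rule sum.group[symmetric]) (use fin kv(1) in auto)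
    also have "\<dots> = beta_comb n g y"
      unfolding beta_comb_def g_def sum_distrib_right by (intro sum.cong refl) auto
    finally have 2: "(\<Sum>x\<in>?S. p x * k x * delta (rw n (v x)) y) = beta_comb n g y" .
    have "(\<Sum>x\<in>?S. p x * (delta x y + (- k x) * delta (rw n (v x)) y))
       = (\<Sum>x\<in>?S. p x * delta x y) - (\<Sum>x\<in>?S. p x * k x * delta (rw n (v x)) y)"
      unfolding sum_subtractf[symmetric] by (intro sum.cong refl) (simp add: algebra_simps)
    thus ?thesis unfolding 1 2 by simp
  qed
  ultimately show ?thesis by (intro exI[of _ g]) simp
qed

lemma sact_delta: "sact (delta u) \<Phi> J = of_int (sign u) * \<Phi> (u ` J)"
  by (simp add: sact_def)

lemma word_lift_exists:
  assumes "set is \<subseteq> {1..<n}"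
  shows "\<exists>p\<in>carrier (free_algebra {1..<n}). \<forall>\<Phi> J. ev p \<Phi> J = sact (delta (word_perm is)) \<Phi> J"
  using assms
proof (induction "is" rule: rev_induct)
  case Nil
  show ?case
    by (rule bexI[of _ "delta []"]) (simp_all add: ev_delta sact_delta)
next
  case (snoc i "is")
  let ?F = "free_algebra {1..<n}"
  obtain p where p: "p \<in> carrier ?F" "\<And>\<Phi> J. ev p \<Phi> J = sact (delta (word_perm is)) \<Phi> J"
    using snoc by auto
  have i: "delta [i] \<in> carrier ?F" using snoc by auto
  \<comment> \<open>Multiplication of the lift by t_i - 1, the image of s_i under theta.\<close>
  let ?q = "\<lambda>x. (p \<otimes>\<^bsub>?F\<^esub> delta [i]) x + (- 1) * p x"
  have pi: "p \<otimes>\<^bsub>?F\<^esub> delta [i] \<in> carrier ?F" using p(1) i by (rule FA.m_closed)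
  have "?q \<in> carrier ?F" using pi p(1) by (rule comb_carrier)
  moreover have "ev ?q \<Phi> J = sact (delta (word_perm (is @ [i]))) \<Phi> J" for \<Phi> J
  proof -
    have "ev ?q \<Phi> J = ev (p \<otimes>\<^bsub>?F\<^esub> delta [i]) \<Phi> J + (- 1) * ev p \<Phi> J"
      by (rule ev_comb[OF carrier_finite[OF pi] carrier_finite[OF p(1)]])
    also have "ev (p \<otimes>\<^bsub>?F\<^esub> delta [i]) \<Phi> J = tact i (ev p \<Phi>) J"
      unfolding ev_mult[OF p(1) i] ev_delta by simp
    also have "\<dots> + (- 1) * ev p \<Phi> J = - ev p \<Phi> (st i ` J)" by (simp add: tact_def)
    also have "\<dots> = - of_int (sign (word_perm is)) * \<Phi> (word_perm is ` st i ` J)"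
      by (simp add: p(2) sact_delta)
    finally show ?thesis
      unfolding sact_delta word_perm_snoc by (simp add: sign_comp_st image_comp)
  qed
  ultimately show ?case by blast
qed

lemma lift_exists:
  assumes "u permutes {1..n}"
  shows "\<exists>p\<in>carrier (free_algebra {1..<n}). \<forall>\<Phi> J. ev p \<Phi> J = sact (delta u) \<Phi> J"
proof -
  obtain "is" where "set is \<subseteq> {1..<n}" "reduced u is" using reduced_exists[OF assms] by blast
  with word_lift_exists[of "is" n] show ?thesis by (auto simp: reduced_def)
qed

lemma perm_expansion_exists:
  assumes "u permutes {1..n}"
  shows "\<exists>g. \<forall>\<Phi> J. (\<Sum>v\<in>Av n. g v * wact (rw n v) \<Phi> J) = of_int (sign u) * \<Phi> (u ` J)"
proof -
  obtain p where p: "p \<in> carrier (free_algebra {1..<n})" "\<And>\<Phi> J. ev p \<Phi> J = sact (delta u) \<Phi> J"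
    using lift_exists[OF assms] by blast
  obtain g where g: "(\<lambda>x. p x + (- 1) * beta_comb n g x) \<in> TL_ideal n"
    using beta_comb_exists[OF p(1)] by blast
  have "ev p \<Phi> J + (- 1) * ev (beta_comb n g) \<Phi> J = 0" for \<Phi> J
    using ev_TL_ideal[OF g, of \<Phi> J] p(1) beta_comb_carrier[of n g]
    by (simp only: ev_comb[OF carrier_finite carrier_finite])
  thus ?thesis by (intro exI[of _ g]) (simp add: p(2) sact_delta ev_beta_comb)
qed

text \<open>A 321-avoiding permutation is increasing on the positions \<open>E\<close> that start an inversion and
  on the remaining positions, so it is the lexicographically least permutation mapping \<open>E\<close> to its
  image.\<close>

lemma sign_perms_independent:
  assumes zero: "\<And>\<Phi> J. (\<Sum>v\<in>Av n. g v * (of_int (sign v) * \<Phi> (v ` J))) = 0" and v0: "v0 \<in> Av n"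
  shows "g v0 = 0"
proof (rule ccontr)
  assume "g v0 \<noteq> 0"
  define S where "S = {v \<in> Av n. g v \<noteq> 0}"
  define R :: "(nat \<Rightarrow> nat) \<Rightarrow> (nat \<Rightarrow> nat) \<Rightarrow> bool" where "R u v \<longleftrightarrow> (\<exists>i. (\<forall>j<i. u j = v j) \<and> u i < v i)" for u v
  have "finite S" "S \<noteq> {}" using v0 \<open>g v0 \<noteq> 0\<close> by (auto simp: S_def)
  moreover have "asymp_on S R"
    by (rule asymp_onI) (auto simp: R_def, metis less_asym linorder_neqE_nat)
  moreover have "transp_on S R"
  proof (rule transp_onI)
    fix x y z assume "R x y" "R y z"
    then obtain i k where "\<forall>j<i. x j = y j" "x i < y i" "\<forall>j<k. y j = z j" "y k < z k" by (auto simp: R_def)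
    thus "R x z" unfolding R_def
      by (intro exI[of _ "min i k"]) (cases i k rule: linorder_cases; auto simp: min_def)
  qed
  \<comment> \<open>The lexicographically greatest \<open>v\<close> with nonzero coefficient. The
    test function below detects only permutations with the same image of \<open>E\<close>, and any
    such permutation other than \<open>v\<close> is lexicographically greater.\<close>
  ultimately obtain v where v: "v \<in> S" "\<And>u. u \<in> S \<Longrightarrow> u \<noteq> v \<Longrightarrow> \<not> R v u"
    using Finite_Set.bex_max_element[of S R] by blast
  have v': "v permutes {1..n}" "avoids_321 v" "g v \<noteq> 0"
    using v(1) by (auto simp: S_def perms_avoiding_321_iff)
  define E where "E = {i. \<exists>j>i. v j < v i}"
  have mono: "v i < v j" if "i < j" "i \<in> E \<longleftrightarrow> j \<in> E" for i j
  proof (rule ccontr)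
    assume "\<not> v i < v j"
    moreover have "v i \<noteq> v j" using v'(1) \<open>i < j\<close> by (metis permutes_inj injD less_irrefl)
    ultimately have "v j < v i" by simp
    hence "i \<in> E" using \<open>i < j\<close> by (auto simp: E_def)
    hence "j \<in> E" using that by simp
    then obtain k where "j < k" "v k < v j" by (auto simp: E_def)
    thus False using avoids_321D[OF v'(2) \<open>i < j\<close>] \<open>v j < v i\<close> by blast
  qed
  have other: "g u * (of_int (sign u) * (if u ` E = v ` E then 1 else 0)) = 0"
    if "u \<in> Av n" "u \<noteq> v" for u
  proof (rule ccontr)
    assume "\<not> ?thesis"
    hence u: "u \<in> S" "u ` E = v ` E" using that by (auto simp: S_def split: if_splits)
    have "u permutes {1..n}" using that by (simp add: perms_avoiding_321_iff)
    from increasing_lex_least[OF this v'(1) u(2) mono that(2)] have "R v u"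
      by (auto simp: R_def) metis
    thus False using v(2) u(1) that(2) by blast
  qed
  have "(\<Sum>u\<in>Av n. g u * (of_int (sign u) * (if u ` E = v ` E then 1 else 0)))
      = (\<Sum>u\<in>{v}. g u * (of_int (sign u) * (if u ` E = v ` E then 1 else 0)))"
    by (rule sum.mono_neutral_right) (use other v(1) in \<open>auto simp: S_def\<close>)
  hence "g v * of_int (sign v) = 0"
    using zero[of "\<lambda>J. if J = v ` E then 1 else 0" E] by simp
  thus False using v'(3) by (simp add: sign_def split: if_splits)
qed

lemma sum_fun_apply: "(\<Sum>v\<in>A. F v) x = (\<Sum>v\<in>A. (F v x :: complex))"
  by (induction A rule: infinite_finite_induct) simp_all

text \<open>The signed permutations of the 321-avoiding \<open>v\<close> are independent and lie in the span of
  equally many operators \<open>wact (rw n v)\<close>, which are therefore independent as well.\<close>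

lemma basis_independent:
  assumes zero: "\<And>\<Phi> J. (\<Sum>v\<in>Av n. g v * wact (rw n v) \<Phi> J) = 0" and v0: "v0 \<in> Av n"
  shows "g v0 = 0"
proof -
  \<comment> \<open>Operators are read as functions of the pair of a row vector and a set, so linear
    algebra can be done pointwise.\<close>
  interpret fv: vector_space "\<lambda>(a::complex) (h :: (nat set \<Rightarrow> complex) \<times> nat set \<Rightarrow> complex) x. a * h x"
    by unfold_locales (simp_all add: fun_eq_iff algebra_simps)
  define E :: "(nat \<Rightarrow> nat) \<Rightarrow> (nat set \<Rightarrow> complex) \<times> nat set \<Rightarrow> complex"
    where "E v = (\<lambda>(\<Phi>, J). wact (rw n v) \<Phi> J)" for v
  define S :: "(nat \<Rightarrow> nat) \<Rightarrow> (nat set \<Rightarrow> complex) \<times> nat set \<Rightarrow> complex"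
    where "S u = (\<lambda>(\<Phi>, J). of_int (sign u) * \<Phi> (u ` J))" for u
  have S_indep: "h u = 0" if "\<And>x. (\<Sum>v\<in>Av n. h v * S v x) = 0" "u \<in> Av n" for h u
    using sign_perms_independent[of h n u] that(1)[of "(_, _)"] that(2) by (simp add: S_def)
  have inj: "inj_on S (Av n)"
  proof (rule inj_onI, rule ccontr)
    fix u v assume uv: "u \<in> Av n" "v \<in> Av n" "S u = S v" "u \<noteq> v"
    define h :: "(nat \<Rightarrow> nat) \<Rightarrow> complex" where "h = (\<lambda>x. if x = u then 1 else if x = v then - 1 else 0)"
    have "(\<Sum>w\<in>Av n. h w * S w x) = (\<Sum>w\<in>{u, v}. h w * S w x)" for x
      by (rule sum.mono_neutral_right) (use uv in \<open>auto simp: h_def\<close>)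
    hence "(\<Sum>w\<in>Av n. h w * S w x) = 0" for x using uv(3,4) by (simp add: h_def)
    from S_indep[OF this uv(1)] show False by (simp add: h_def)
  qed
  have indep: "fv.independent (S ` Av n)"
  proof (rule fv.independent_if_scalars_zero)
    fix h x assume *: "(\<Sum>y\<in>S ` Av n. (\<lambda>z. h y * y z)) = 0" "x \<in> S ` Av n"
    then obtain v where v: "v \<in> Av n" "x = S v" by blast
    have "(\<Sum>w\<in>Av n. h (S w) * S w z) = 0" for z
      using fun_cong[OF *(1), of z] by (simp add: sum_fun_apply sum.reindex[OF inj])
    from S_indep[OF this v(1)] show "h x = 0" using v(2) by simp
  qed simp
  have span: "S ` Av n \<subseteq> fv.span (E ` Av n)"
  proof
    fix x assume "x \<in> S ` Av n"
    then obtain u where u: "u permutes {1..n}" "x = S u" by (auto simp: perms_avoiding_321_iff)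
    obtain h where h: "\<And>\<Phi> J. (\<Sum>v\<in>Av n. h v * wact (rw n v) \<Phi> J) = of_int (sign u) * \<Phi> (u ` J)"
      using perm_expansion_exists[OF u(1)] by blast
    have "x = (\<Sum>v\<in>Av n. (\<lambda>z. h v * E v z))"
      by (rule ext) (auto simp: sum_fun_apply u(2) S_def E_def h)
    also have "\<dots> \<in> fv.span (E ` Av n)"
      by (intro fv.span_sum fv.span_scale fv.span_base imageI)
    finally show "x \<in> fv.span (E ` Av n)" .
  qed
  \<comment> \<open>Exchange: a finite spanning set has at least as many elements as the independent
    family \<open>S\<close>. Hence \<open>E\<close> is injective and none of its members is
    redundant.\<close>
  have card_le: "card (Av n) \<le> card T" if "finite T" "S ` Av n \<subseteq> fv.span T" for T
    using fv.independent_span_bound[OF that(1) indep that(2)] card_image[OF inj] by simp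
  have "card (E ` Av n) = card (Av n)"
    using card_le[OF _ span] card_image_le[of "Av n" E] by simp
  hence injE: "inj_on E (Av n)" by (intro eq_card_imp_inj_on) simp_all
  have indepE: "fv.independent (E ` Av n)"
  proof
    assume "fv.dependent (E ` Av n)"
    then obtain a where a: "a \<in> E ` Av n" "a \<in> fv.span (E ` Av n - {a})" by (auto simp: fv.dependent_def)
    have "fv.span (insert a (E ` Av n - {a})) = fv.span (E ` Av n - {a})"
      using a(2) by (rule fv.span_redundant)
    hence "fv.span (E ` Av n) = fv.span (E ` Av n - {a})" using a(1) by (simp add: insert_absorb)
    hence "card (Av n) \<le> card (E ` Av n - {a})" using span by (intro card_le) simp_all
    also have "\<dots> < card (E ` Av n)" using a(1) by (intro card_Diff1_less) simp_all
    also have "\<dots> \<le> card (Av n)" by (rule card_image_le) simp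
    finally show False by simp
  qed
  have "(\<Sum>y\<in>E ` Av n. (\<lambda>z. g (the_inv_into (Av n) E y) * y z)) = 0"
  proof
    fix x
    have "(\<Sum>y\<in>E ` Av n. g (the_inv_into (Av n) E y) * y x) = (\<Sum>v\<in>Av n. g (the_inv_into (Av n) E (E v)) * E v x)"
      by (simp add: sum.reindex[OF injE])
    also have "\<dots> = (\<Sum>v\<in>Av n. g v * E v x)"
      by (intro sum.cong refl) (simp add: the_inv_into_f_f[OF injE])
    also have "\<dots> = 0" by (cases x) (simp add: E_def zero)
    finally show "(\<Sum>y\<in>E ` Av n. (\<lambda>z. g (the_inv_into (Av n) E y) * y z)) x = 0 x"
      by (simp add: sum_fun_apply)
  qed
  from fv.independentD[OF indepE _ _ this, of "E v0"] show ?thesis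
    using v0 by (simp add: the_inv_into_f_f[OF injE])
qed

text \<open>Faithfulness: modulo the ideal \<open>p\<close> is a combination of the beta(v), and
  these act independently, so all coefficients vanish.\<close>

lemma ev_kernel:
  assumes p: "p \<in> carrier (free_algebra {1..<n})" and zero: "\<And>\<Phi> J. ev p \<Phi> J = 0"
  shows "p \<in> TL_ideal n"
proof -
  obtain g where g: "(\<lambda>x. p x + (- 1) * beta_comb n g x) \<in> TL_ideal n"
    using beta_comb_exists[OF p] by blast
  have "ev p \<Phi> J + (- 1) * ev (beta_comb n g) \<Phi> J = 0" for \<Phi> J
    using ev_TL_ideal[OF g, of \<Phi> J] p beta_comb_carrier[of n g]
    by (simp only: ev_comb[OF carrier_finite carrier_finite])
  hence "(\<Sum>v\<in>Av n. g v * wact (rw n v) \<Phi> J) = 0" for \<Phi> J by (simp add: zero ev_beta_comb)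
  hence "g v = 0" if "v \<in> Av n" for v using basis_independent that by blast
  hence "beta_comb n g x = 0" for x by (simp add: beta_comb_def)
  thus ?thesis using g by simp
qed

section \<open>The quotient algebra through its action\<close>

definition cls :: "nat \<Rightarrow> (nat list \<Rightarrow> complex) \<Rightarrow> (nat list \<Rightarrow> complex) set" where
  "cls n p = TL_ideal n +>\<^bsub>free_algebra {1..<n}\<^esub> p"

text \<open>The ideal is exactly the kernel of the action. Identities between cosets can therefore
  be verified on row vectors.\<close>

lemma cls_eq:
  assumes "p \<in> carrier (free_algebra {1..<n})"
  shows "cls n p = {q \<in> carrier (free_algebra {1..<n}). \<forall>\<Phi> J. ev q \<Phi> J = ev p \<Phi> J}"
proof (intro Set.set_eqI iffI)
  fix q assume "q \<in> cls n p"
  then obtain r where r: "r \<in> TL_ideal n" "q = (\<lambda>x. r x + 1 * p x)"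
    by (auto simp: cls_def a_r_coset_def' monoid_algebra_simps(5))
  note rc = TL_ideal_carrier[OF r(1)]
  have "q \<in> carrier (free_algebra {1..<n})" unfolding r(2) using rc assms by (rule comb_carrier)
  moreover have "ev q \<Phi> J = ev p \<Phi> J" for \<Phi> J
    unfolding r(2) ev_comb[OF carrier_finite[OF rc] carrier_finite[OF assms]] by (simp add: ev_TL_ideal[OF r(1)])
  ultimately show "q \<in> {q \<in> carrier (free_algebra {1..<n}). \<forall>\<Phi> J. ev q \<Phi> J = ev p \<Phi> J}" by simp
next
  fix q assume "q \<in> {q \<in> carrier (free_algebra {1..<n}). \<forall>\<Phi> J. ev q \<Phi> J = ev p \<Phi> J}"
  hence q: "q \<in> carrier (free_algebra {1..<n})" "\<And>\<Phi> J. ev q \<Phi> J = ev p \<Phi> J" by auto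
  have "(\<lambda>x. q x + (- 1) * p x) \<in> TL_ideal n"
    by (rule ev_kernel, rule comb_carrier[OF q(1) assms])
      (simp only: ev_comb[OF carrier_finite[OF q(1)] carrier_finite[OF assms]] q(2), simp)
  moreover have "q = (\<lambda>x. q x + (- 1) * p x) \<oplus>\<^bsub>free_algebra {1..<n}\<^esub> p"
    by (simp add: monoid_algebra_simps(5))
  ultimately show "q \<in> cls n p" unfolding cls_def a_r_coset_def' by blast
qed

lemma mem_cls: "p \<in> carrier (free_algebra {1..<n}) \<Longrightarrow> p \<in> cls n p"
  by (simp add: cls_eq)

lemma TL_carrier: "carrier (TL n) = cls n ` carrier (free_algebra {1..<n})"
  by (auto simp: TL_def quotient_algebra_def ring.defs FactRing_def A_RCOSETS_def' cls_def)

lemma TL_mult: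
  assumes "p \<in> carrier (free_algebra {1..<n})" "q \<in> carrier (free_algebra {1..<n})"
  shows "cls n p \<otimes>\<^bsub>TL n\<^esub> cls n q = cls n (p \<otimes>\<^bsub>free_algebra {1..<n}\<^esub> q)"
  using ideal.rcoset_mult_add[OF ideal_TL_ideal assms]
  by (simp add: TL_def quotient_algebra_def ring.defs FactRing_def cls_def)

lemma TL_add:
  assumes "p \<in> carrier (free_algebra {1..<n})" "q \<in> carrier (free_algebra {1..<n})"
  shows "cls n p \<oplus>\<^bsub>TL n\<^esub> cls n q = cls n (\<lambda>x. p x + q x)"
  using abelian_subgroup.a_rcos_sum[OF abelian_subgroupI3[OF TL_additive_subgroup FA.abelian_group_axioms] assms]
  by (simp add: TL_def quotient_algebra_def ring.defs FactRing_def cls_def monoid_algebra_simps(5))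

lemma TL_one: "\<one>\<^bsub>TL n\<^esub> = cls n (delta [])"
  by (simp add: TL_def quotient_algebra_def ring.defs FactRing_def cls_def monoid_algebra_simps(3))

lemma zero_carrier: "(\<lambda>x. 0) \<in> carrier (monoid_algebra M)"
  by (simp add: monoid_algebra_simps(1))

lemma scale_carrier: "p \<in> carrier (monoid_algebra M) \<Longrightarrow> (\<lambda>x. c * p x) \<in> carrier (monoid_algebra M)"
  using comb_carrier[OF zero_carrier, of p M c] by simp

lemma ev_scale: "finite {x. p x \<noteq> 0} \<Longrightarrow> ev (\<lambda>x. c * p x) \<Phi> J = c * ev p \<Phi> J"
  using ev_comb[of "\<lambda>x. 0" p c \<Phi> J] by (simp add: ev_def)

lemma TL_zero: "\<zero>\<^bsub>TL n\<^esub> = cls n (\<lambda>x. 0)"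
proof -
  have "\<zero>\<^bsub>TL n\<^esub> = TL_ideal n"
    by (simp add: TL_def quotient_algebra_def ring.defs FactRing_def)
  also have "\<dots> = {q \<in> carrier (free_algebra {1..<n}). \<forall>\<Phi> J. ev q \<Phi> J = 0}"
    by (intro Set.set_eqI iffI CollectI conjI allI TL_ideal_carrier ev_TL_ideal; (elim CollectE conjE)?)
      (assumption+, rule ev_kernel, assumption, blast)
  also have "\<dots> = cls n (\<lambda>x. 0)"
    unfolding cls_eq[OF zero_carrier] by (simp add: ev_def)
  finally show ?thesis .
qed

lemma TL_smult:
  assumes "p \<in> carrier (free_algebra {1..<n})"
  shows "c \<odot>\<^bsub>TL n\<^esub> cls n p = cls n (\<lambda>x. c * p x)"
proof -
  have "c \<odot>\<^bsub>TL n\<^esub> cls n p = (\<Union>q\<in>cls n p. cls n (\<lambda>x. c * q x))"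
    by (simp add: TL_def quotient_algebra_def ring.defs module.defs cls_def monoid_algebra_simps(6))
  \<comment> \<open>All representatives give the same coset, so the union in the scalar action is a
    union of equal sets.\<close>
  also have "\<dots> = (\<Union>q\<in>cls n p. cls n (\<lambda>x. c * p x))"
  proof (rule SUP_cong[OF refl])
    fix q assume that: "q \<in> cls n p"
    have q: "q \<in> carrier (free_algebra {1..<n})" "\<And>\<Phi> J. ev q \<Phi> J = ev p \<Phi> J"
      using that by (simp_all add: cls_eq[OF assms])
    show "cls n (\<lambda>x. c * q x) = cls n (\<lambda>x. c * p x)" unfolding cls_eq[OF scale_carrier[OF q(1)]] cls_eq[OF scale_carrier[OF assms]]
      by (simp add: ev_scale[OF carrier_finite[OF q(1)]] ev_scale[OF carrier_finite[OF assms]] q(2))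
  qed
  also have "\<dots> = cls n (\<lambda>x. c * p x)" using mem_cls[OF assms] by (subst UN_constant) auto
  finally show ?thesis .
qed

lemma add_carrier:
  "p \<in> carrier (monoid_algebra M) \<Longrightarrow> q \<in> carrier (monoid_algebra M) \<Longrightarrow> (\<lambda>x. p x + q x) \<in> carrier (monoid_algebra M)"
  using comb_carrier[of p M q 1] by simp

lemma abelian_group_TL: "abelian_group (TL n)"
proof (rule abelian_groupI)
  fix X assume "X \<in> carrier (TL n)"
  then obtain p where p: "p \<in> carrier (free_algebra {1..<n})" "X = cls n p" by (auto simp: TL_carrier)
  show "\<exists>Y\<in>carrier (TL n). Y \<oplus>\<^bsub>TL n\<^esub> X = \<zero>\<^bsub>TL n\<^esub>"
    by (rule bexI[of _ "cls n (\<lambda>x. (- 1) * p x)"])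
      (use p scale_carrier[OF p(1), of "- 1"] in \<open>simp_all add: TL_add TL_zero TL_carrier\<close>)
  show "\<zero>\<^bsub>TL n\<^esub> \<oplus>\<^bsub>TL n\<^esub> X = X" unfolding TL_zero p(2) TL_add[OF zero_carrier p(1)] by simp
qed (auto simp: TL_carrier TL_add TL_zero add_carrier zero_carrier algebra_simps)

interpretation TL: abelian_group "TL n" for n by (rule abelian_group_TL)

lemma TL_minus:
  assumes "p \<in> carrier (free_algebra {1..<n})" "q \<in> carrier (free_algebra {1..<n})"
  shows "cls n p \<ominus>\<^bsub>TL n\<^esub> cls n q = cls n (\<lambda>x. p x + (- 1) * q x)"
proof -
  have "\<ominus>\<^bsub>TL n\<^esub> cls n q = cls n (\<lambda>x. (- 1) * q x)"
    by (rule TL.minus_equality)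
      (use assms scale_carrier[OF assms(2), of "- 1"] in \<open>simp_all add: TL_add TL_zero TL_carrier\<close>)
  thus ?thesis unfolding a_minus_def using TL_add[OF assms(1) scale_carrier[OF assms(2), of "- 1"]] by simp
qed

lemma TL_finsum:
  assumes "finite A" "\<And>v. v \<in> A \<Longrightarrow> q v \<in> carrier (free_algebra {1..<n})"
  shows "finsum (TL n) (\<lambda>v. cls n (\<lambda>x. c v * q v x)) A = cls n (\<lambda>x. \<Sum>v\<in>A. c v * q v x)"
  using assms
proof (induction A rule: finite_induct)
  case empty
  show ?case by (simp add: TL_zero)
next
  case (insert v A)
  have "finsum (TL n) (\<lambda>v. cls n (\<lambda>x. c v * q v x)) (insert v A) =
    cls n (\<lambda>x. c v * q v x) \<oplus>\<^bsub>TL n\<^esub> finsum (TL n) (\<lambda>v. cls n (\<lambda>x. c v * q v x)) A"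
    using insert by (intro TL.finsum_insert) (auto simp: TL_carrier intro!: imageI scale_carrier)
  also have "\<dots> = cls n (\<lambda>x. c v * q v x + (\<Sum>v\<in>A. c v * q v x))"
    using insert by (simp add: TL_add scale_carrier sum_carrier)
  finally show ?case using insert.hyps by simp
qed

lemma TL_gen_eq: "TL_gen n i = cls n (delta [i])"
  by (simp add: TL_gen_def cls_def)

lemma word_carrier: "set is \<subseteq> {1..<n} \<Longrightarrow> delta is \<in> carrier (free_algebra {1..<n})"
  by (intro delta_carrier) (auto simp: in_lists_conv_set)

lemma TL_beta_eq:
  assumes "v \<in> Av n" shows "TL_beta n v = cls n (delta (rw n v))"
proof -
  have "foldr (monoid.mult (TL n)) (map (TL_gen n) is) \<one>\<^bsub>TL n\<^esub> = cls n (delta is)" if "set is \<subseteq> {1..<n}" for "is"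
    using that
  proof (induction "is")
    case (Cons i "is")
    have "delta [i] \<in> carrier (free_algebra {1..<n})" "delta is \<in> carrier (free_algebra {1..<n})"
      by (intro word_carrier; use Cons.prems in simp)+
    thus ?case using Cons by (simp add: TL_gen_eq TL_mult delta_append)
  qed (simp add: TL_one)
  thus ?thesis using assms rw(1)[of v n] unfolding TL_beta_def rw_def by (simp add: perms_avoiding_321_iff)
qed

lemma TL_beta_finsum:
  "finsum (TL n) (\<lambda>v. g v \<odot>\<^bsub>TL n\<^esub> TL_beta n v) (Av n) = cls n (beta_comb n g)"
proof -
  have c: "delta (rw n v) \<in> carrier (free_algebra {1..<n})" if "v \<in> Av n" for v
    using that rw(1)[of v n] by (intro word_carrier) (simp add: perms_avoiding_321_iff)
  have "finsum (TL n) (\<lambda>v. g v \<odot>\<^bsub>TL n\<^esub> TL_beta n v) (Av n)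
      = finsum (TL n) (\<lambda>v. cls n (\<lambda>x. g v * delta (rw n v) x)) (Av n)"
    by (rule TL.finsum_cong') (use c in \<open>auto simp: TL_beta_eq TL_smult TL_carrier intro!: imageI scale_carrier\<close>)
  also have "\<dots> = cls n (beta_comb n g)"
    unfolding beta_comb_def[abs_def] by (rule TL_finsum[OF finite_Av c])
  finally show ?thesis .
qed

section \<open>The homomorphism theta\<close>

lemma sym_group_simps:
  "carrier (sym_group n) = {p. p permutes {1..n}}" "x \<otimes>\<^bsub>sym_group n\<^esub> y = x \<circ> y" "\<one>\<^bsub>sym_group n\<^esub> = id"
  by (simp_all add: sym_group_def)

lemma monoid_sym_group: "Group.monoid (sym_group n)"
  using sym_group_is_group by (rule group.is_monoid)

text \<open>The set of all lifts of a signed action: nonempty by \<open>theta_rep\<close> and then a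
  single coset by \<open>cls_eq\<close>. Multiplicativity follows from comparing actions.\<close>

definition theta :: "nat \<Rightarrow> ((nat \<Rightarrow> nat) \<Rightarrow> complex) \<Rightarrow> (nat list \<Rightarrow> complex) set" where
  "theta n q = {p \<in> carrier (free_algebra {1..<n}). \<forall>\<Phi> J. ev p \<Phi> J = sact q \<Phi> J}"

lemma theta_eq_cls:
  assumes "p \<in> carrier (free_algebra {1..<n})" "\<And>\<Phi> J. ev p \<Phi> J = sact q \<Phi> J"
  shows "theta n q = cls n p"
  using assms by (simp add: theta_def cls_eq)

lemma sact_comb:
  assumes "p \<in> carrier (monoid_algebra M)" "q \<in> carrier (monoid_algebra M)"
  shows "sact (\<lambda>x. p x + c * q x) \<Phi> J = sact p \<Phi> J + c * sact q \<Phi> J"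
  unfolding sact_def by (rule lin_comb[OF carrier_finite[OF assms(1)] carrier_finite[OF assms(2)]])

lemma sact_mult:
  assumes "p \<in> carrier (sym_group_algebra n)" "q \<in> carrier (sym_group_algebra n)"
  shows "sact (p \<otimes>\<^bsub>sym_group_algebra n\<^esub> q) \<Phi> = sact q (sact p \<Phi>)"
proof
  fix J
  have perm: "permutation u" if "p u \<noteq> 0 \<or> q u \<noteq> 0" for u
  proof -
    have "u permutes {1..n}" using assms that by (auto simp: monoid_algebra_simps(1) sym_group_simps)
    thus ?thesis using permutation_permutes by auto
  qed
  have "sact (p \<otimes>\<^bsub>sym_group_algebra n\<^esub> q) \<Phi> J
      = lin (\<lambda>u. lin (\<lambda>t. of_int (sign (u \<circ> t)) * \<Phi> ((u \<circ> t) ` J)) q) p"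
    unfolding sact_def by (subst lin_mult) (use assms in \<open>simp_all add: carrier_finite sym_group_simps\<close>)
  also have "\<dots> = lin (\<lambda>u. lin (\<lambda>t. of_int (sign t) * (of_int (sign u) * \<Phi> (u ` t ` J))) q) p"
    by (intro lin_cong) (simp add: sign_compose perm image_comp mult.commute mult.left_commute)
  also have "\<dots> = lin (\<lambda>t. lin (\<lambda>u. of_int (sign t) * (of_int (sign u) * \<Phi> (u ` t ` J))) p) q"
    by (rule lin_swap)
  also have "\<dots> = sact q (sact p \<Phi>) J"
    unfolding sact_def by (intro lin_cong) (simp add: lin_def sum_distrib_left mult.left_commute)
  finally show "sact (p \<otimes>\<^bsub>sym_group_algebra n\<^esub> q) \<Phi> J = sact q (sact p \<Phi>) J" .
qed

lemma theta_rep: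
  assumes "q \<in> carrier (sym_group_algebra n)"
  shows "\<exists>p\<in>carrier (free_algebra {1..<n}). \<forall>\<Phi> J. ev p \<Phi> J = sact q \<Phi> J"
proof -
  let ?S = "{u. q u \<noteq> 0}"
  have fin: "finite ?S" and S: "\<And>u. u \<in> ?S \<Longrightarrow> u permutes {1..n}"
    using assms by (auto simp: monoid_algebra_simps(1) sym_group_simps)
  obtain P where P: "\<And>u. u \<in> ?S \<Longrightarrow> P u \<in> carrier (free_algebra {1..<n})"
    "\<And>u \<Phi> J. u \<in> ?S \<Longrightarrow> ev (P u) \<Phi> J = sact (delta u) \<Phi> J"
    using lift_exists[OF S] by metis
  let ?p = "\<lambda>x. \<Sum>u\<in>?S. q u * P u x"
  have "?p \<in> carrier (free_algebra {1..<n})" using fin P(1) by (rule sum_carrier)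
  moreover have "ev ?p \<Phi> J = sact q \<Phi> J" for \<Phi> J
  proof -
    have "ev ?p \<Phi> J = (\<Sum>u\<in>?S. q u * ev (P u) \<Phi> J)"
      unfolding ev_def by (rule lin_sum(1)[OF fin]) (use P(1) carrier_finite in blast)
    also have "\<dots> = (\<Sum>u\<in>?S. q u * (of_int (sign u) * \<Phi> (u ` J)))"
      by (intro sum.cong refl) (simp add: P(2) sact_delta)
    finally show ?thesis by (simp add: sact_def lin_def)
  qed
  ultimately show ?thesis by blast
qed

lemma theta_hom: "theta n \<in> algebra_hom (sym_group_algebra n) (TL n)"
proof -
  let ?G = "sym_group_algebra n" and ?F = "free_algebra {1..<n}"
  have closed: "theta n q \<in> carrier (TL n)" if q: "q \<in> carrier ?G" for q
    using theta_rep[OF q] theta_eq_cls by (auto simp: TL_carrier)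
  moreover have "theta n (q \<otimes>\<^bsub>?G\<^esub> r) = theta n q \<otimes>\<^bsub>TL n\<^esub> theta n r"
    "theta n (q \<oplus>\<^bsub>?G\<^esub> r) = theta n q \<oplus>\<^bsub>TL n\<^esub> theta n r" if qr: "q \<in> carrier ?G" "r \<in> carrier ?G" for q r
  proof -
    obtain p where p: "p \<in> carrier ?F" "\<And>\<Phi> J. ev p \<Phi> J = sact q \<Phi> J" using theta_rep[OF qr(1)] by blast
    obtain s where s: "s \<in> carrier ?F" "\<And>\<Phi> J. ev s \<Phi> J = sact r \<Phi> J" using theta_rep[OF qr(2)] by blast
    have e: "ev p \<Phi> = sact q \<Phi>" "ev s \<Phi> = sact r \<Phi>" for \<Phi> using p(2) s(2) by auto
    have "theta n (q \<otimes>\<^bsub>?G\<^esub> r) = cls n (p \<otimes>\<^bsub>?F\<^esub> s)"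
      by (rule theta_eq_cls) (use p s in \<open>simp_all add: FA.m_closed ev_mult sact_mult[OF qr] e\<close>)
    thus "theta n (q \<otimes>\<^bsub>?G\<^esub> r) = theta n q \<otimes>\<^bsub>TL n\<^esub> theta n r"
      using theta_eq_cls[OF p] theta_eq_cls[OF s] TL_mult[OF p(1) s(1)] by simp
    have "theta n (\<lambda>x. q x + 1 * r x) = cls n (\<lambda>x. p x + 1 * s x)"
      by (rule theta_eq_cls[OF comb_carrier[OF p(1) s(1)]])
        (simp only: ev_comb[OF carrier_finite[OF p(1)] carrier_finite[OF s(1)]] sact_comb[OF qr] e)
    thus "theta n (q \<oplus>\<^bsub>?G\<^esub> r) = theta n q \<oplus>\<^bsub>TL n\<^esub> theta n r"
      using theta_eq_cls[OF p] theta_eq_cls[OF s] TL_add[OF p(1) s(1)] by (simp add: monoid_algebra_simps(5))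
  qed
  moreover have "theta n \<one>\<^bsub>?G\<^esub> = \<one>\<^bsub>TL n\<^esub>"
    unfolding TL_one monoid_algebra_simps(3) sym_group_simps
    by (rule theta_eq_cls) (simp_all add: word_carrier ev_delta sact_delta)
  moreover have "theta n (c \<odot>\<^bsub>?G\<^esub> q) = c \<odot>\<^bsub>TL n\<^esub> theta n q" if q: "q \<in> carrier ?G" for c q
  proof -
    obtain p where p: "p \<in> carrier ?F" "\<And>\<Phi> J. ev p \<Phi> J = sact q \<Phi> J" using theta_rep[OF q] by blast
    have "theta n (\<lambda>x. c * q x) = cls n (\<lambda>x. c * p x)"
      by (rule theta_eq_cls[OF scale_carrier[OF p(1)]])
        (use sact_comb[OF zero_carrier q, of c] in \<open>simp add: ev_scale[OF carrier_finite[OF p(1)]] p(2) sact_def\<close>)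
    thus ?thesis using theta_eq_cls[OF p] TL_smult[OF p(1)] by (simp add: monoid_algebra_simps(6))
  qed
  ultimately show ?thesis unfolding algebra_hom_def ring_hom_def by auto
qed

lemma st_mem: "i \<in> {1..<n} \<Longrightarrow> delta (st i) \<in> carrier (sym_group_algebra n)"
  by (intro delta_carrier) (simp add: sym_group_simps st_permutes)

lemma theta_gen:
  assumes "i \<in> {1..<n}"
  shows "theta n (delta (st i)) = TL_gen n i \<ominus>\<^bsub>TL n\<^esub> \<one>\<^bsub>TL n\<^esub>"
proof -
  have c: "delta [i] \<in> carrier (free_algebra {1..<n})" "delta [] \<in> carrier (free_algebra {1..<n})"
    using assms by (auto intro!: word_carrier)
  show ?thesis unfolding TL_gen_eq TL_one TL_minus[OF c]
    by (rule theta_eq_cls[OF comb_carrier[OF c]])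
      (simp only: ev_comb[OF finite_delta finite_delta] ev_delta sact_delta, simp add: tact_def)
qed

text \<open>The values on generators determine those on words, hence on permutations, hence by
  linearity on everything; the last passage is an induction over a finite set containing the
  support.\<close>

lemma theta_unique:
  assumes h: "h \<in> algebra_hom (sym_group_algebra n) (TL n)"
    and gen: "\<And>i. i \<in> {1..<n} \<Longrightarrow> h (delta (st i)) = TL_gen n i \<ominus>\<^bsub>TL n\<^esub> \<one>\<^bsub>TL n\<^esub>"
    and q: "q \<in> carrier (sym_group_algebra n)"
  shows "h q = theta n q"
proof -
  let ?G = "sym_group_algebra n"
  have hom: "k (x \<otimes>\<^bsub>?G\<^esub> y) = k x \<otimes>\<^bsub>TL n\<^esub> k y" "k (\<lambda>z. x z + y z) = k x \<oplus>\<^bsub>TL n\<^esub> k y"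
    "k (delta id) = \<one>\<^bsub>TL n\<^esub>" "k (\<lambda>z. c * x z) = c \<odot>\<^bsub>TL n\<^esub> k x"
    if "k \<in> algebra_hom ?G (TL n)" "x \<in> carrier ?G" "y \<in> carrier ?G" for k x y c
    using that by (auto simp: algebra_hom_def ring_hom_def monoid_algebra_simps(3,5,6) sym_group_simps)
  have id: "delta id \<in> carrier ?G" by (intro delta_carrier) (simp add: sym_group_simps permutes_id)
  have word: "h (delta (word_perm is)) = theta n (delta (word_perm is))" if "set is \<subseteq> {1..<n}" for "is"
    using that
  proof (induction "is")
    case Nil
    show ?case unfolding word_perm_simps by (simp only: hom(3)[OF h id id] hom(3)[OF theta_hom id id])
  next
    case (Cons i "is")
    have i: "i \<in> {1..<n}" and w: "delta (word_perm is) \<in> carrier ?G"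
      using Cons.prems word_perm_permutes[of "is" 1 n] by (auto intro!: delta_carrier simp: sym_group_simps)
    have eq: "delta (word_perm (i # is)) = delta (st i) \<otimes>\<^bsub>?G\<^esub> delta (word_perm is)"
      unfolding mult_delta sym_group_simps word_perm_simps ..
    show ?case unfolding eq
      using hom(1)[OF h st_mem[OF i] w] hom(1)[OF theta_hom st_mem[OF i] w] gen[OF i] theta_gen[OF i] Cons
      by simp
  qed
  have perm: "h (delta u) = theta n (delta u)" if "u permutes {1..n}" for u
    using reduced_exists[OF that] word by (auto simp: reduced_def)
  have "\<forall>q\<in>carrier ?G. {u. q u \<noteq> 0} \<subseteq> A \<longrightarrow> h q = theta n q" if "finite A" for A
    using that
  proof (induction A rule: finite_induct)
    case empty
    \<comment> \<open>\<open>algebra_hom\<close> says nothing about zero explicitly, so zero is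
      written as a scalar multiple of the identity.\<close>
    have zero: "h (\<lambda>x. 0 * delta id x) = theta n (\<lambda>x. 0 * delta id x)"
      by (simp only: hom(4)[OF h id id] hom(4)[OF theta_hom id id] hom(3)[OF h id id] hom(3)[OF theta_hom id id])
    show ?case
    proof (intro ballI impI)
      fix q :: "(nat \<Rightarrow> nat) \<Rightarrow> complex"
      assume "{u. q u \<noteq> 0} \<subseteq> {}"
      hence "q = (\<lambda>x. 0 * delta id x)" by (simp add: fun_eq_iff)
      thus "h q = theta n q" using zero by (simp only:)
    qed
  next
    case (insert u A)
    show ?case
    proof (intro ballI impI)
      fix q assume q: "q \<in> carrier ?G" "{x. q x \<noteq> 0} \<subseteq> insert u A"
      show "h q = theta n q"
      proof (cases "q u = 0")
        case True
        thus ?thesis using q insert.IH by auto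
      next
        case False
        hence u: "u permutes {1..n}" using q(1) by (auto simp: monoid_algebra_simps(1) sym_group_simps)
        hence du: "delta u \<in> carrier ?G" by (intro delta_carrier) (simp add: sym_group_simps)
        define r where "r = (\<lambda>x. q x + (- q u) * delta u x)"
        have r: "r \<in> carrier ?G" unfolding r_def by (rule comb_carrier[OF q(1) du])
        have "r u = 0" by (simp add: r_def) (simp add: delta_def)
        moreover have "x = u \<or> x \<in> A" if "r x \<noteq> 0" for x
        proof (cases "q x = 0")
          case True
          hence "delta u x \<noteq> 0" using that by (auto simp: r_def)
          thus ?thesis by (simp only: delta_neq_0) simp
        qed (use q(2) in auto)
        ultimately have "{x. r x \<noteq> 0} \<subseteq> A" by auto
        hence IH: "h r = theta n r" using insert.IH r by blast
        have eq: "q = (\<lambda>x. r x + q u * delta u x)" by (simp add: r_def)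
        have "k q = k r \<oplus>\<^bsub>TL n\<^esub> q u \<odot>\<^bsub>TL n\<^esub> k (delta u)" if "k \<in> algebra_hom ?G (TL n)" for k
          by (subst eq) (simp only: hom(2)[OF that r scale_carrier[OF du]] hom(4)[OF that du du])
        from this[OF h] this[OF theta_hom] show ?thesis using IH perm[OF u] by simp
      qed
    qed
  qed
  moreover have "finite {u. q u \<noteq> 0}" using q by (rule carrier_finite)
  ultimately show ?thesis using q by blast
qed

lemma TL_theta_eq:
  assumes q: "q \<in> carrier (sym_group_algebra n)" shows "TL_theta n q = theta n q"
proof -
  let ?G = "sym_group_algebra n"
  have "TL_theta n = restrict (theta n) (carrier ?G)"
    unfolding TL_theta_def
  proof (rule the_equality, intro conjI ballI)
    show "restrict (theta n) (carrier ?G) \<in> algebra_hom ?G (TL n)"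
    proof -
      have G: "ring ?G" using monoid_sym_group by (rule ring_monoid_algebra)
      have "c \<odot>\<^bsub>?G\<^esub> x \<in> carrier ?G" if "x \<in> carrier ?G" for c x
        using scale_carrier[OF that] by (simp add: monoid_algebra_simps(6))
      thus ?thesis using theta_hom[of n] ring.ring_simprules(1,5,6)[OF G]
        by (auto simp: algebra_hom_def ring_hom_def)
    qed
    fix i assume "i \<in> {1..<n}"
    thus "restrict (theta n) (carrier ?G) (delta (st i)) = TL_gen n i \<ominus>\<^bsub>TL n\<^esub> \<one>\<^bsub>TL n\<^esub>"
      by (simp add: st_mem theta_gen)
  next
    fix h assume h: "h \<in> extensional (carrier ?G) \<and> h \<in> algebra_hom ?G (TL n) \<and>
       (\<forall>i\<in>{1..<n}. h (delta (st i)) = TL_gen n i \<ominus>\<^bsub>TL n\<^esub> \<one>\<^bsub>TL n\<^esub>)"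
    show "h = restrict (theta n) (carrier ?G)"
      by (rule extensionalityI[of _ "carrier ?G"]) (use h theta_unique[of h n] in auto)
  qed simp
  thus ?thesis using q by simp
qed

text \<open>Independence resolves the \<open>THE\<close> in \<open>TL_coeff\<close>. This identity
  is all that the later computation uses about the coefficients.\<close>

theorem TL_coeff_expansion:
  assumes u: "u permutes {1..n}"
  shows "(\<Sum>v\<in>Av n. TL_coeff n v u * wact (rw n v) \<Phi> J) = of_int (sign u) * \<Phi> (u ` J)"
proof -
  let ?P = "\<lambda>g. \<forall>\<Phi> J. (\<Sum>v\<in>Av n. g v * wact (rw n v) \<Phi> J) = of_int (sign u) * \<Phi> (u ` J)"
  have du: "delta u \<in> carrier (sym_group_algebra n)" using u by (intro delta_carrier) (simp add: sym_group_simps)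
  have iff: "TL_theta n (delta u) = finsum (TL n) (\<lambda>v. g v \<odot>\<^bsub>TL n\<^esub> TL_beta n v) (Av n) \<longleftrightarrow> ?P g" for g
  proof -
    have "TL_theta n (delta u) = cls n (beta_comb n g) \<longleftrightarrow> ?P g"
    proof
      assume "TL_theta n (delta u) = cls n (beta_comb n g)"
      hence "beta_comb n g \<in> theta n (delta u)"
        using TL_theta_eq[OF du] mem_cls[OF beta_comb_carrier] by simp
      thus "?P g" by (simp add: theta_def ev_beta_comb sact_delta)
    next
      assume "?P g"
      thus "TL_theta n (delta u) = cls n (beta_comb n g)"
        unfolding TL_theta_eq[OF du] by (intro theta_eq_cls beta_comb_carrier) (simp add: ev_beta_comb sact_delta)
    qed
    thus ?thesis by (simp add: TL_beta_finsum)
  qed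
  obtain g0 where g0: "?P g0" using perm_expansion_exists[OF u] by blast
  define g where "g = restrict g0 (Av n)"
  have g: "g \<in> extensional (Av n)" "?P g" using g0 by (simp_all add: g_def)
  have uniq: "h = g" if "h \<in> extensional (Av n)" "?P h" for h
  proof (rule extensionalityI[OF that(1) g(1)])
    fix v assume v: "v \<in> Av n"
    have "(\<Sum>v\<in>Av n. (h v - g v) * wact (rw n v) \<Phi> J) = 0" for \<Phi> J
      using that(2) g(2) by (simp add: left_diff_distrib sum_subtractf)
    from basis_independent[OF this v] show "h v = g v" by simp
  qed
  have "(THE h. h \<in> extensional (Av n) \<and> ?P h) = g"
    by (rule the_equality, rule conjI[OF g], elim conjE, rule uniq)
  hence "TL_coeff n v u = g v" for v unfolding TL_coeff_def iff by simp
  thus ?thesis using g(2) by simp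
qed

section \<open>The coefficient functional of a block permutation\<close>

lemma less_of_ascents:
  fixes v :: "nat \<Rightarrow> nat"
  assumes "\<And>k. x \<le> k \<Longrightarrow> k < y \<Longrightarrow> v k < v (Suc k)" "x \<le> i" "i < j" "j \<le> y"
  shows "v i < v j"
  using assms(3,4)
proof (induction j)
  case (Suc j)
  have "v j < v (Suc j)" using assms(1,2) Suc.prems by simp
  thus ?case using Suc less_trans by (cases "i = j") auto
qed simp

lemma upward_closed_interval:
  fixes S :: "nat set"
  assumes "S \<subseteq> {x..y}" "\<And>i j. i \<in> S \<Longrightarrow> i < j \<Longrightarrow> j \<le> y \<Longrightarrow> j \<in> S"
  shows "S = {Suc y - card S..y}"
proof (cases "S = {}")
  case False
  have fin: "finite S" using assms(1) finite_subset by blast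
  have "Min S \<in> S" using fin False by simp
  hence "{Min S..y} \<subseteq> S" using assms(2)[of "Min S"] by (auto simp: le_less)
  moreover have "S \<subseteq> {Min S..y}" using fin assms(1) by auto
  ultimately have "S = {Min S..y}" by auto
  moreover have "Min S \<le> y" using \<open>Min S \<in> S\<close> assms(1) by auto
  ultimately have "card S = Suc y - Min S" by (metis card_atLeastAtMost)
  thus ?thesis using \<open>S = {Min S..y}\<close> \<open>Min S \<le> y\<close> by simp
qed simp

lemma downward_closed_interval:
  fixes S :: "nat set"
  assumes "S \<subseteq> {x..y}" "\<And>i j. i \<in> S \<Longrightarrow> j < i \<Longrightarrow> x \<le> j \<Longrightarrow> j \<in> S"
  shows "S = {x..<x + card S}"
proof (cases "S = {}")
  case False
  have fin: "finite S" using assms(1) finite_subset by blast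
  have "Max S \<in> S" using fin False by simp
  hence "{x..Max S} \<subseteq> S" using assms(2)[of "Max S"] by (auto simp: le_less)
  moreover have "S \<subseteq> {x..Max S}" using fin assms(1) by auto
  ultimately have "S = {x..Max S}" by auto
  moreover have "x \<le> Max S" using \<open>Max S \<in> S\<close> assms(1) by auto
  ultimately have "card S = Suc (Max S) - x" by (metis card_atLeastAtMost)
  hence "x + card S = Suc (Max S)" using \<open>x \<le> Max S\<close> by simp
  thus ?thesis using \<open>S = {x..Max S}\<close> atLeastLessThanSuc_atLeastAtMost by metis
qed simp

text \<open>Each of two different such permutations would be smaller than the other at their first
  difference.\<close>

lemma increasing_unique:
  fixes v w :: "nat \<Rightarrow> nat"
  assumes "v permutes {1..n}" "w permutes {1..n}" "v ` I = w ` I"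
    and "\<And>i j. i < j \<Longrightarrow> i \<in> {1..n} \<Longrightarrow> j \<in> {1..n} \<Longrightarrow> i \<in> I \<longleftrightarrow> j \<in> I \<Longrightarrow> v i < v j"
    and "\<And>i j. i < j \<Longrightarrow> i \<in> {1..n} \<Longrightarrow> j \<in> {1..n} \<Longrightarrow> i \<in> I \<longleftrightarrow> j \<in> I \<Longrightarrow> w i < w j"
  shows "v = w"
proof (rule ccontr)
  assume ne: "v \<noteq> w"
  obtain i where i: "\<forall>j<i. v j = w j" "w i < v i"
    using increasing_lex_least[OF assms(1,2,3,5) ne] by blast
  obtain j where j: "\<forall>k<j. w k = v k" "v j < w j"
    using increasing_lex_least[OF assms(2,1) assms(3)[symmetric] assms(4) ne[symmetric]] by blast
  show False using i j by (cases i j rule: linorder_cases) auto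
qed

locale blocks =
  fixes a b c d e f n :: nat
  assumes pos: "a \<ge> 1" "b \<ge> 1" "c \<ge> 1" "d \<ge> 1" "max e f \<ge> 1"
    and n_eq: "a + b + c + d + e + f = n"
begin

text \<open>The words occurring in X and, below, in Y. Y is also needed as a function,
  \<open>target\<close>, whereas X only enters through sums over \<open>source_sets\<close>.\<close>

definition source_sets :: "nat set set" where
  "source_sets = {I. {1..a + e} \<subseteq> I \<and> I \<subseteq> {1..a + e + b + c} \<and> card I = a + c + e}"

definition target_sets :: "nat set set" where
  "target_sets = {J. {b + f + a + d + 1..n} \<subseteq> J \<and> J \<subseteq> {b + f + 1..n} \<and> card J = a + c + e}"

definition target :: "nat set \<Rightarrow> complex" where
  "target J = (if J \<in> target_sets then 1 else 0)"

text \<open>The colouring that \<open>w\<close> carries to \<open>target0\<close>; \<open>w\<close>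
  increases both on it and off it, which determines \<open>w\<close>.\<close>

definition source0 :: "nat set" where
  "source0 = {1..a + e} \<union> {a + e + b + 1..a + e + b + c}"

definition target0 :: "nat set" where
  "target0 = {b + f + 1..b + f + a} \<union> {b + f + a + d + 1..n}"

end

text \<open>A nonzero term of the pairing of Y with beta(v) X that the block symmetries do not
  remove. In lemma names P1, P2, P3 are the position blocks cut after \<open>p\<close> and
  \<open>q\<close>, while L, M, T are the value blocks cut after \<open>l\<close> and
  \<open>h\<close>.\<close>

locale surviving = blocks +
  fixes v :: "nat \<Rightarrow> nat" and I :: "nat set"
  assumes v: "v permutes {1..n}" "avoids_321 v"
    and asc: "\<And>i. 1 \<le> i \<Longrightarrow> i < n \<Longrightarrow> i \<noteq> a + e \<Longrightarrow> i \<noteq> a + e + b + c \<Longrightarrow> v i < v (Suc i)"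
    and inv_asc: "\<And>i. 1 \<le> i \<Longrightarrow> i < n \<Longrightarrow> i \<noteq> b + f \<Longrightarrow> i \<noteq> b + f + a + d \<Longrightarrow>
      inv' v i < inv' v (Suc i)"
    and I: "I \<in> source_sets"
    and nz: "pact v target I \<noteq> 0"
begin

abbreviation p where "p \<equiv> a + e"
abbreviation q where "q \<equiv> a + e + b + c"
abbreviation l where "l \<equiv> b + f"
abbreviation h where "h \<equiv> b + f + a + d"

lemma order: "1 \<le> p" "p < q" "q < n" "1 \<le> l" "l < h" "h < n"
  using pos n_eq by auto

lemma inj: "v i = v j \<longleftrightarrow> i = j"
  using v(1) by (metis permutes_inj injD)

lemma range: "1 \<le> v i \<and> v i \<le> n \<longleftrightarrow> 1 \<le> i \<and> i \<le> n"
  using permutes_in_image[OF v(1), of i] by simp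

lemma fixed: "i < 1 \<or> n < i \<Longrightarrow> v i = i"
  using permutes_not_in[OF v(1), of i] by auto

lemma inversion_range:
  assumes "i < j" "v j < v i" shows "1 \<le> i \<and> j \<le> n"
proof -
  have "1 \<le> i"
  proof (rule ccontr)
    assume "\<not> 1 \<le> i"
    thus False using fixed[of i] assms by simp
  qed
  moreover have "j \<le> n"
  proof (rule ccontr)
    assume "\<not> j \<le> n"
    hence "v j = j" using fixed[of j] by simp
    thus False using \<open>\<not> j \<le> n\<close> assms range[of i] fixed[of i] by linarith
  qed
  ultimately show ?thesis ..
qed

lemma v_inv [simp]: "v (inv' v x) = x" "inv' v (v x) = x"
  using v(1) by (simp_all add: permutes_inverses)

lemma mono1: "i < j \<Longrightarrow> 1 \<le> i \<Longrightarrow> j \<le> p \<Longrightarrow> v i < v j"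
  by (rule less_of_ascents[of 1 p]) (use asc order in auto)

lemma mono2: "i < j \<Longrightarrow> p < i \<Longrightarrow> j \<le> q \<Longrightarrow> v i < v j"
  by (rule less_of_ascents[of "Suc p" q]) (use asc order in auto)

lemma mono3: "i < j \<Longrightarrow> q < i \<Longrightarrow> j \<le> n \<Longrightarrow> v i < v j"
  by (rule less_of_ascents[of "Suc q" n]) (use asc order in auto)

lemma pos_mono1: "v i < v j \<Longrightarrow> 1 \<le> v i \<Longrightarrow> v j \<le> l \<Longrightarrow> i < j"
  using less_of_ascents[of 1 l "inv' v" "v i" "v j"] inv_asc order by auto

lemma pos_mono2: "v i < v j \<Longrightarrow> l < v i \<Longrightarrow> v j \<le> h \<Longrightarrow> i < j"
  using less_of_ascents[of "Suc l" h "inv' v" "v i" "v j"] inv_asc order by auto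

lemma pos_mono3: "v i < v j \<Longrightarrow> h < v i \<Longrightarrow> v j \<le> n \<Longrightarrow> i < j"
  using less_of_ascents[of "Suc h" n "inv' v" "v i" "v j"] inv_asc order by auto

lemma I_P1: "1 \<le> i \<Longrightarrow> i \<le> p \<Longrightarrow> i \<in> I"
  using I unfolding source_sets_def by auto

lemma I_P3: "q < i \<Longrightarrow> i \<notin> I"
  using I unfolding source_sets_def by auto

lemma card_I: "card I = a + c + e"
  using I unfolding source_sets_def by auto

lemma targetD:
  "target J \<noteq> 0 \<Longrightarrow> 1 \<le> x \<Longrightarrow> x \<le> l \<Longrightarrow> x \<notin> J"
  "target J \<noteq> 0 \<Longrightarrow> h < x \<Longrightarrow> x \<le> n \<Longrightarrow> x \<in> J"
  by (force simp: target_def target_sets_def split: if_splits)+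

text \<open>The bounds \<open>l0 = 0\<close> and \<open>h0 = n\<close> switch off the removal at the
  lower and at the upper end.\<close>

lemma peel_I:
  assumes "l0 \<le> l" "h \<le> h0" "h0 \<le> n" "l0 \<le> h0"
    and "\<And>i j. 1 \<le> v j \<Longrightarrow> v j \<le> l0 \<Longrightarrow> i < j \<Longrightarrow> v j < v i \<Longrightarrow> i \<in> I"
    and "\<And>i j. h0 < v i \<Longrightarrow> v i \<le> n \<Longrightarrow> i < j \<Longrightarrow> v j < v i \<Longrightarrow> j \<notin> I"
  shows "(\<forall>i. 1 \<le> v i \<and> v i \<le> l0 \<longrightarrow> i \<notin> I) \<and> (\<forall>i. h0 < v i \<and> v i \<le> n \<longrightarrow> i \<in> I) \<and>
    (\<exists>v' \<pi>. v' permutes {Suc l0..h0} \<and> avoids_321 v' \<and> v = v' \<circ> \<pi> \<and>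
       (\<forall>i j. i < j \<and> l0 < v i \<and> v i \<le> h0 \<and> l0 < v j \<and> v j \<le> h0 \<longrightarrow> \<pi> i < \<pi> j) \<and>
       pact v target I = of_int (sign v * sign v') * pact v' target (\<pi> ` I))"
  by (rule peel[of target l h n v 1 n]) (use v targetD nz assms in auto)

text \<open>Otherwise position 1 has a value in L. Values in L occur from left to right, so no
  smaller value lies to the right of position 1, and its line can be removed at once: it would need
  colour 0, but has colour 1.\<close>

lemma no_P1_to_L:
  assumes "1 \<le> i" "i \<le> p" shows "l < v i"
proof (rule ccontr)
  assume "\<not> l < v i"
  hence v1: "v 1 \<le> l" using mono1[of 1 i] assms by (cases "i = 1") auto
  have first: "j = 1" if "1 \<le> v j" "v j \<le> v 1" for j
    using pos_mono1[of j 1] that v1 inj[of j 1] fixed[of j] range[of j] by (cases "v j = v 1") auto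
  have "\<forall>i. 1 \<le> v i \<and> v i \<le> v 1 \<longrightarrow> i \<notin> I"
  proof (rule conjunct1[OF peel_I[of "v 1" n]])
    fix i j assume *: "1 \<le> v j" "v j \<le> v 1" "i < j" "v j < v i"
    hence "i = 0" using first[of j] by simp
    thus "i \<in> I" using * fixed[of i] by simp
  qed (use v1 order in auto)
  thus False using I_P1[of 1] order range[of 1] by auto
qed

text \<open>The mirror image, with position \<open>n\<close> and the greatest value.\<close>

lemma no_P3_to_T:
  assumes "q < i" "i \<le> n" shows "v i \<le> h"
proof (rule ccontr)
  assume "\<not> v i \<le> h"
  hence vn: "h < v n" using mono3[of i n] assms by (cases "i = n") auto
  have vn': "1 \<le> v n" "v n \<le> n" using range[of n] order by auto
  have last: "j = n" if "v n \<le> v j" "v j \<le> n" for j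
    using pos_mono3[of n j] that vn inj[of j n] fixed[of j] by (cases "v j = v n") auto
  have "\<forall>i. v n - 1 < v i \<and> v i \<le> n \<longrightarrow> i \<in> I"
  proof (rule conjunct1[OF conjunct2[OF peel_I[of 0 "v n - 1"]]])
    fix i j assume *: "v n - 1 < v i" "v i \<le> n" "i < j" "v j < v i"
    hence "i = n" using last[of i] by simp
    thus "j \<notin> I" using * inversion_range[of i j] by simp
  qed (use vn vn' in auto)
  thus False using I_P3[of n] order vn' by auto
qed

text \<open>A line to a value up to \<open>v k\<close> starts at a position up to \<open>k\<close>,
  and \<open>v\<close> increases on P2. So it is crossed from the left only by lines from P1, which
  have colour 1, and \<open>peel_I\<close> applies up to \<open>v k\<close>.\<close>

lemma P2_to_L:
  assumes "p < k" "k \<le> q" "v k \<le> l" shows "k \<notin> I"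
proof -
  have vk: "1 \<le> v k" using range[of k] assms order by simp
  have "\<forall>i. 1 \<le> v i \<and> v i \<le> v k \<longrightarrow> i \<notin> I"
  proof (rule conjunct1[OF peel_I[of "v k" n]])
    fix i j assume *: "1 \<le> v j" "v j \<le> v k" "i < j" "v j < v i"
    have "j \<le> k" using pos_mono1[of j k] * assms(3) inj[of j k] by (cases "v j = v k") auto
    moreover have "\<not> p < i" using mono2[of i j] * \<open>j \<le> k\<close> assms by auto
    ultimately show "i \<in> I" using I_P1[of i] inversion_range[of i j] * by simp
  qed (use assms order range[of k] in auto)
  thus ?thesis using vk by auto
qed

lemma P2_to_T:
  assumes "p < k" "k \<le> q" "h < v k" shows "k \<in> I"
proof -
  have vk: "v k \<le> n" using range[of k] assms order by simp
  have "\<forall>i. v k - 1 < v i \<and> v i \<le> n \<longrightarrow> i \<in> I"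
  proof (rule conjunct1[OF conjunct2[OF peel_I[of 0 "v k - 1"]]])
    fix i j assume *: "v k - 1 < v i" "v i \<le> n" "i < j" "v j < v i"
    have "k \<le> i"
    proof (cases "i = k")
      case False
      hence "v i \<noteq> v k" using inj by simp
      hence "v k < v i" using *(1) by linarith
      thus ?thesis using pos_mono3[of k i] * assms(3) by simp
    qed simp
    moreover have "\<not> j \<le> q" using mono2[of i j] * \<open>k \<le> i\<close> assms by auto
    ultimately show "j \<notin> I" using I_P3[of j] by simp
  qed (use assms order vk in auto)
  thus ?thesis using vk assms by auto
qed

lemma I_split: "I = {1..p} \<union> (I \<inter> {p<..q})" "finite I"
  using I order unfolding source_sets_def by (auto intro: finite_subset)

lemma card_I_P2: "card (I \<inter> {p<..q}) = c"
proof -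
  have "card I = card {1..p} + card (I \<inter> {p<..q})"
    using I_split by (subst I_split(1), subst card_Un_disjoint) auto
  thus ?thesis using card_I by simp
qed

lemma card_P2_diff: "card ({p<..q} - I) = b"
proof -
  have "card ({p<..q} - I) = card {p<..q} - card (I \<inter> {p<..q})"
    by (subst card_Diff_subset_Int) (auto simp: Int_commute)
  thus ?thesis using card_I_P2 by simp
qed

lemma card_positions: "S \<subseteq> {1..n} \<Longrightarrow> card {i. v i \<in> S} = card S"
proof -
  have "{i. v i \<in> S} = inv' v ` S" by (auto simp: image_iff) (metis v_inv(2))
  moreover have "inj (inv' v)" using v(1) by (metis permutes_inv permutes_inj)
  ultimately show ?thesis by (metis card_image inj_on_subset subset_UNIV)
qed

text \<open>A line from the middle block of positions to the middle block of values excludes, by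
  321-avoidance, one of the two kinds of lines that run from an outer block to the opposite
  outer block. The remaining kind then crosses a line of its own colour.\<close>

lemma no_P2_to_M:
  assumes k: "p < k" "k \<le> q" shows "v k \<le> l \<or> h < v k"
proof (rule ccontr)
  assume "\<not> ?thesis"
  hence vk: "l < v k" "v k \<le> h" by auto
  show False
  proof (cases "\<exists>i. 1 \<le> i \<and> i \<le> p \<and> h < v i")
    case False
    have T: "{i. v i \<in> {h<..n}} \<subseteq> I \<inter> {p<..q}"
    proof
      fix i assume "i \<in> {i. v i \<in> {h<..n}}"
      hence i: "h < v i" "1 \<le> i" "i \<le> n" using range[of i] by auto
      hence "p < i" "i \<le> q" using False no_P3_to_T[of i] by (auto simp: not_le[symmetric])
      thus "i \<in> I \<inter> {p<..q}" using P2_to_T[of i] i by simp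
    qed
    have "{h<..n} \<subseteq> {1..n}" by auto
    note cT = card_positions[OF this]
    have "card {h<..n} \<le> c"
      using card_mono[OF _ T] card_I_P2 cT by simp
    \<comment> \<open>T has c + e values, all reached by the c lines of colour 1 from P2. So e = 0
      and f is positive: L has more values than P2 has lines of colour 0, and some line must run
      from P3 to L.\<close>
    hence e: "e = 0" "f \<ge> 1" "card {h<..n} = c" using n_eq pos by auto
    have I2: "{i. v i \<in> {h<..n}} = I \<inter> {p<..q}"
      using card_subset_eq[OF _ T] card_I_P2 cT e by simp
    have "\<exists>j. q < j \<and> 1 \<le> v j \<and> v j \<le> l"
    proof (rule ccontr)
      assume no: "\<nexists>j. q < j \<and> 1 \<le> v j \<and> v j \<le> l"
      have "{i. v i \<in> {1..l}} \<subseteq> {p<..q} - I"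
      proof
        fix i assume "i \<in> {i. v i \<in> {1..l}}"
        hence i: "1 \<le> v i" "v i \<le> l" "1 \<le> i" "i \<le> n" using range[of i] order by auto
        hence "p < i" "i \<le> q" using no no_P1_to_L[of i] by (auto simp: not_le[symmetric])
        thus "i \<in> {p<..q} - I" using P2_to_L[of i] i by simp
      qed
      hence "card {i. v i \<in> {1..l}} \<le> b"
        using card_mono[of "{p<..q} - I" "{i. v i \<in> {1..l}}"] card_P2_diff by simp
      hence "card {1..l} \<le> b" using card_positions[of "{1..l}"] order by simp
      thus False using e by simp
    qed
    then obtain j where j: "q < j" "1 \<le> v j" "v j \<le> l" by blast
    \<comment> \<open>The leftmost position of P3 also has its value in L. All values below
      \<open>v j0\<close> and all of T are removed next, which makes its line the lowest of those
      that remain.\<close>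
    define j0 where "j0 = Suc q"
    have j0: "q < j0" "j0 \<le> n" using order by (auto simp: j0_def)
    have "v j0 \<le> v j" using mono3[of j0 j] j range[of j] order by (cases "j = j0") (auto simp: j0_def)
    hence vj0: "1 \<le> v j0" "v j0 \<le> l" using j range[of j0] order j0 by auto
    have "\<exists>v' \<pi>. v' permutes {Suc (v j0 - 1)..h} \<and> avoids_321 v' \<and> v = v' \<circ> \<pi> \<and>
       (\<forall>i j. i < j \<and> v j0 - 1 < v i \<and> v i \<le> h \<and> v j0 - 1 < v j \<and> v j \<le> h \<longrightarrow> \<pi> i < \<pi> j) \<and>
       pact v target I = of_int (sign v * sign v') * pact v' target (\<pi> ` I)"
    proof (rule conjunct2[OF conjunct2[OF peel_I[of "v j0 - 1" h]]])
      fix x y assume *: "1 \<le> v y" "v y \<le> v j0 - 1" "x < y" "v y < v x"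
      hence "y < j0" using pos_mono1[of y j0] vj0 by simp
      hence "y \<le> q" by (simp add: j0_def)
      hence "\<not> p < x" using mono2[of x y] * by auto
      thus "x \<in> I" using I_P1[of x] inversion_range[of x y] * by simp
    next
      fix x y assume *: "h < v x" "v x \<le> n" "x < y" "v y < v x"
      hence "x \<in> {p<..q}" using I2 by auto
      hence "\<not> y \<le> q" using mono2[of x y] * by auto
      thus "y \<notin> I" using I_P3[of y] by simp
    qed (use vj0 order in auto)
    then obtain v' \<pi> where v': "v' permutes {v j0..h}" "avoids_321 v'" "v = v' \<circ> \<pi>"
      and mono: "\<And>i j. i < j \<Longrightarrow> v j0 \<le> v i \<Longrightarrow> v i \<le> h \<Longrightarrow> v j0 \<le> v j \<Longrightarrow> v j \<le> h \<Longrightarrow> \<pi> i < \<pi> j"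
      and nz': "pact v' target (\<pi> ` I) \<noteq> 0"
      using vj0 nz by (auto simp: Suc_le_eq[symmetric])
    have p': "permutation v'" using v'(1) permutation_permutes by auto
    have inj': "v' x = v' y \<longleftrightarrow> x = y" for x y using v'(1) by (metis permutes_inj injD)
    have v'\<pi>: "v' (\<pi> x) = v x" for x using v'(3) by simp
    have \<pi>: "\<pi> x = inv' v' (v x)" for x
      unfolding v'\<pi>[symmetric] using v'(1) by (simp add: permutes_inverses)
    have inj\<pi>: "\<pi> x = \<pi> y \<longleftrightarrow> x = y" for x y using v'\<pi> inj by metis
    have r: "v' x \<in> {v j0..h} \<longleftrightarrow> x \<in> {v j0..h}" for x using permutes_in_image[OF v'(1)] .
    have lt: "\<pi> k < \<pi> j0" using mono[of k j0] k vk vj0 order j0 by auto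
    moreover have "v j0 \<le> \<pi> k" using r[of "\<pi> k"] vk vj0 by (simp add: v'\<pi>)
    moreover define m where "m = \<pi> j0 - 1"
    ultimately have m: "\<pi> j0 = Suc m" "v j0 \<le> m" "\<pi> k \<le> m" by auto
    have "\<pi> j0 \<le> h" using r[of "\<pi> j0"] vj0 order by (simp add: v'\<pi>)
    hence vm: "v j0 \<le> v' m" "v' m \<le> h" using r[of m] m by auto
    moreover have "v' m \<noteq> v j0" using inj'[of m "\<pi> j0"] m(1) v'\<pi>[of j0] by simp
    ultimately have desc: "v' (Suc m) < v' m" using m(1) v'\<pi>[of j0] by simp
    \<comment> \<open>The left neighbour of the line of \<open>j0\<close> among the remaining lines.
      It starts between \<open>k\<close> and \<open>j0\<close>, hence in P2, and does not end in T,
      so it has colour 0 like \<open>j0\<close>. A descent between equal colours makes the value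
      0.\<close>
    define i1 where "i1 = inv' v (v' m)"
    have vi1: "v i1 = v' m" by (simp add: i1_def)
    hence \<pi>i1: "\<pi> i1 = m" using \<pi>[of i1] v'(1) by (simp add: permutes_inverses)
    have "\<not> i1 < k" using mono[of i1 k] m \<pi>i1 vi1 vm vk vj0 by auto
    moreover have "\<not> j0 < i1" using mono[of j0 i1] m \<pi>i1 vi1 vm vk vj0 order by auto
    moreover have "i1 \<noteq> j0" using \<pi>i1 m by auto
    ultimately have i1: "p < i1" "i1 \<le> q" using k by (auto simp: j0_def)
    have "i1 \<notin> {i. v i \<in> {h<..n}}" using vi1 vm by simp
    hence "i1 \<notin> I" using i1 unfolding I2 by simp
    moreover have "j0 \<notin> I" using I_P3[of j0] j0 by simp
    ultimately have "m \<notin> \<pi> ` I" "Suc m \<notin> \<pi> ` I" using \<pi>i1 m(1) inj\<pi> by auto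
    hence "st m ` \<pi> ` I = \<pi> ` I" by (intro image_st_same) simp
    thus False using nz' pact_descent[OF v'(2) p' desc, of target "\<pi> ` I"] by simp
  next
    case True
    then obtain i where i: "1 \<le> i" "i \<le> p" "h < v i" by blast
    have noL: "\<not> v j \<le> l" if "q < j" "j \<le> n" for j
      using avoids_321D[OF v(2), of i k j] i k vk that by auto
    have L: "{i. v i \<in> {1..l}} \<subseteq> {p<..q} - I"
    proof
      fix i assume "i \<in> {i. v i \<in> {1..l}}"
      hence i: "1 \<le> v i" "v i \<le> l" "1 \<le> i" "i \<le> n" using range[of i] order by auto
      hence "p < i" "i \<le> q" using noL[of i] no_P1_to_L[of i] by (auto simp: not_le[symmetric])
      thus "i \<in> {p<..q} - I" using P2_to_L[of i] i by simp
    qed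
    have "{1..l} \<subseteq> {1..n}" using order by auto
    note cL = card_positions[OF this]
    have "card {1..l} \<le> b"
      using card_mono[OF _ L] card_P2_diff cL by simp
    hence f: "card {1..l} = b" by simp
    have I2: "{i. v i \<in> {1..l}} = {p<..q} - I"
      using card_subset_eq[OF _ L] card_P2_diff cL f by simp
    \<comment> \<open>Mirror image: the rightmost line from P1 ends in T. After removal of L and of
      the values above \<open>v j0\<close>, its right neighbour comes from P2 and has colour 1 as
      well.\<close>
    define j0 where "j0 = p"
    have j0: "1 \<le> j0" "j0 \<le> p" using order by (auto simp: j0_def)
    have vj0: "h < v j0" "v j0 \<le> n" using mono1[of i p] i range[of p] order
      by (cases "i = p"; auto simp: j0_def)+
    have "\<exists>v' \<pi>. v' permutes {Suc l..v j0} \<and> avoids_321 v' \<and> v = v' \<circ> \<pi> \<and>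
       (\<forall>i j. i < j \<and> l < v i \<and> v i \<le> v j0 \<and> l < v j \<and> v j \<le> v j0 \<longrightarrow> \<pi> i < \<pi> j) \<and>
       pact v target I = of_int (sign v * sign v') * pact v' target (\<pi> ` I)"
    proof (rule conjunct2[OF conjunct2[OF peel_I[of l "v j0"]]])
      fix x y assume *: "1 \<le> v y" "v y \<le> l" "x < y" "v y < v x"
      hence "y \<in> {p<..q}" using I2 by auto
      hence "\<not> p < x" using mono2[of x y] * by auto
      thus "x \<in> I" using I_P1[of x] inversion_range[of x y] * by simp
    next
      fix x y assume *: "v j0 < v x" "v x \<le> n" "x < y" "v y < v x"
      hence "p < x" using pos_mono3[of j0 x] vj0 by (simp add: j0_def)
      hence "\<not> y \<le> q" using mono2[of x y] * by auto
      thus "y \<notin> I" using I_P3[of y] by simp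
    qed (use vj0 order in auto)
    then obtain v' \<pi> where v': "v' permutes {Suc l..v j0}" "avoids_321 v'" "v = v' \<circ> \<pi>"
      and mono: "\<And>i j. i < j \<Longrightarrow> l < v i \<Longrightarrow> v i \<le> v j0 \<Longrightarrow> l < v j \<Longrightarrow> v j \<le> v j0 \<Longrightarrow> \<pi> i < \<pi> j"
      and nz': "pact v' target (\<pi> ` I) \<noteq> 0"
      using nz by auto
    have p': "permutation v'" using v'(1) permutation_permutes by auto
    have inj': "v' x = v' y \<longleftrightarrow> x = y" for x y using v'(1) by (metis permutes_inj injD)
    have v'\<pi>: "v' (\<pi> x) = v x" for x using v'(3) by simp
    have \<pi>: "\<pi> x = inv' v' (v x)" for x
      unfolding v'\<pi>[symmetric] using v'(1) by (simp add: permutes_inverses)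
    have inj\<pi>: "\<pi> x = \<pi> y \<longleftrightarrow> x = y" for x y using v'\<pi> inj by metis
    have r: "v' x \<in> {Suc l..v j0} \<longleftrightarrow> x \<in> {Suc l..v j0}" for x using permutes_in_image[OF v'(1)] .
    define m where "m = \<pi> j0"
    have "\<pi> j0 < \<pi> k" using mono[of j0 k] k vk vj0 order j0 by auto
    hence m: "Suc m \<le> \<pi> k" by (simp add: m_def)
    have "l < m" "\<pi> k \<le> v j0" using r[of "\<pi> k"] r[of m] vk vj0 order by (auto simp: v'\<pi> m_def)
    hence vm: "l < v' (Suc m)" "v' (Suc m) \<le> v j0" using r[of "Suc m"] m by auto
    moreover have "v' (Suc m) \<noteq> v j0" using inj'[of "Suc m" "\<pi> j0"] by (simp add: v'\<pi> m_def)
    ultimately have desc: "v' (Suc m) < v' m" using v'\<pi>[of j0] by (simp add: m_def)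
    define i1 where "i1 = inv' v (v' (Suc m))"
    have vi1: "v i1 = v' (Suc m)" by (simp add: i1_def)
    hence \<pi>i1: "\<pi> i1 = Suc m" using \<pi>[of i1] v'(1) by (simp add: permutes_inverses)
    have "\<not> k < i1" using mono[of k i1] m \<pi>i1 vi1 vm vk vj0 by auto
    moreover have "\<not> i1 < j0" using mono[of i1 j0] \<pi>i1 vi1 vm vk vj0 order by (auto simp: m_def)
    moreover have "i1 \<noteq> j0" using \<pi>i1 by (auto simp: m_def)
    ultimately have i1: "p < i1" "i1 \<le> q" using k by (auto simp: j0_def)
    have "i1 \<notin> {i. v i \<in> {1..l}}" using vi1 vm by simp
    hence "i1 \<in> I" using i1 unfolding I2 by simp
    moreover have "j0 \<in> I" using I_P1[of j0] j0 by simp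
    ultimately have "m \<in> \<pi> ` I" "Suc m \<in> \<pi> ` I" using \<pi>i1 m_def by (metis image_eqI)+
    hence "st m ` \<pi> ` I = \<pi> ` I" by (intro image_st_same) simp
    thus False using nz' pact_descent[OF v'(2) p' desc, of target "\<pi> ` I"] by simp
  qed
qed

lemma P2_mem_I: "p < k \<Longrightarrow> k \<le> q \<Longrightarrow> k \<in> I \<longleftrightarrow> h < v k"
  using no_P2_to_M[of k] P2_to_L[of k] P2_to_T[of k] by blast

text \<open>On P2 colour 1 means a value in T. As \<open>v\<close> increases there, these c
  positions are the last ones of P2.\<close>

lemma I_eq: "I = source0"
proof -
  have "I \<inter> {p<..q} = {Suc q - card (I \<inter> {p<..q})..q}"
  proof (rule upward_closed_interval)
    fix i j assume "i \<in> I \<inter> {p<..q}" "i < j" "j \<le> q"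
    thus "j \<in> I \<inter> {p<..q}" using mono2[of i j] P2_mem_I[of i] P2_mem_I[of j] by auto
  qed auto
  also have "\<dots> = {a + e + b + 1..q}" using card_I_P2 by simp
  finally show ?thesis using I_split(1) by (simp add: source0_def)
qed

text \<open>Now L and T can be removed completely. The lines that remain end in M, where positions
  are in order, so they do not cross and the remaining operator is the identity.\<close>

lemma pact_eq_sign: "pact v target I = of_int (sign v)" and image_target: "v ` I \<in> target_sets"
proof -
  have "\<exists>v' \<pi>. v' permutes {Suc l..h} \<and> avoids_321 v' \<and> v = v' \<circ> \<pi> \<and>
     (\<forall>i j. i < j \<and> l < v i \<and> v i \<le> h \<and> l < v j \<and> v j \<le> h \<longrightarrow> \<pi> i < \<pi> j) \<and>
     pact v target I = of_int (sign v * sign v') * pact v' target (\<pi> ` I)"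
  proof (rule conjunct2[OF conjunct2[OF peel_I[of l h]]])
    fix x y assume *: "1 \<le> v y" "v y \<le> l" "x < y" "v y < v x"
    note r = inversion_range[OF *(3,4)]
    show "x \<in> I"
    proof (cases "x \<le> p")
      case False
      have "x \<le> q" using mono3[of x y] * r by (auto simp: not_le[symmetric])
      moreover have "l < v x" by (rule ccontr) (use pos_mono1[of y x] * in simp)
      ultimately show ?thesis using no_P2_to_M[of x] P2_to_T[of x] False by auto
    qed (use I_P1[of x] r in auto)
  next
    fix x y assume *: "h < v x" "v x \<le> n" "x < y" "v y < v x"
    note r = inversion_range[OF *(3,4)]
    show "y \<notin> I"
    proof (cases "q < y")
      case False
      have "p < y" using mono1[of x y] * r by (auto simp: not_le[symmetric])
      moreover have "v y \<le> h" by (rule ccontr) (use pos_mono3[of y x] * in simp)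
      ultimately show ?thesis using no_P2_to_M[of y] P2_to_L[of y] False by auto
    qed (use I_P3[of y] in auto)
  qed (use order in auto)
  then obtain v' \<pi> where v': "v' permutes {Suc l..h}" "v = v' \<circ> \<pi>"
    and mono: "\<And>i j. i < j \<Longrightarrow> l < v i \<Longrightarrow> v i \<le> h \<Longrightarrow> l < v j \<Longrightarrow> v j \<le> h \<Longrightarrow> \<pi> i < \<pi> j"
    and eq: "pact v target I = of_int (sign v * sign v') * pact v' target (\<pi> ` I)"
    by blast
  have v'\<pi>: "v' (\<pi> x) = v x" for x using v'(2) by simp
  have r: "v' x \<in> {Suc l..h} \<longleftrightarrow> x \<in> {Suc l..h}" for x using permutes_in_image[OF v'(1)] .
  have \<pi>: "\<pi> x = inv' v' (v x)" for x
    unfolding v'\<pi>[symmetric] using v'(1) by (simp add: permutes_inverses)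
  have "v' = id"
  proof (rule permutes_ascending_imp_id[OF v'(1)])
    fix k assume k: "Suc l \<le> k" "k < h"
    define i where "i = inv' v (v' k)"
    define j where "j = inv' v (v' (Suc k))"
    have ij: "v i = v' k" "v j = v' (Suc k)" by (simp_all add: i_def j_def)
    have \<pi>ij: "\<pi> i = k" "\<pi> j = Suc k" using \<pi>[of i] \<pi>[of j] ij v'(1) by (simp_all add: permutes_inverses)
    show "v' k < v' (Suc k)"
    proof (rule ccontr)
      assume "\<not> ?thesis"
      moreover have "i \<noteq> j" using \<pi>ij by auto
      hence "v i \<noteq> v j" using inj by simp
      ultimately have lt: "v j < v i" using ij by simp
      hence "j < i" using pos_mono2[of j i] r[of k] r[of "Suc k"] k ij by simp
      thus False using mono[of j i] \<pi>ij r[of k] r[of "Suc k"] k ij by simp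
    qed
  qed
  hence eq': "pact v target I = of_int (sign v) * target (v ` I)" using eq v' by simp
  thus "v ` I \<in> target_sets" using nz by (auto simp: target_def split: if_splits)
  thus "pact v target I = of_int (sign v)" using eq' by (simp add: target_def)
qed

text \<open>Lines of colour 1 into M start in P1. A smaller value in M starts further left, again in
  P1, so the values in question are the first a values of M.\<close>

lemma image_eq: "v ` I = target0"
proof -
  let ?J = "v ` I"
  have J: "{h + 1..n} \<subseteq> ?J" "?J \<subseteq> {l + 1..n}" "card ?J = a + c + e"
    using image_target by (auto simp: target_sets_def)
  have "?J \<inter> {Suc l..h} = {Suc l..<Suc l + card (?J \<inter> {Suc l..h})}"
  proof (rule downward_closed_interval)
    fix x y assume *: "x \<in> ?J \<inter> {Suc l..h}" "y < x" "Suc l \<le> y"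
    then obtain i where i: "x = v i" "i \<in> I" by blast
    have xr: "1 \<le> i" "i \<le> n" using * i range[of i] order by auto
    have "i \<le> p" using i * P2_mem_I[of i] I_P3[of i] by (auto simp: not_le[symmetric])
    define j where "j = inv' v y"
    have vj: "v j = y" by (simp add: j_def)
    have "j < i" using pos_mono2[of j i] * i vj by simp
    moreover have "1 \<le> j" using range[of j] vj * order by simp
    ultimately have "j \<in> I" using I_P1[of j] \<open>i \<le> p\<close> by simp
    thus "y \<in> ?J \<inter> {Suc l..h}" using vj * by auto
  qed auto
  moreover have split: "?J = (?J \<inter> {Suc l..h}) \<union> {h + 1..n}" using J by auto
  moreover have "card (?J \<inter> {Suc l..h}) = a"
  proof -
    have "card ?J = card (?J \<inter> {Suc l..h}) + card {h + 1..n}"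
      by (subst split, rule card_Un_disjoint) auto
    thus ?thesis using J(3) n_eq by simp
  qed
  ultimately show ?thesis by (auto simp: target0_def)
qed

text \<open>Crossing lines of the same colour would both end in T (colour 1) or both in L (colour
  0), where positions are in order.\<close>

lemma increasing:
  assumes "i < j" "i \<in> {1..n}" "j \<in> {1..n}" "i \<in> I \<longleftrightarrow> j \<in> I"
  shows "v i < v j"
proof (rule ccontr)
  assume "\<not> ?thesis"
  hence lt: "v j < v i" using inj[of i j] assms(1) by simp
  show False
  proof (cases "i \<in> I")
    case True
    hence "j \<in> I" using assms by simp
    hence "j \<le> q" using I_P3[of j] by (auto simp: not_le[symmetric])
    moreover have "p < j" using mono1[of i j] lt assms by (auto simp: not_le[symmetric])
    ultimately have "h < v j" using P2_mem_I[of j] \<open>j \<in> I\<close> by simp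
    thus False using pos_mono3[of j i] lt assms range[of i] by simp
  next
    case False
    hence "p < i" using I_P1[of i] assms by (auto simp: not_le[symmetric])
    moreover have "i \<le> q" using mono3[of i j] lt assms by (auto simp: not_le[symmetric])
    ultimately have "v i \<le> l" using P2_mem_I[of i] no_P2_to_M[of i] False by auto
    thus False using pos_mono1[of j i] lt assms range[of j] by simp
  qed
qed

end

section \<open>Comparison with the block permutation\<close>

lemma avoids_321_of_increasing:
  fixes w :: "nat \<Rightarrow> nat"
  assumes "w permutes {1..n}"
    and "\<And>i j. i < j \<Longrightarrow> i \<in> {1..n} \<Longrightarrow> j \<in> {1..n} \<Longrightarrow> i \<in> I \<longleftrightarrow> j \<in> I \<Longrightarrow> w i < w j"
  shows "w \<in> perms_avoiding_321 n"
proof -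
  have False if "i \<in> {1..n}" "j \<in> {1..n}" "k \<in> {1..n}" "i < j" "j < k" "w j < w i" "w k < w j" for i j k
    using assms(2)[of i j] assms(2)[of j k] assms(2)[of i k] that by linarith
  thus ?thesis using assms(1) by (auto simp: perms_avoiding_321_def)
qed

lemma wact_zero: "wact is (\<lambda>_. 0) = (\<lambda>_. 0)"
proof (induction "is")
  case (Cons i "is")
  have "tact i (\<lambda>_. 0) = (\<lambda>_. 0)" by (simp add: tact_def fun_eq_iff)
  with Cons show ?case by simp
qed simp

context blocks
begin

lemma finite_source_sets: "finite source_sets"
  by (rule finite_subset[of _ "Pow {1..a + e + b + c}"]) (auto simp: source_sets_def)

lemma card_image_st: "card (st i ` I) = card I"
  by (rule card_image) (metis bij_st bij_is_inj inj_on_subset subset_UNIV)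

lemma source_sets_st:
  assumes "1 \<le> i" "i \<noteq> a + e" "i \<noteq> a + e + b + c" "I \<in> source_sets"
  shows "st i ` I \<in> source_sets"
proof -
  have "st i ` {1..a + e} = {1..a + e}" "st i ` {1..a + e + b + c} = {1..a + e + b + c}"
    using assms by (intro image_st_same; auto)+
  moreover have "{1..a + e} \<subseteq> I" "I \<subseteq> {1..a + e + b + c}" "card I = a + c + e"
    using assms(4) by (auto simp: source_sets_def)
  ultimately show ?thesis unfolding source_sets_def mem_Collect_eq card_image_st by (metis image_mono)
qed

lemma target_sets_st:
  assumes "i < n" "i \<noteq> b + f" "i \<noteq> b + f + a + d" "J \<in> target_sets"
  shows "st i ` J \<in> target_sets"
proof -
  have "st i ` {b + f + a + d + 1..n} = {b + f + a + d + 1..n}" "st i ` {b + f + 1..n} = {b + f + 1..n}"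
    using assms by (intro image_st_same; auto)+
  moreover have "{b + f + a + d + 1..n} \<subseteq> J" "J \<subseteq> {b + f + 1..n}" "card J = a + c + e"
    using assms(4) by (auto simp: target_sets_def)
  ultimately show ?thesis unfolding target_sets_def mem_Collect_eq card_image_st by (metis image_mono)
qed

text \<open>The swap permutes the words of X, so the two terms given by the last letter cancel in
  the sum.\<close>

lemma sum_source_descent:
  assumes v: "v permutes {1..n}" "avoids_321 v"
    and i: "1 \<le> i" "i \<noteq> a + e" "i \<noteq> a + e + b + c" "v (Suc i) < v i"
  shows "(\<Sum>I\<in>source_sets. pact v Y I) = 0"
proof -
  have p: "permutation v" using v(1) permutation_permutes by auto
  have "bij_betw (image (st i)) source_sets source_sets"
    by (rule bij_betw_byWitness[where f' = "image (st i)"])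
      (use source_sets_st[OF i(1-3)] in auto)
  hence "(\<Sum>I\<in>source_sets. pact (v \<circ> st i) Y (st i ` I)) = (\<Sum>I\<in>source_sets. pact (v \<circ> st i) Y I)"
    by (rule sum.reindex_bij_betw)
  thus ?thesis by (simp add: pact_descent[OF v(2) p i(4)] sum_subtractf)
qed

text \<open>A reduced word can begin with \<open>i\<close>; this letter acts first, and
  \<open>target\<close> is invariant under the swap.\<close>

lemma pact_target_descent:
  assumes v: "v permutes {1..n}" "avoids_321 v"
    and i: "1 \<le> i" "i < n" "i \<noteq> b + f" "i \<noteq> b + f + a + d" "inv' v (Suc i) < inv' v i"
  shows "pact v target I = 0"
proof -
  obtain "is" where "reduced v (i # is)" using reduced_Cons[OF v(1) i(5)] i by auto
  hence "pact v target I = wact is (tact i target) I" using pact_eq[OF v(2)] by simp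
  also have "st i ` J \<in> target_sets \<longleftrightarrow> J \<in> target_sets" for J
    using target_sets_st[OF i(2-4), of J] target_sets_st[OF i(2-4), of "st i ` J"] by auto
  hence "tact i target = (\<lambda>_. 0)" by (simp add: tact_def target_def fun_eq_iff)
  finally show ?thesis by (simp add: wact_zero)
qed

end

locale block_permutation = blocks +
  fixes w :: "nat \<Rightarrow> nat"
  assumes w: "w permutes {1..n}"
    and w_list: "map w [1..<Suc n] =
           [b + f + 1..<Suc (b + f + a)] @ [n - c - e + 1..<Suc (n - c)] @ [1..<Suc b]
           @ [n - c + 1..<Suc n] @ [b + 1..<Suc (b + f)]
           @ [n - d - c - e + 1..<Suc (n - c - e)]"
begin

lemma w_apply:
  assumes "1 \<le> i" "i \<le> n"
  shows "w i = (if i \<le> a then b + f + i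
    else if i \<le> a + e then b + f + d + i
    else if i \<le> a + e + b then i - (a + e)
    else if i \<le> a + e + b + c then d + f + i
    else if i \<le> a + e + b + c + f then i - (a + e + c)
    else i - (e + c))"
proof -
  let ?xs = "[b + f + 1..<Suc (b + f + a)] @ [n - c - e + 1..<Suc (n - c)] @ [1..<Suc b]
           @ [n - c + 1..<Suc n] @ [b + 1..<Suc (b + f)]
           @ [n - d - c - e + 1..<Suc (n - c - e)]"
  have "w i = map w [1..<Suc n] ! (i - 1)" using assms by (simp add: nth_append del: upt_Suc)
  hence wi: "w i = ?xs ! (i - 1)" by (simp only: w_list)
  consider t where "i = Suc t" "t < a" | t where "i = a + Suc t" "t < e"
    | t where "i = a + e + Suc t" "t < b" | t where "i = a + e + b + Suc t" "t < c"
    | t where "i = a + e + b + c + Suc t" "t < f" | t where "i = a + e + b + c + f + Suc t" "t < d"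
  proof -
    consider "i \<le> a" | "a < i" "i \<le> a + e" | "a + e < i" "i \<le> a + e + b"
      | "a + e + b < i" "i \<le> a + e + b + c" | "a + e + b + c < i" "i \<le> a + e + b + c + f"
      | "a + e + b + c + f < i" by linarith
    thus thesis
    proof cases
      case 1 thus ?thesis using that(1)[of "i - 1"] assms by simp
    next
      case 2 thus ?thesis using that(2)[of "i - Suc a"] by simp
    next
      case 3 thus ?thesis using that(3)[of "i - Suc (a + e)"] by simp
    next
      case 4 thus ?thesis using that(4)[of "i - Suc (a + e + b)"] by simp
    next
      case 5 thus ?thesis using that(5)[of "i - Suc (a + e + b + c)"] by simp
    next
      case 6 thus ?thesis using that(6)[of "i - Suc (a + e + b + c + f)"] assms n_eq by simp
    qed
  qed
  thus ?thesis unfolding wi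
    by cases (use n_eq[symmetric] in \<open>simp_all add: nth_append del: upt_Suc\<close>)
qed

lemma w_increasing:
  assumes "i < j" "i \<in> {1..n}" "j \<in> {1..n}" "i \<in> source0 \<longleftrightarrow> j \<in> source0"
  shows "w i < w j"
  using assms n_eq by (auto simp: w_apply source0_def split: if_splits)

lemma w_avoids: "w \<in> perms_avoiding_321 n"
  using avoids_321_of_increasing[OF w w_increasing] .

lemma w_source0: "w ` source0 = target0"
proof (rule card_subset_eq)
  show "w ` source0 \<subseteq> target0" using n_eq
    by (auto simp: w_apply source0_def target0_def split: if_splits)
  have "card source0 = card target0"
    unfolding source0_def target0_def using n_eq by (subst (1 2) card_Un_disjoint) auto
  moreover have "inj_on w source0" using w permutes_inj inj_on_subset by blast
  ultimately show "card (w ` source0) = card target0" by (simp add: card_image)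
qed (simp add: target0_def)

lemma source0_mem: "source0 \<in> source_sets"
proof -
  have "card source0 = a + e + c" unfolding source0_def by (subst card_Un_disjoint) auto
  thus ?thesis by (auto simp: source_sets_def source0_def)
qed

lemma target0_mem: "target0 \<in> target_sets"
proof -
  have "card target0 = a + (c + e)" unfolding target0_def using n_eq by (subst card_Un_disjoint) auto
  thus ?thesis using n_eq by (auto simp: target_sets_def target0_def)
qed

text \<open>The ascents of the inverse follow from \<open>pact_target_descent\<close>. A survivor
  then has the same image of \<open>source0\<close> as \<open>w\<close> and is increasing on both
  parts, which leaves only \<open>w\<close>.\<close>

lemma pact_target_cases:
  assumes v: "v permutes {1..n}" "avoids_321 v"
    and asc: "\<And>i. 1 \<le> i \<Longrightarrow> i < n \<Longrightarrow> i \<noteq> a + e \<Longrightarrow> i \<noteq> a + e + b + c \<Longrightarrow> \<not> v (Suc i) < v i"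
    and I: "I \<in> source_sets" and nz: "pact v target I \<noteq> 0"
  shows "v = w \<and> I = source0 \<and> pact v target I = of_int (sign v)"
proof -
  have neq: "v i \<noteq> v (Suc i)" "inv' v i \<noteq> inv' v (Suc i)" for i
    using v(1) by (metis permutes_inj permutes_inv injD n_not_Suc_n)+
  interpret surviving a b c d e f n v I
  proof unfold_locales
    fix i assume "1 \<le> i" "i < n" "i \<noteq> a + e" "i \<noteq> a + e + b + c"
    thus "v i < v (Suc i)" using asc[of i] neq(1)[of i] by simp
  next
    fix i assume "1 \<le> i" "i < n" "i \<noteq> b + f" "i \<noteq> b + f + a + d"
    thus "inv' v i < inv' v (Suc i)" using pact_target_descent[OF v, of i I] nz neq(2)[of i]
      by (meson linorder_neqE_nat)
  qed (fact v I nz)+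
  have "v = w"
    by (rule increasing_unique[OF v(1) w, of source0])
      (use increasing image_eq w_source0 w_increasing in \<open>auto simp: I_eq\<close>)
  thus ?thesis using I_eq pact_eq_sign by simp
qed

lemma sum_pact_other:
  assumes v: "v \<in> perms_avoiding_321 n" "v \<noteq> w"
  shows "(\<Sum>I\<in>source_sets. pact v target I) = 0"
proof -
  have v': "v permutes {1..n}" "avoids_321 v" using v(1) by (simp_all add: perms_avoiding_321_iff)
  show ?thesis
  proof (cases "\<exists>i. 1 \<le> i \<and> i < n \<and> i \<noteq> a + e \<and> i \<noteq> a + e + b + c \<and> v (Suc i) < v i")
    case True
    thus ?thesis using sum_source_descent[OF v'] by blast
  next
    case False
    hence "pact v target I = 0" if "I \<in> source_sets" for I
      using pact_target_cases[OF v', of I] that v(2) by blast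
    thus ?thesis by simp
  qed
qed

text \<open>If the sum is nonzero, then \<open>w\<close> has no descent inside a position block and
  only the term at \<open>source0\<close> survives. The assumption is discharged in
  \<open>TL_coeff_count\<close>.\<close>

lemma sum_pact_w:
  assumes "(\<Sum>I\<in>source_sets. pact w target I) \<noteq> 0"
  shows "(\<Sum>I\<in>source_sets. pact w target I) = of_int (sign w)"
proof -
  have w': "w permutes {1..n}" "avoids_321 w" using w_avoids by (simp_all add: perms_avoiding_321_iff)
  have asc: "\<not> w (Suc i) < w i" if "1 \<le> i" "i < n" "i \<noteq> a + e" "i \<noteq> a + e + b + c" for i
    using sum_source_descent[OF w', of i] that assms by blast
  obtain I where I: "I \<in> source_sets" "pact w target I \<noteq> 0" using assms by (meson sum.not_neutral_contains_not_neutral)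
  have cases: "J = source0 \<and> pact w target J = of_int (sign w)"
    if "J \<in> source_sets" "pact w target J \<noteq> 0" for J
    using pact_target_cases[OF w', of J] asc that by blast
  have "(\<Sum>J\<in>source_sets. pact w target J) = (\<Sum>J\<in>{source0}. pact w target J)"
    by (rule sum.mono_neutral_right) (use finite_source_sets source0_mem cases in auto)
  also have "\<dots> = of_int (sign w)" using cases[OF I] I(2) by auto
  finally show ?thesis .
qed

end

section \<open>Counting\<close>

text \<open>Such a set arises by adding \<open>L\<close> to a subset of \<open>U - L\<close>. The
  case \<open>m < card L\<close> is separate because truncated subtraction would turn it into a
  binomial coefficient equal to 1.\<close>

lemma card_between:
  assumes "finite U" "L \<subseteq> U"
  shows "card {I. L \<subseteq> I \<and> I \<subseteq> U \<and> card I = m} =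
    (if m < card L then 0 else (card U - card L) choose (m - card L))"
proof (cases "m < card L")
  case True
  have "card I \<noteq> m" if "L \<subseteq> I" "I \<subseteq> U" for I
    using card_mono[of I L] that assms(1) finite_subset True by fastforce
  hence "{I. L \<subseteq> I \<and> I \<subseteq> U \<and> card I = m} = {}" by auto
  thus ?thesis using True by (simp only: card.empty if_True)
next
  case False
  have fin: "finite L" using assms finite_subset by blast
  have "bij_betw (\<lambda>I. I \<union> L) {I. I \<subseteq> U - L \<and> card I = m - card L} {I. L \<subseteq> I \<and> I \<subseteq> U \<and> card I = m}"
  proof (rule bij_betw_byWitness[where f' = "\<lambda>I. I - L"])
    show "(\<lambda>I. I \<union> L) ` {I. I \<subseteq> U - L \<and> card I = m - card L} \<subseteq> {I. L \<subseteq> I \<and> I \<subseteq> U \<and> card I = m}"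
    proof (safe; (use assms(2) in auto; fail)?)
      fix I assume I: "I \<subseteq> U - L" "card I = m - card L"
      have "finite I" using I(1) assms(1) finite_subset by blast
      moreover have "I \<inter> L = {}" using I(1) by auto
      ultimately show "card (I \<union> L) = m" using fin I(2) False by (simp add: card_Un_disjoint)
    qed
    show "(\<lambda>I. I - L) ` {I. L \<subseteq> I \<and> I \<subseteq> U \<and> card I = m} \<subseteq> {I. I \<subseteq> U - L \<and> card I = m - card L}"
      using fin by (auto simp: card_Diff_subset)
  qed auto
  hence "card {I. L \<subseteq> I \<and> I \<subseteq> U \<and> card I = m} = card {I. I \<subseteq> U - L \<and> card I = m - card L}"
    by (simp add: bij_betw_same_card)
  also have "\<dots> = card (U - L) choose (m - card L)" using assms(1) by (intro n_subsets) simp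
  finally show ?thesis using False assms fin by (simp add: card_Diff_subset)
qed

context blocks
begin

context
  fixes u :: "nat \<Rightarrow> nat"
  assumes u: "u permutes {1..n}"
begin

lemma image_mem_target_sets:
  assumes "I \<subseteq> {1..n}" "card I = a + c + e"
  shows "u ` I \<in> target_sets \<longleftrightarrow> {i. b + f + a + d < u i \<and> u i \<le> n} \<subseteq> I \<and> I \<subseteq> {i. b + f < u i}"
proof -
  have inj: "inj u" using u by (rule permutes_inj)
  have "card (u ` I) = a + c + e" using assms(2) inj by (metis card_image inj_on_subset subset_UNIV)
  moreover have "{b + f + a + d + 1..n} \<subseteq> u ` I \<longleftrightarrow> {i. b + f + a + d < u i \<and> u i \<le> n} \<subseteq> I"
  proof
    assume L: "{b + f + a + d + 1..n} \<subseteq> u ` I"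
    show "{i. b + f + a + d < u i \<and> u i \<le> n} \<subseteq> I"
    proof
      fix i assume "i \<in> {i. b + f + a + d < u i \<and> u i \<le> n}"
      hence "u i \<in> u ` I" using L by auto
      thus "i \<in> I" using inj by (simp add: inj_image_mem_iff)
    qed
  next
    assume R: "{i. b + f + a + d < u i \<and> u i \<le> n} \<subseteq> I"
    show "{b + f + a + d + 1..n} \<subseteq> u ` I"
    proof
      fix x assume "x \<in> {b + f + a + d + 1..n}"
      moreover have ux: "u (inv' u x) = x" using u by (simp add: permutes_inverses)
      ultimately have "inv' u x \<in> {i. b + f + a + d < u i \<and> u i \<le> n}" by simp
      hence "inv' u x \<in> I" using R by blast
      thus "x \<in> u ` I" using ux by (metis imageI)
    qed
  qed
  moreover have "u i \<le> n" if "i \<in> I" for i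
    using permutes_in_image[OF u, of i] assms(1) that by auto
  hence "u ` I \<subseteq> {b + f + 1..n} \<longleftrightarrow> I \<subseteq> {i. b + f < u i}" by auto
  ultimately show ?thesis unfolding target_sets_def by blast
qed

lemma count_sets:
  "{I \<in> source_sets. u ` I \<in> target_sets} =
    {I. {1..a + e} \<union> {i. b + f + a + d < u i \<and> u i \<le> n} \<subseteq> I \<and>
        I \<subseteq> {i \<in> {1..a + e + b + c}. b + f < u i} \<and> card I = a + c + e}"
proof (rule Collect_cong)
  fix I
  have "I \<subseteq> {1..n}" if "I \<subseteq> {1..a + e + b + c}" using that n_eq by auto
  thus "(I \<in> source_sets \<and> u ` I \<in> target_sets) \<longleftrightarrow>
    ({1..a + e} \<union> {i. b + f + a + d < u i \<and> u i \<le> n} \<subseteq> I \<and>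
        I \<subseteq> {i \<in> {1..a + e + b + c}. b + f < u i} \<and> card I = a + c + e)"
    using image_mem_target_sets[of I] unfolding source_sets_def by blast
qed

text \<open>A position forced to colour 1 is sent to a value forced to colour 0, or conversely; no
  word satisfies both.\<close>

lemma count_vanishing:
  assumes "(\<exists>i\<in>{1..a + e}. u i \<in> {1..b + f}) \<or>
    (\<exists>i\<in>{a + e + b + c + 1..n}. u i \<in> {b + f + a + d + 1..n})"
  shows "card {I \<in> source_sets. u ` I \<in> target_sets} = 0"
proof -
  have "{I \<in> source_sets. u ` I \<in> target_sets} = {}"
    unfolding count_sets using assms by (auto simp: subset_iff not_less) (metis Suc_le_eq not_less)+
  thus ?thesis by (simp only: card.empty)
qed

text \<open>Colour 1 is forced on P1 and on the positions of P2 sent to T, and excluded on those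
  sent to L. On P2 this leaves A + B free positions, of which A must receive colour 1.\<close>

lemma count_nonvanishing:
  assumes no: "\<not> ((\<exists>i\<in>{1..a + e}. u i \<in> {1..b + f}) \<or>
    (\<exists>i\<in>{a + e + b + c + 1..n}. u i \<in> {b + f + a + d + 1..n}))"
  defines "A \<equiv> int c - int (card ({a + e + 1..a + e + b + c} \<inter> u -` {b + f + a + d + 1..n}))"
    and "B \<equiv> int b - int (card ({a + e + 1..a + e + b + c} \<inter> u -` {1..b + f}))"
  shows "card {I \<in> source_sets. u ` I \<in> target_sets} =
    (if A < 0 \<or> B < 0 then 0 else nat (A + B) choose nat A)"
proof -
  let ?S = "{a + e + 1..a + e + b + c}"
  let ?T = "?S \<inter> u -` {b + f + a + d + 1..n}" and ?L = "?S \<inter> u -` {1..b + f}"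
  let ?lower = "{1..a + e} \<union> {i. b + f + a + d < u i \<and> u i \<le> n}"
  let ?upper = "{i \<in> {1..a + e + b + c}. b + f < u i}"
  have range: "1 \<le> u i \<and> u i \<le> n \<longleftrightarrow> 1 \<le> i \<and> i \<le> n" for i
    using permutes_in_image[OF u, of i] by simp
  have P1: "b + f < u i" if "1 \<le> i" "i \<le> a + e" for i
    using no range[of i] that n_eq by (force simp: not_less)
  have P3: "u i \<le> b + f + a + d" if "a + e + b + c < i" "i \<le> n" for i
    using no range[of i] that by (force simp: not_less)
  have lower: "?lower = {1..a + e} \<union> ?T"
  proof -
    have "i \<le> a + e + b + c \<and> 1 \<le> i" if "b + f + a + d < u i" "u i \<le> n" for i
      using P3[of i] range[of i] that by (auto simp: not_less[symmetric])
    thus ?thesis by fastforce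
  qed
  have upper: "?upper = {1..a + e} \<union> (?S - ?L)"
  proof -
    have "1 \<le> u i" if "i \<in> ?S" for i using range[of i] that n_eq by simp
    thus ?thesis using P1 by (auto simp: not_le not_less Suc_le_eq)
  qed
  have sub: "?lower \<subseteq> ?upper" unfolding lower upper by auto
  have cl: "card ?lower = a + e + card ?T" unfolding lower by (subst card_Un_disjoint) auto
  have "card ?upper = a + e + card (?S - ?L)" unfolding upper by (subst card_Un_disjoint) auto
  also have "card (?S - ?L) = b + c - card ?L" by (subst card_Diff_subset) auto
  finally have cu: "card ?upper = a + e + (b + c - card ?L)" .
  have le: "card ?L \<le> b + c" using card_mono[of ?S ?L] by simp
  have "card ?lower \<le> card ?upper" using sub by (intro card_mono) simp_all
  hence le': "card ?T + card ?L \<le> b + c" unfolding cl cu using le by simp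
  have "card {I \<in> source_sets. u ` I \<in> target_sets} =
      (if a + c + e < card ?lower then 0 else (card ?upper - card ?lower) choose (a + c + e - card ?lower))"
    unfolding count_sets by (rule card_between[OF _ sub]) simp
  also have "\<dots> = (if c < card ?T then 0 else (b + c - card ?L - card ?T) choose (c - card ?T))"
    unfolding cl cu by simp
  also have "\<dots> = (if A < 0 \<or> B < 0 then 0 else nat (A + B) choose nat A)"
  proof (cases "c < card ?T \<or> b < card ?L")
    case True
    hence "A < 0 \<or> B < 0" by (auto simp: A_def B_def)
    \<comment> \<open>Here B is negative, and more positions would have to be chosen than are free;
      \<open>le'\<close> keeps the truncated subtraction exact.\<close>
    moreover have "(b + c - card ?L - card ?T) choose (c - card ?T) = 0" if "\<not> c < card ?T"
      using that True le' by (intro binomial_eq_0) linarith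
    ultimately show ?thesis by simp
  next
    case False
    hence "nat A = c - card ?T" "nat (A + B) = b + c - card ?L - card ?T" "\<not> (A < 0 \<or> B < 0)"
      by (auto simp: A_def B_def nat_diff_distrib)
    thus ?thesis using False by simp
  qed
  finally show ?thesis .
qed

end

end

context block_permutation
begin

text \<open>Pairing the expansion of theta(u) with X and Y leaves only the term of \<open>w\<close>
  on one side and a signed count of words on the other.\<close>

lemma TL_coeff_count:
  assumes u: "u permutes {1..n}"
  shows "TL_coeff n w u = of_int (sign w * sign u) * of_nat (card {I \<in> source_sets. u ` I \<in> target_sets})"
proof -
  let ?\<phi> = "\<Sum>I\<in>source_sets. pact w target I"
  have pact: "pact v = wact (rw n v)" if "v \<in> Av n" for v
    using that rw(2)[of v n] by (intro pact_eq) (simp_all add: perms_avoiding_321_iff)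
  have eq: "TL_coeff n w t * ?\<phi> = of_int (sign t) * of_nat (card {I \<in> source_sets. t ` I \<in> target_sets})"
    if t: "t permutes {1..n}" for t
  proof -
    have "(\<Sum>I\<in>source_sets. \<Sum>v\<in>Av n. TL_coeff n v t * pact v target I)
        = (\<Sum>I\<in>source_sets. \<Sum>v\<in>Av n. TL_coeff n v t * wact (rw n v) target I)"
      by (intro sum.cong refl) (simp add: pact)
    also have "\<dots> = (\<Sum>I\<in>source_sets. of_int (sign t) * target (t ` I))"
      by (simp add: TL_coeff_expansion[OF t])
    also have "\<dots> = of_int (sign t) * of_nat (card {I \<in> source_sets. t ` I \<in> target_sets})"
      using finite_source_sets
      by (simp add: target_def sum.If_cases Int_def flip: sum_distrib_left)
    finally have "(\<Sum>v\<in>Av n. TL_coeff n v t * (\<Sum>I\<in>source_sets. pact v target I))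
        = of_int (sign t) * of_nat (card {I \<in> source_sets. t ` I \<in> target_sets})"
      by (subst (asm) sum.swap) (simp add: sum_distrib_left)
    moreover have "(\<Sum>v\<in>Av n. TL_coeff n v t * (\<Sum>I\<in>source_sets. pact v target I))
        = (\<Sum>v\<in>{w}. TL_coeff n v t * (\<Sum>I\<in>source_sets. pact v target I))"
      by (rule sum.mono_neutral_right) (use w_avoids sum_pact_other in auto)
    ultimately show ?thesis by simp
  qed
  \<comment> \<open>The identity at \<open>w\<close> itself: the count is positive, so the pairing
    of beta(w) cannot vanish.\<close>
  have "source0 \<in> {I \<in> source_sets. w ` I \<in> target_sets}"
    using source0_mem target0_mem w_source0 by simp
  hence "card {I \<in> source_sets. w ` I \<in> target_sets} \<noteq> 0"
    using finite_source_sets by auto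
  hence "?\<phi> \<noteq> 0" using eq[OF w] by (auto simp: sign_def split: if_splits)
  hence \<phi>: "?\<phi> = of_int (sign w)" by (rule sum_pact_w)
  have "TL_coeff n w u = TL_coeff n w u * of_int (sign w) * of_int (sign w)"
    by (simp add: sign_def)
  also have "\<dots> = of_int (sign w * sign u) * of_nat (card {I \<in> source_sets. u ` I \<in> target_sets})"
    using eq[OF u] unfolding \<phi> by simp
  finally show ?thesis .
qed

end

section \<open>Reading coefficients off the immanant\<close>

lemma lookup_perm_monomial:
  "Poly_Mapping.lookup (perm_monomial n u) (i, j) = (if i \<in> {1..n} \<and> j = u i then 1 else 0)"
proof -
  have "Poly_Mapping.lookup (perm_monomial n u) (i, j) = (\<Sum>k\<in>{1..n}. if k = i then if j = u i then 1 else 0 else 0)"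
    unfolding perm_monomial_def lookup_sum by (intro sum.cong refl) (auto simp: lookup_single when_def)
  thus ?thesis by (simp add: sum.delta)
qed

lemma perm_monomial_inj:
  assumes "u permutes {1..n}" "v permutes {1..n}" "perm_monomial n u = perm_monomial n v"
  shows "u = v"
proof
  fix i show "u i = v i"
  proof (cases "i \<in> {1..n}")
    case True
    have "Poly_Mapping.lookup (perm_monomial n u) (i, u i) = Poly_Mapping.lookup (perm_monomial n v) (i, u i)"
      using assms(3) by simp
    with True show ?thesis by (simp add: lookup_perm_monomial split: if_splits)
  qed (use assms permutes_not_in in metis)
qed

lemma lookup_TL_immanant:
  assumes "u permutes {1..n}"
  shows "Poly_Mapping.lookup (TL_immanant n w) (perm_monomial n u) = TL_coeff n w u"
proof -
  have "Poly_Mapping.lookup (TL_immanant n w) (perm_monomial n u)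
      = (\<Sum>v | v permutes {1..n}. if v = u then TL_coeff n w v else 0)"
    unfolding TL_immanant_def lookup_sum
    by (intro sum.cong refl) (use perm_monomial_inj[OF _ assms] in \<open>auto simp: lookup_single when_def\<close>)
  thus ?thesis using assms by (simp add: finite_permutations sum.delta)
qed

theorem theorem5p12:
  fixes a b c d e f n :: nat and w u :: "nat \<Rightarrow> nat"
  assumes "a \<ge> 1" "b \<ge> 1" "c \<ge> 1" "d \<ge> 1" "max e f \<ge> 1"
    and "a + b + c + d + e + f = n"
    and "w permutes {1..n}"
    and "map w [1..<Suc n] =
           [b + f + 1..<Suc (b + f + a)] @ [n - c - e + 1..<Suc (n - c)] @ [1..<Suc b]
           @ [n - c + 1..<Suc n] @ [b + 1..<Suc (b + f)]
           @ [n - d - c - e + 1..<Suc (n - c - e)]"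
    and "u permutes {1..n}"
  shows "Poly_Mapping.lookup (TL_immanant n w) (perm_monomial n u) = TL_coeff n w u \<and>
    (let vanishing =
           (\<exists>i\<in>{1..a + e}. u i \<in> {1..b + f}) \<or>
           (\<exists>i\<in>{a + e + b + c + 1..n}. u i \<in> {b + f + a + d + 1..n});
         A = int c - int (card ({a + e + 1..a + e + b + c} \<inter> u -` {b + f + a + d + 1..n}));
         B = int b - int (card ({a + e + 1..a + e + b + c} \<inter> u -` {1..b + f}))
     in (vanishing \<longrightarrow> TL_coeff n w u = 0) \<and>
        (\<not> vanishing \<longrightarrow> TL_coeff n w u =
           of_int (sign w * sign u) *
           (if A < 0 \<or> B < 0 then 0 else of_nat (nat (A + B) choose nat A))))"
proof -
  interpret block_permutation a b c d e f n w
    by unfold_locales (fact assms)+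
  note count = TL_coeff_count[OF assms(9)]
  show ?thesis unfolding Let_def
  proof (intro conjI impI, goal_cases)
    case 1 show ?case using assms(9) by (rule lookup_TL_immanant)
  next
    case 2 thus ?case unfolding count by (subst count_vanishing[OF assms(9)]) simp_all
  next
    case 3 show ?case unfolding count count_nonvanishing[OF assms(9) 3] by simp
  qed
qed

end
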